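(* Let $T>0$ and let $g:\mathbb{R}\times[0,+\infty)\to\mathbb{R}$ be a continuous function, $T$-periodic in its first variable. For each integer $j>0$ put $\mu_j=(\pi j/T)^2$ and let $\psi_j:\mathbb{R}\to\mathbb{R}$ be the $T/j$-periodic function with $\psi_j(t)=\sin(\sqrt{\mu_j}\,t)$ for $t\in[0,T/j]$. Let $N>0$ be an integer and assume that there exists a constant $\hat\eta$ such that $$\mu_N x-\hat\eta\le g(t,x)\le\mu_{N+1}x+\hat\eta\qquad\text{for every } t\in[0,T]\text{ and every } x>0 .$$ Assume moreover that, for every $\tau\in[0,T]$, $$\int_0^T\limsup_{x\to+\infty}\bigl(g(t,x)-\mu_{N+1}x\bigr)\,\psi_{N+1}(t+\tau)\,dt<0$$ and $$\int_0^T\liminf_{x\to+\infty}\bigl(g(t,x)-\mu_{N}x\bigr)\,\psi_{N}(t+\tau)\,dt>0 .$$ Then there exists a $T$-periodic $0$-bouncing solution, defined on $\mathbb{R}$, of the equation $x''+g(t,x)=0$.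
   Context: **Bouncing solutions.** Let $w\in\mathbb{R}$ and let $p:\mathbb{R}\times[w,+\infty)\to\mathbb{R}$ be continuous. A $w$-bouncing solution of $x''+p(t,x)=0$ is a continuous function $x$ defined on some interval $(a,b)$ (possibly $\mathbb{R}$), with $x(t)\ge w$ for every $t\in(a,b)$, such that: (i) if $t_0\in(a,b)$ and $x(t_0)>w$, then $x$ is twice differentiable at $t_0$ and $x''(t_0)+p(t_0,x(t_0))=0$; (ii) if $t_0\in(a,b)$, $x(t_0)=w$ and, in a neighborhood of $t_0$, $x(t)>w$ for $t\ne t_0$, then the one-sided derivatives $x'(t_0^-)$ and $x'(t_0^+)$ exist and $x'(t_0^-)=-x'(t_0^+)$; (iii) if $t_0\in(a,b)$, $x(t_0)=w$ and either $x'(t_0^-)$ or $x'(t_0^+)$ exists and is different from $0$, then, in a neighborhood of $t_0$, $x(t)>w$ for $t\ne t_0$; (iv) if $x(t)=w$ for all $t$ in a non-trivial interval $I\subseteq(a,b)$, then $p(t,w)\ge 0$ for every $t\in I$. Here $w=0$ and $p=g$. *)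

theory Defs
  imports "HOL-Analysis.Analysis" "HOL-Library.Real_Mod"
begin

text \<open>The solution lives on the open interval with extended-real endpoints \<open>a < b\<close>; only the
  values of \<open>x\<close> on that interval and of \<open>p\<close> on \<open>\<real> \<times> [w, \<infinity>)\<close> matter.  One-sided derivatives are finite.\<close>

definition bouncing_solution ::
    "real \<Rightarrow> (real \<Rightarrow> real \<Rightarrow> real) \<Rightarrow> ereal \<Rightarrow> ereal \<Rightarrow> (real \<Rightarrow> real) \<Rightarrow> bool" where
  "bouncing_solution w p a b x \<longleftrightarrow>
     a < b \<and> continuous_on (einterval a b) x \<and> (\<forall>t\<in>einterval a b. w \<le> x t) \<and>
     (\<forall>t\<^sub>0\<in>einterval a b. w < x t\<^sub>0 \<longrightarrow>
        (\<exists>x' x''. (\<forall>\<^sub>F t in nhds t\<^sub>0. (x has_real_derivative x' t) (at t)) \<and>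
                  (x' has_real_derivative x'') (at t\<^sub>0) \<and> x'' + p t\<^sub>0 (x t\<^sub>0) = 0)) \<and>
     (\<forall>t\<^sub>0\<in>einterval a b. x t\<^sub>0 = w \<and> (\<forall>\<^sub>F t in at t\<^sub>0. w < x t) \<longrightarrow>
        (\<exists>l r. (x has_real_derivative l) (at_left t\<^sub>0) \<and>
               (x has_real_derivative r) (at_right t\<^sub>0) \<and> l = - r)) \<and>
     (\<forall>t\<^sub>0\<in>einterval a b. x t\<^sub>0 = w \<and>
        (\<exists>d. d \<noteq> 0 \<and> ((x has_real_derivative d) (at_left t\<^sub>0) \<or>
                      (x has_real_derivative d) (at_right t\<^sub>0))) \<longrightarrow>
        (\<forall>\<^sub>F t in at t\<^sub>0. w < x t)) \<and>
     (\<forall>I. is_interval I \<and> I \<subseteq> einterval a b \<and> (\<exists>s\<in>I. \<exists>t\<in>I. s < t) \<and> (\<forall>t\<in>I. x t = w) \<longrightarrow>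
        (\<forall>t\<in>I. 0 \<le> p t w))"

definition mu :: "real \<Rightarrow> nat \<Rightarrow> real" where
  "mu T j = (pi * real j / T)\<^sup>2"

definition psi :: "real \<Rightarrow> nat \<Rightarrow> real \<Rightarrow> real" where
  "psi T j t = sin (sqrt (mu T j) * (t rmod (T / real j)))"

lemma psi_eq:
  assumes "T > 0" "j > 0" "t \<in> {0..T / real j}"
  shows "psi T j t = sin (sqrt (mu T j) * t)"
proof (cases "t = T / real j")
  case True
  with assms show ?thesis by (simp add: psi_def mu_def rmod_def)
next
  case False
  with assms show ?thesis by (simp add: psi_def rmod_idem)
qed

lemma psi_periodic:
  assumes "T > 0" "j > 0"
  shows "psi T j (t + T / real j) = psi T j t"
proof -
  have "(t + c) rmod c = t rmod c" if "c > 0" for c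
    using that by (simp add: rmod_conv_frac add_divide_distrib frac_1_eq)
  from this[of "T / real j"] assms show ?thesis by (simp add: psi_def)
qed

text \<open>Integral of an extended-real function, as positive part minus negative part
  (\<^const>\<open>e2ennreal\<close> maps negative numbers to \<open>0\<close>).  It has the usual meaning when at least one of
  the two parts is finite; for \<open>\<infinity> - \<infinity>\<close> the value is \<open>\<infinity>\<close> by the convention of
  \<^typ>\<open>ereal\<close>.\<close>

definition ereal_integral :: "'a measure \<Rightarrow> ('a \<Rightarrow> ereal) \<Rightarrow> ereal" where
  "ereal_integral M f =
     enn2ereal (\<integral>\<^sup>+ t. e2ennreal (f t) \<partial>M) - enn2ereal (\<integral>\<^sup>+ t. e2ennreal (- f t) \<partial>M)"

end

theory Submission
  imports Defs "HOL-Complex_Analysis.Great_Picard"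
begin

text \<open>In the quotient of the half-plane \<open>x \<ge> 0\<close> by \<open>(0, v) \<sim> (0, -v)\<close>, which is a plane, a bounce is
  invisible and the harmonic oscillator with bounces is a rotation.  The return map over one period
  has a fixed point by Brouwer's theorem, provided that no point of a large circle is mapped to a
  multiple larger than \<open>1\<close> of itself.  A large motion with this property would make an integer number of
  turns, whereas a Fatou argument with the Landesman--Lazer conditions shows that it makes strictly
  more than \<open>N\<close> and strictly fewer than \<open>N + 1\<close> of them.

  Since \<open>g\<close> is only continuous and does not vanish at \<open>x = 0\<close>, the return map is realised by Euler polygons
  of the equation \<open>x'' = - g(t,x) + \<epsilon>\<^sup>2/x\<^sup>3\<close>, the radial equation of a planar motion of angular momentum \<open>\<epsilon>\<close>;
  the mesh is refined first and then \<open>\<epsilon> \<rightarrow> 0\<close>.\<close>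

section \<open>Approximate solutions and a radial fixed point theorem\<close>

text \<open>At \<epsilon> = 0 the field in the glued coordinates contains the term 2 x' g(t,x), and
  x' changes sign across the gluing line x = 0. Unless g(t,0) = 0 the field jumps there, so not even
  Peano's theorem applies. The angular momentum keeps x positive and makes the field continuous. It
  still need not be Lipschitz, so the equation may have no return map; only the Euler step is a
  continuous map of the initial point. What has to survive both limits is the alternative
  \<open>\<mu> = 1 \<or> norm z = R\<close> together with \<open>P z = \<mu> *\<^sub>R z\<close>.

  The lower estimate for the number of turns measures angles with the frequency of
  \<open>mu T N\<close>, the upper one with that of \<open>mu T (N + 1)\<close>, and these angles
  differ in general. They agree over a period in which a motion returns to a positive multiple of
  itself, since they are integer multiples of 2 pi that vary continuously with the frequency.

  The limiting equations admit a point at rest on the wall whatever the sign of g(t,0). Clause (iv)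
  of the definition therefore has to be extracted from the regularised velocities.\<close>

primrec euler :: "(real \<Rightarrow> 'a \<Rightarrow> 'a::real_vector) \<Rightarrow> real \<Rightarrow> 'a \<Rightarrow> nat \<Rightarrow> 'a" where
  "euler F h z 0 = z"
| "euler F h z (Suc k) = euler F h z k + h *\<^sub>R F (real k * h) (euler F h z k)"

text \<open>The factor \<open>max 0 (min h (t - real k * h))\<close> is the time spent in the k-th
  mesh cell up to t. The polygon thus becomes one linear formula in the node values of F, without
  locating the cell that contains t.\<close>

definition euler_path :: "(real \<Rightarrow> 'a \<Rightarrow> 'a::real_vector) \<Rightarrow> real \<Rightarrow> nat \<Rightarrow> 'a \<Rightarrow> real \<Rightarrow> 'a" where
  "euler_path F h n z t =
     z + (\<Sum>k<n. max 0 (min h (t - real k * h)) *\<^sub>R F (real k * h) (euler F h z k))"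

lemma euler_sum: "euler F h z k = z + (\<Sum>j<k. h *\<^sub>R F (real j * h) (euler F h z j))"
  by (induction k) auto

lemma euler_path_node:
  assumes "0 \<le> h" "k \<le> n"
  shows "euler_path F h n z (real k * h) = euler F h z k"
proof -
  define f where "f j = F (real j * h) (euler F h z j)" for j
  have c: "max 0 (min h (real k * h - real j * h)) = (if j < k then h else 0)" for j
  proof (cases "j < k")
    case True
    then have "1 * h \<le> (real k - real j) * h" using assms(1) by (intro mult_right_mono) auto
    with True assms(1) show ?thesis by (simp add: algebra_simps)
  next
    case False
    then have "real k * h \<le> real j * h" using assms(1) by (intro mult_right_mono) auto
    with False assms(1) show ?thesis by simp
  qed
  have "(\<Sum>j<n. (if j < k then h else 0) *\<^sub>R f j) = (\<Sum>j<k. h *\<^sub>R f j)"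
    using assms(2) by (intro sum.mono_neutral_cong_right) auto
  then show ?thesis
    unfolding euler_path_def euler_sum[of F h z k] c f_def by simp
qed

lemma clamp_sum:
  fixes h t :: real
  assumes "0 \<le> h"
  shows "(\<Sum>k<n. max 0 (min h (t - real k * h))) = max 0 (min (real n * h) t)"
proof (induction n)
  case (Suc n)
  define a where "a = real n * h"
  have "0 \<le> a" using assms by (simp add: a_def)
  then have "max 0 (min a t) + max 0 (min h (t - a)) = max 0 (min (a + h) t)"
    using assms by (auto simp: max_def min_def)
  then show ?case using Suc by (simp add: a_def algebra_simps)
qed (auto simp: max_def min_def)

text \<open>The increment combines node values of F with nonnegative weights, the times spent in the
  cells, which add up to t - s. Only cells that meet [s, t] contribute, so a node may lie up to h
  before s. With v = 0 this is the Lipschitz bound of the polygons; with v a value of F at a limit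
  point it yields the derivative of their limit.\<close>

lemma euler_path_increment:
  assumes h: "0 \<le> h" and st: "0 \<le> s" "s \<le> t" "t \<le> real n * h"
    and \<delta>: "\<And>k. k < n \<Longrightarrow> s - h \<le> real k * h \<Longrightarrow> real k * h \<le> t \<Longrightarrow>
           norm (F (real k * h) (euler F h z k) - v) \<le> \<delta>"
  shows "norm (euler_path F h n z t - euler_path F h n z s - (t - s) *\<^sub>R v) \<le> \<delta> * (t - s)"
proof -
  define c where "c r k = max 0 (min h (r - real k * h))" for r k
  define f where "f k = F (real k * h) (euler F h z k)" for k
  have sum_c: "(\<Sum>k<n. c t k - c s k) = t - s"
    unfolding sum_subtractf c_def clamp_sum[OF h] using st by (auto simp: max_def min_def)
  have "euler_path F h n z t - euler_path F h n z s - (t - s) *\<^sub>R v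
      = (\<Sum>k<n. (c t k - c s k) *\<^sub>R f k) - (\<Sum>k<n. c t k - c s k) *\<^sub>R v"
    unfolding sum_c euler_path_def
    by (simp add: c_def f_def scaleR_left_diff_distrib sum_subtractf)
  also have "\<dots> = (\<Sum>k<n. (c t k - c s k) *\<^sub>R (f k - v))"
    by (subst scaleR_sum_left) (simp add: scaleR_right_diff_distrib flip: sum_subtractf)
  also have "norm \<dots> \<le> (\<Sum>k<n. (c t k - c s k) * \<delta>)"
  proof (rule sum_norm_le)
    fix k assume "k \<in> {..<n}"
    have mono: "c s k \<le> c t k" using st unfolding c_def by (auto simp: max_def min_def)
    show "norm ((c t k - c s k) *\<^sub>R (f k - v)) \<le> (c t k - c s k) * \<delta>"
    proof (cases "c t k = c s k")
      case False
      then have "s - h \<le> real k * h" "real k * h \<le> t"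
        using st h unfolding c_def by (auto simp: max_def min_def split: if_splits)
      then have "norm (f k - v) \<le> \<delta>" using \<delta> \<open>k \<in> {..<n}\<close> unfolding f_def by auto
      then show ?thesis using mono by (simp add: mult_left_mono)
    qed simp
  qed
  also have "\<dots> = \<delta> * (t - s)" using sum_c by (metis sum_distrib_right mult.commute)
  finally show ?thesis .
qed

text \<open>Discrete Gronwall inequality: each step multiplies 1 + norm by at most 1 + K h, hence by
  at most exp (K h).\<close>

lemma euler_growth:
  fixes F :: "real \<Rightarrow> 'a \<Rightarrow> 'a::real_normed_vector"
  assumes h: "0 \<le> h" "real n * h \<le> T" and K: "0 \<le> K"
    and growth: "\<And>t w. t \<in> {0..T} \<Longrightarrow> norm (F t w) \<le> K * (1 + norm w)"
    and "k \<le> n"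
  shows "1 + norm (euler F h z k) \<le> exp (K * T) * (1 + norm z)"
proof -
  have "1 + norm (euler F h z k) \<le> exp (K * (real k * h)) * (1 + norm z)"
    using \<open>k \<le> n\<close>
  proof (induction k)
    case (Suc k)
    let ?e = "euler F h z k"
    have "real k * h \<le> real n * h" using Suc.prems h by (intro mult_right_mono) auto
    then have *: "norm (F (real k * h) ?e) \<le> K * (1 + norm ?e)" using h by (intro growth) auto
    have "1 + norm (euler F h z (Suc k)) \<le> 1 + norm ?e + h * norm (F (real k * h) ?e)"
      using norm_triangle_ineq[of ?e "h *\<^sub>R F (real k * h) ?e"] h by simp
    also have "\<dots> \<le> 1 + norm ?e + h * (K * (1 + norm ?e))"
      using * h by (intro add_left_mono mult_left_mono) auto
    also have "\<dots> = (1 + K * h) * (1 + norm ?e)" by (simp add: algebra_simps)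
    also have "\<dots> \<le> exp (K * h) * (exp (K * (real k * h)) * (1 + norm z))"
      using Suc h by (intro mult_mono exp_ge_add_one_self) auto
    also have "\<dots> = exp (K * (real (Suc k) * h)) * (1 + norm z)"
      by (simp add: algebra_simps flip: exp_add)
    finally show ?case .
  qed simp
  also have "real k * h \<le> T"
    using mult_right_mono[of "real k" "real n" h] \<open>k \<le> n\<close> h by auto
  then have "exp (K * (real k * h)) * (1 + norm z) \<le> exp (K * T) * (1 + norm z)"
    using K by (intro mult_right_mono) (auto intro: mult_left_mono)
  finally show ?thesis .
qed

text \<open>For a fixed mesh the end point is a finite composition of continuous maps, so Brouwer's
  theorem applies even where solutions of the equation branch.\<close>

lemma euler_continuous:
  fixes F :: "real \<Rightarrow> 'a \<Rightarrow> 'a::real_normed_vector"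
  assumes cont: "continuous_on ({0..T} \<times> UNIV) (\<lambda>(t, w). F t w)"
    and h: "0 \<le> h" "real n * h \<le> T" and "k \<le> n"
  shows "continuous_on UNIV (\<lambda>z. euler F h z k)"
  using \<open>k \<le> n\<close>
proof (induction k)
  case (Suc k)
  have "real k * h \<le> real n * h" using Suc.prems h by (intro mult_right_mono) auto
  then have "continuous_on UNIV (\<lambda>z. (\<lambda>(t, w). F t w) (real k * h, euler F h z k))"
    using h Suc by (intro continuous_on_compose2[OF cont] continuous_intros) auto
  then show ?case using Suc by (auto intro!: continuous_intros)
qed simp

text \<open>The fixed point of the map followed by the radial retraction onto the ball.\<close>

lemma brouwer_radial:
  fixes P :: "'a::euclidean_space \<Rightarrow> 'a"
  assumes "continuous_on UNIV P" "R > 0"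
  obtains z \<mu> where "norm z \<le> R" "1 \<le> \<mu>" "P z = \<mu> *\<^sub>R z" "\<mu> = 1 \<or> norm z = R"
proof -
  define m where "m v = max 1 (norm v / R)" for v :: 'a
  have m: "m v \<ge> 1" "norm v \<le> R * m v" for v
    using \<open>R > 0\<close> by (auto simp: m_def max_def field_simps)
  have m0: "m v \<noteq> 0" "m v > 0" for v using m(1)[of v] by auto
  have "continuous_on (cball 0 R) (\<lambda>z. (1 / m (P z)) *\<^sub>R P z)"
    using assms m0 unfolding m_def
    by (intro continuous_intros continuous_on_subset[OF assms(1)]) auto
  moreover have "(\<lambda>z. (1 / m (P z)) *\<^sub>R P z) \<in> cball 0 R \<rightarrow> cball 0 R"
    using m(2) m0 by (auto simp: field_simps abs_of_pos)
  ultimately obtain z where z: "z \<in> cball 0 R" "(1 / m (P z)) *\<^sub>R P z = z"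
    using brouwer[of "cball 0 R" "\<lambda>z. (1 / m (P z)) *\<^sub>R P z"] \<open>R > 0\<close> by auto
  have eq: "P z = m (P z) *\<^sub>R z"
    using arg_cong[OF z(2), of "\<lambda>v. m (P z) *\<^sub>R v"] m0 by simp
  have "m (P z) = 1 \<or> norm z = R"
  proof (cases "m (P z) = 1")
    case False
    then have "m (P z) = norm (P z) / R" by (auto simp: m_def max_def)
    also have "norm (P z) = m (P z) * norm z" using eq m0(2)[of "P z"]
      by (metis abs_of_pos norm_scaleR)
    finally have "norm z = R" using m0(1)[of "P z"] \<open>R > 0\<close> by (simp add: field_simps)
    then show ?thesis ..
  qed auto
  then show thesis using that[of z "m (P z)"] eq z m by auto
qed

text \<open>Near \<open>t0\<close> all node values that enter the increment of a polygon are close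
  to \<open>F t0 (w t0)\<close>. Hence the increment is close to (t - s) times this value, and the
  estimate survives the limit.\<close>

lemma euler_limit_derivative:
  fixes F :: "real \<Rightarrow> 'a \<Rightarrow> 'a::euclidean_space"
  assumes cont: "continuous_on ({0..T} \<times> UNIV) (\<lambda>(t, w). F t w)"
    and hN: "\<And>n. 0 < h n" "\<And>n. real (N n) * h n = T" "h \<longlonglongrightarrow> 0"
    and w: "continuous_on {0..T} w"
    and lim: "uniform_limit {0..T} (\<lambda>n. euler_path F (h n) (N n) (z n)) w sequentially"
    and t0: "t0 \<in> {0..T}"
  shows "(w has_vector_derivative F t0 (w t0)) (at t0 within {0..T})"
proof -
  have "\<exists>\<delta>>0. \<forall>y\<in>{0..T}. norm (y - t0) < \<delta> \<longrightarrow>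
      norm (w y - w t0 - (y - t0) *\<^sub>R F t0 (w t0)) \<le> e * norm (y - t0)" if "e > 0" for e
  proof -
    obtain d where d: "d > 0" and "\<forall>p\<in>{0..T} \<times> UNIV. dist p (t0, w t0) < d \<longrightarrow>
        dist ((\<lambda>(t, w). F t w) p) (F t0 (w t0)) < e"
      using cont[unfolded continuous_on_iff, rule_format, of "(t0, w t0)" e] t0 \<open>e > 0\<close> by auto
    then have near: "norm (F s u - F t0 (w t0)) < e"
      if "s \<in> {0..T}" "dist (s, u) (t0, w t0) < d" for s u
      using that by (force simp: dist_norm)
    obtain d1 where d1: "d1 > 0" "\<And>s. s \<in> {0..T} \<Longrightarrow> dist s t0 < d1 \<Longrightarrow> dist (w s) (w t0) < d / 4"
      using w[unfolded continuous_on_iff, rule_format, of t0 "d / 4"] t0 d by auto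
    \<comment> \<open>A node that enters the increment may precede s by one mesh width, so it is
      only within 2 \<delta> of \<open>t0\<close>. The divisors make 2 \<delta> at most d / 2 and at
      most \<open>d1\<close>.\<close>
    define \<delta> where "\<delta> = min (d / 4) (d1 / 2)"
    have "\<delta> > 0" using d d1 by (auto simp: \<delta>_def)
    have key: "norm (w t - w s - (t - s) *\<^sub>R F t0 (w t0)) \<le> e * (t - s)"
      if st: "s \<in> {0..T}" "t \<in> {0..T}" "s \<le> t" "\<bar>s - t0\<bar> < \<delta>" "\<bar>t - t0\<bar> < \<delta>" for s t
    proof (rule tendsto_upperbound)
      let ?p = "\<lambda>n. euler_path F (h n) (N n) (z n)"
      show "(\<lambda>n. norm (?p n t - ?p n s - (t - s) *\<^sub>R F t0 (w t0)))
          \<longlonglongrightarrow> norm (w t - w s - (t - s) *\<^sub>R F t0 (w t0))"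
        using st by (intro tendsto_intros tendsto_uniform_limitI[OF lim])
      have "\<forall>\<^sub>F n in sequentially. \<forall>r\<in>{0..T}. dist (?p n r) (w r) < d / 4"
        using uniform_limitD[OF lim, of "d / 4"] d by simp
      moreover have "\<forall>\<^sub>F n in sequentially. h n < \<delta>"
        using order_tendstoD(2)[OF hN(3) \<open>\<delta> > 0\<close>] .
      ultimately show "\<forall>\<^sub>F n in sequentially.
          norm (?p n t - ?p n s - (t - s) *\<^sub>R F t0 (w t0)) \<le> e * (t - s)"
      proof eventually_elim
        case (elim n)
        show ?case
        proof (rule euler_path_increment)
          fix k assume k: "k < N n" "s - h n \<le> real k * h n" "real k * h n \<le> t"
          let ?r = "real k * h n"
          have "0 \<le> ?r" using hN(1)[of n] by simp
          then have r: "?r \<in> {0..T}" using k(3) st by simp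
          have "dist ?r t0 < 2 * \<delta>" using k st elim unfolding dist_real_def by linarith
          then have "dist (w ?r) (w t0) < d / 4" using r unfolding \<delta>_def by (intro d1) linarith+
          moreover have "dist (euler F (h n) (z n) k) (w ?r) < d / 4"
            using bspec[OF elim(1) r] euler_path_node[of "h n" k "N n" F "z n"] hN(1)[of n] k(1) by simp
          ultimately have "dist (euler F (h n) (z n) k) (w t0) < d / 2"
            using dist_triangle[of "euler F (h n) (z n) k" "w t0" "w ?r"] by linarith
          moreover have "dist ?r t0 < d / 2" using \<open>dist ?r t0 < 2 * \<delta>\<close> unfolding \<delta>_def by linarith
          ultimately have "dist (?r, euler F (h n) (z n) k) (t0, w t0) < d"
            unfolding dist_Pair_Pair
            using sqrt_sum_squares_le_sum[of "dist ?r t0" "dist (euler F (h n) (z n) k) (w t0)"] by simp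
          then show "norm (F ?r (euler F (h n) (z n) k) - F t0 (w t0)) \<le> e"
            using near[OF r] by (meson less_imp_le)
        qed (use st hN(1)[of n] hN(2)[of n] in \<open>simp_all add: less_imp_le\<close>)
      qed
    qed simp
    show ?thesis
    proof (intro exI[of _ \<delta>] conjI ballI impI)
      fix y assume y: "y \<in> {0..T}" "norm (y - t0) < \<delta>"
      show "norm (w y - w t0 - (y - t0) *\<^sub>R F t0 (w t0)) \<le> e * norm (y - t0)"
      proof (cases "t0 \<le> y")
        case True
        then show ?thesis using key[of t0 y] y t0 \<open>\<delta> > 0\<close> by auto
      next
        case False
        have "norm (w y - w t0 - (y - t0) *\<^sub>R F t0 (w t0))
            = norm (w t0 - w y - (t0 - y) *\<^sub>R F t0 (w t0))"
          by (subst norm_minus_cancel[symmetric]) (simp add: algebra_simps)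
        then show ?thesis using key[of y t0] y t0 \<open>\<delta> > 0\<close> False by auto
      qed
    qed (rule \<open>\<delta> > 0\<close>)
  qed
  then show ?thesis
    unfolding has_vector_derivative_def has_derivative_within_alt
    by (auto intro!: bounded_linear_scaleR_left)
qed

section \<open>Compactness and limits of radial fixed points\<close>

lemma Lipschitz_Arzela_Ascoli:
  fixes f :: "nat \<Rightarrow> 'a::euclidean_space \<Rightarrow> 'b::{real_normed_vector,heine_borel}"
  assumes "compact S" and M: "\<And>n x. x \<in> S \<Longrightarrow> norm (f n x) \<le> M"
    and L: "\<And>n x y. x \<in> S \<Longrightarrow> y \<in> S \<Longrightarrow> norm (f n x - f n y) \<le> L * norm (x - y)"
  obtains g k where "continuous_on S g" "strict_mono (k :: nat \<Rightarrow> nat)"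
    "uniform_limit S (\<lambda>n. f (k n)) g sequentially"
proof -
  have equi: "\<exists>d>0. \<forall>n y. y \<in> S \<and> norm (x - y) < d \<longrightarrow> norm (f n x - f n y) < e"
    if "x \<in> S" "e > 0" for x e
  proof (intro exI[of _ "e / (\<bar>L\<bar> + 1)"] conjI allI impI)
    fix n y assume y: "y \<in> S \<and> norm (x - y) < e / (\<bar>L\<bar> + 1)"
    have "norm (f n x - f n y) \<le> L * norm (x - y)" using L that y by auto
    also have "\<dots> \<le> (\<bar>L\<bar> + 1) * norm (x - y)" by (intro mult_right_mono) auto
    also have "\<dots> < e" using y by (simp add: field_simps)
    finally show "norm (f n x - f n y) < e" .
  qed (use that in auto)
  show thesis
  proof (rule Arzela_Ascoli[OF assms(1) M equi])
    fix g and k :: "nat \<Rightarrow> nat"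
    assume g: "continuous_on S g" "strict_mono k"
      and lim: "\<And>e. 0 < e \<Longrightarrow> \<exists>N. \<forall>n x. n \<ge> N \<and> x \<in> S \<longrightarrow> norm (f (k n) x - g x) < e"
    have "uniform_limit S (\<lambda>n. f (k n)) g sequentially"
      unfolding uniform_limit_sequentially_iff dist_norm
    proof (intro allI impI)
      fix e :: real assume "e > 0"
      from lim[OF this] show "\<exists>N. \<forall>n\<ge>N. \<forall>x\<in>S. norm (f (k n) x - g x) < e" by blast
    qed
    with g show thesis by (rule that)
  qed
qed

text \<open>Convergence of the multipliers has to be derived. If norm x < R, then eventually norm (z
  n) < R and \<mu> n = 1. If norm x = R, then \<mu> n is the quotient of two convergent norms whose
  denominator has the limit R > 0.\<close>

lemma radial_multiple_limit:
  fixes z :: "nat \<Rightarrow> 'a::real_normed_vector"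
  assumes z: "z \<longlonglongrightarrow> x" "(\<lambda>n. \<mu> n *\<^sub>R z n) \<longlonglongrightarrow> y" and "R > 0"
    and bnd: "\<And>n. norm (z n) \<le> R" "\<And>n. 1 \<le> \<mu> n" and alt: "\<And>n. \<mu> n = 1 \<or> norm (z n) = R"
  obtains l where "y = l *\<^sub>R x" "1 \<le> l" "norm x \<le> R" "l = 1 \<or> norm x = R"
proof -
  have xR: "norm x \<le> R" using bnd by (intro tendsto_upperbound[OF tendsto_norm[OF z(1)]]) auto
  show thesis
  proof (cases "norm x < R")
    case True
    then have "\<forall>\<^sub>F n in sequentially. norm (z n) < R"
      using order_tendstoD(2)[OF tendsto_norm[OF z(1)]] by auto
    then have "\<forall>\<^sub>F n in sequentially. \<mu> n *\<^sub>R z n = z n"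
    proof eventually_elim
      case (elim n)
      then show ?case using alt[of n] by auto
    qed
    then have "z \<longlonglongrightarrow> y" using z(2) by (rule Lim_transform_eventually[rotated])
    then have "y = x" using z(1) LIMSEQ_unique by blast
    then show thesis using that[of 1] xR by simp
  next
    case False
    then have nx: "norm x = R" using xR by simp
    let ?l = "norm y / R"
    have "(\<lambda>n. norm (\<mu> n *\<^sub>R z n) / norm (z n)) \<longlonglongrightarrow> norm y / norm x"
      using nx \<open>R > 0\<close> by (intro tendsto_divide tendsto_norm z) auto
    moreover have "\<forall>\<^sub>F n in sequentially. 0 < norm (z n)"
      using order_tendstoD(1)[OF tendsto_norm[OF z(1)], of 0] nx \<open>R > 0\<close> by auto
    then have "\<forall>\<^sub>F n in sequentially. norm (\<mu> n *\<^sub>R z n) / norm (z n) = \<mu> n"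
    proof eventually_elim
      case (elim n)
      then show ?case using bnd(2)[of n] by simp
    qed
    ultimately have l: "\<mu> \<longlonglongrightarrow> ?l" unfolding nx by (rule Lim_transform_eventually)
    show thesis
    proof (rule that[of ?l])
      show "y = ?l *\<^sub>R x" using LIMSEQ_unique[OF z(2) tendsto_scaleR[OF l z(1)]] .
      show "1 \<le> ?l" using bnd(2) by (intro tendsto_lowerbound[OF l]) auto
    qed (use nx in auto)
  qed
qed

text \<open>Peano's theorem with the boundary condition built in: for each mesh the radial fixed
  point is that of the Euler end point, and linear growth bounds the polygons and their slopes
  uniformly in the mesh.\<close>

theorem ode_radial_fixed_point:
  fixes F :: "real \<Rightarrow> 'a \<Rightarrow> 'a::euclidean_space"
  assumes "T > 0" "R > 0"
    and cont: "continuous_on ({0..T} \<times> UNIV) (\<lambda>(t, w). F t w)"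
    and K: "0 \<le> K" and growth: "\<And>t w. t \<in> {0..T} \<Longrightarrow> norm (F t w) \<le> K * (1 + norm w)"
  obtains w \<mu> where
    "\<And>t. t \<in> {0..T} \<Longrightarrow> (w has_vector_derivative F t (w t)) (at t within {0..T})"
    "w T = \<mu> *\<^sub>R w 0" "1 \<le> \<mu>" "norm (w 0) \<le> R" "\<mu> = 1 \<or> norm (w 0) = R"
proof -
  define h where "h n = T / real (Suc n)" for n
  have h: "0 < h n" "real (Suc n) * h n = T" for n using \<open>T > 0\<close> by (auto simp: h_def)
  have "h \<longlonglongrightarrow> 0" unfolding h_def
    using LIMSEQ_Suc[OF lim_const_over_n[of T]] by simp
  have "\<exists>z \<mu>. norm z \<le> R \<and> 1 \<le> \<mu> \<and> euler F (h n) z (Suc n) = \<mu> *\<^sub>R z \<and> (\<mu> = 1 \<or> norm z = R)" for n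
  proof -
    have "continuous_on UNIV (\<lambda>z. euler F (h n) z (Suc n))"
      using h[of n] by (intro euler_continuous[OF cont, of _ "Suc n"]) auto
    from brouwer_radial[OF this \<open>R > 0\<close>] show ?thesis by blast
  qed
  then obtain z \<mu> where z: "\<And>n. norm (z n) \<le> R" and \<mu>: "\<And>n. 1 \<le> \<mu> n"
    and eq: "\<And>n. euler F (h n) (z n) (Suc n) = \<mu> n *\<^sub>R z n"
    and alt: "\<And>n. \<mu> n = 1 \<or> norm (z n) = R"
    by metis
  define M where "M = exp (K * T) * (1 + R)"
  have e: "1 + norm (euler F (h n) (z n) k) \<le> M" if "k \<le> Suc n" for n k
  proof -
    have "1 + norm (euler F (h n) (z n) k) \<le> exp (K * T) * (1 + norm (z n))"
      using h[of n] that by (intro euler_growth[OF _ _ K growth, of _ "Suc n"]) auto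
    also have "\<dots> \<le> M" unfolding M_def using z by (intro mult_left_mono) auto
    finally show ?thesis .
  qed
  have "M \<ge> 0" using \<open>R > 0\<close> by (simp add: M_def)
  define p where "p n = euler_path F (h n) (Suc n) (z n)" for n
  have L': "norm (p n t - p n s) \<le> K * M * (t - s)" if "0 \<le> s" "s \<le> t" "t \<le> T" for n s t
  proof -
    have "norm (p n t - p n s - (t - s) *\<^sub>R 0) \<le> K * M * (t - s)"
      unfolding p_def
    proof (rule euler_path_increment)
      fix k assume k: "k < Suc n" "real k * h n \<le> t"
      have "norm (F (real k * h n) (euler F (h n) (z n) k))
          \<le> K * (1 + norm (euler F (h n) (z n) k))"
        using k that h(1)[of n] by (intro growth) auto
      also have "\<dots> \<le> K * M" using e[of k n] k K by (intro mult_left_mono) auto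
      finally show "norm (F (real k * h n) (euler F (h n) (z n) k) - 0) \<le> K * M" by simp
    qed (use that h[of n] in auto)
    then show ?thesis by simp
  qed
  have L: "norm (p n t - p n s) \<le> K * M * norm (t - s)" if "s \<in> {0..T}" "t \<in> {0..T}" for n s t
    using L'[of s t n] L'[of t s n] that by (cases "s \<le> t") (auto simp: norm_minus_commute)
  have p0: "p n 0 = z n" and pT: "p n T = \<mu> n *\<^sub>R z n" for n
    using euler_path_node[of "h n" 0 "Suc n" F "z n"]
      euler_path_node[of "h n" "Suc n" "Suc n" F "z n"] h[of n] eq[of n]
    unfolding p_def by (auto simp del: of_nat_Suc)
  have pM: "norm (p n t) \<le> R + K * M * T" if "t \<in> {0..T}" for n t
  proof -
    have "norm (p n t) \<le> norm (p n 0) + norm (p n t - p n 0)"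
      by (metis add.commute diff_add_cancel norm_triangle_ineq)
    also have "\<dots> \<le> R + K * M * t" using L'[of 0 t n] p0[of n] z[of n] that by auto
    also have "\<dots> \<le> R + K * M * T"
      using that K \<open>M \<ge> 0\<close> by (intro add_left_mono mult_left_mono) auto
    finally show ?thesis .
  qed
  obtain w k where w: "continuous_on {0..T} w" and k: "strict_mono k"
    and lim: "uniform_limit {0..T} (\<lambda>n. p (k n)) w sequentially"
    by (rule Lipschitz_Arzela_Ascoli[OF compact_Icc pM L])
  have z0: "(\<lambda>n. z (k n)) \<longlonglongrightarrow> w 0"
    using tendsto_uniform_limitI[OF lim, of 0] \<open>T > 0\<close> unfolding p0 by simp
  have zT: "(\<lambda>n. \<mu> (k n) *\<^sub>R z (k n)) \<longlonglongrightarrow> w T"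
    using tendsto_uniform_limitI[OF lim, of T] \<open>T > 0\<close> unfolding pT by simp
  obtain l where l: "w T = l *\<^sub>R w 0" "1 \<le> l" "norm (w 0) \<le> R" "l = 1 \<or> norm (w 0) = R"
    by (rule radial_multiple_limit[OF z0 zT \<open>R > 0\<close> z \<mu> alt])
  have hm: "(\<lambda>n. h (k n)) \<longlonglongrightarrow> 0"
    using LIMSEQ_subseq_LIMSEQ[OF \<open>h \<longlonglongrightarrow> 0\<close> k] by (simp add: o_def)
  have lim_e: "uniform_limit {0..T} (\<lambda>n. euler_path F (h (k n)) (Suc (k n)) (z (k n))) w sequentially"
    using lim unfolding p_def .
  show thesis
  proof (rule that)
    show "(w has_vector_derivative F t (w t)) (at t within {0..T})" if "t \<in> {0..T}" for t
      by (rule euler_limit_derivative[OF cont h(1) h(2) hm w lim_e that])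
  qed (rule l)+
qed

section \<open>The regularised equation\<close>

text \<open>Put a = x^2, b = x x' and c = x'^2 + \<epsilon>^2/x^2. Then a c = b^2 + \<epsilon>^2, so
  (a + c)^2 = (a - c)^2 + (2 b)^2 + 4 \<epsilon>^2. The formula recovers a + c from w = (a - c, 2
  b), for every w in the plane.\<close>

definition energy :: "real \<Rightarrow> real \<times> real \<Rightarrow> real" where
  "energy \<epsilon> w = sqrt ((fst w)\<^sup>2 + (snd w)\<^sup>2 + 4 * \<epsilon>\<^sup>2)"

definition sq_pos :: "real \<Rightarrow> real \<times> real \<Rightarrow> real" where
  "sq_pos \<epsilon> w = (energy \<epsilon> w + fst w) / 2"

definition sq_vel :: "real \<Rightarrow> real \<times> real \<Rightarrow> real" where
  "sq_vel \<epsilon> w = (energy \<epsilon> w - fst w) / 2"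

definition prod_pv :: "real \<times> real \<Rightarrow> real" where
  "prod_pv w = snd w / 2"

lemma energy_bounds:
  "\<bar>fst w\<bar> \<le> energy \<epsilon> w" "norm w \<le> energy \<epsilon> w" "energy \<epsilon> w \<le> norm w + 2 * \<bar>\<epsilon>\<bar>"
  "0 < \<epsilon> \<Longrightarrow> \<bar>fst w\<bar> < energy \<epsilon> w"
proof -
  show "\<bar>fst w\<bar> \<le> energy \<epsilon> w" unfolding energy_def by (rule real_le_rsqrt) simp
  show "norm w \<le> energy \<epsilon> w"
    unfolding energy_def norm_prod_def by (intro real_sqrt_le_mono) simp
  have "energy \<epsilon> w = sqrt ((norm w)\<^sup>2 + (2 * \<bar>\<epsilon>\<bar>)\<^sup>2)"
    unfolding energy_def norm_prod_def by (simp add: power_mult_distrib)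
  also have "\<dots> \<le> norm w + 2 * \<bar>\<epsilon>\<bar>" by (intro sqrt_sum_squares_le_sum) auto
  finally show "energy \<epsilon> w \<le> norm w + 2 * \<bar>\<epsilon>\<bar>" .
  show "\<bar>fst w\<bar> < energy \<epsilon> w" if "0 < \<epsilon>"
  proof -
    have "sqrt ((fst w)\<^sup>2) < energy \<epsilon> w"
      unfolding energy_def using that by (intro real_sqrt_less_mono) (simp add: add_nonneg_pos)
    then show ?thesis by simp
  qed
qed

lemma sq_nonneg: "0 \<le> sq_pos \<epsilon> w" "0 \<le> sq_vel \<epsilon> w" "0 < \<epsilon> \<Longrightarrow> 0 < sq_pos \<epsilon> w"
  using energy_bounds(1)[of w \<epsilon>] energy_bounds(4)[of \<epsilon> w] unfolding sq_pos_def sq_vel_def by auto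

lemma sq_sum: "sq_pos \<epsilon> w + sq_vel \<epsilon> w = energy \<epsilon> w"
  and sq_diff: "sq_pos \<epsilon> w - sq_vel \<epsilon> w = fst w"
  unfolding sq_pos_def sq_vel_def by (auto simp: field_simps)

lemma sq_prod: "sq_pos \<epsilon> w * sq_vel \<epsilon> w = (prod_pv w)\<^sup>2 + \<epsilon>\<^sup>2"
proof -
  have "(energy \<epsilon> w)\<^sup>2 = (fst w)\<^sup>2 + (snd w)\<^sup>2 + 4 * \<epsilon>\<^sup>2" unfolding energy_def by simp
  then show ?thesis
    unfolding sq_pos_def sq_vel_def prod_pv_def by (simp add: power2_eq_square algebra_simps)
qed

text \<open>The quotient is x', and \<open>sq_vel\<close> exceeds its square by \<epsilon>^2/x^2.
  This keeps the growth of the field uniform in \<epsilon> although the field divides by x.\<close>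

lemma velocity_bound:
  assumes "0 < \<epsilon>"
  shows "\<bar>prod_pv w / sqrt (sq_pos \<epsilon> w)\<bar> \<le> sqrt (sq_vel \<epsilon> w)"
proof -
  have "(prod_pv w)\<^sup>2 \<le> sq_vel \<epsilon> w * sq_pos \<epsilon> w" using sq_prod[of \<epsilon> w] by (simp add: mult.commute)
  then have "\<bar>prod_pv w\<bar> \<le> sqrt (sq_vel \<epsilon> w * sq_pos \<epsilon> w)" by (intro real_le_rsqrt) simp
  then show ?thesis
    using sq_nonneg[of \<epsilon> w] assms by (simp add: real_sqrt_mult field_simps)
qed

text \<open>The vector field of \<open>x'' = - g(t,x) + \<epsilon>\<^sup>2/x\<^sup>3\<close> in the coordinates
  \<open>w = (x\<^sup>2 - x'\<^sup>2 - \<epsilon>\<^sup>2/x\<^sup>2, 2 x x')\<close>, which identify the half-plane \<open>x > 0\<close> with the whole plane;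
  then \<open>energy\<close>, \<open>sq_pos\<close>, \<open>sq_vel\<close>, \<open>prod_pv\<close> are
  \<open>x\<^sup>2 + x'\<^sup>2 + \<epsilon>\<^sup>2/x\<^sup>2\<close>, \<open>x\<^sup>2\<close>, \<open>x'\<^sup>2 + \<epsilon>\<^sup>2/x\<^sup>2\<close>, \<open>x x'\<close>.  For \<open>\<epsilon> = 0\<close> the
  coordinates glue \<open>(0, v)\<close> to \<open>(0, -v)\<close>, which is the bouncing rule.\<close>

definition reg_field :: "(real \<Rightarrow> real \<Rightarrow> real) \<Rightarrow> real \<Rightarrow> real \<Rightarrow> real \<times> real \<Rightarrow> real \<times> real" where
  "reg_field g \<epsilon> t w =
     (let x = sqrt (sq_pos \<epsilon> w) in
      (2 * prod_pv w + 2 * (prod_pv w / x) * g t x, 2 * (sq_vel \<epsilon> w - x * g t x)))"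

section \<open>A priori bounds for the regularised motions, uniform in \<epsilon>\<close>

locale half_line_oscillator =
  fixes T G :: real and g :: "real \<Rightarrow> real \<Rightarrow> real"
  assumes T_pos: "0 < T"
    and g_cont: "continuous_on ({0..T} \<times> {0..}) (\<lambda>(t, x). g t x)"
    and g_growth: "\<And>t x. t \<in> {0..T} \<Longrightarrow> 0 \<le> x \<Longrightarrow> \<bar>g t x\<bar> \<le> G * (1 + x)"
begin

lemma G_nonneg: "0 \<le> G"
  using g_growth[of 0 0] T_pos by simp

text \<open>With x = sqrt a and v = sqrt c both expressions grow at most quadratically in (x, v), so
  inequalities such as 2 v x \<le> v^2 + x^2 bound them by the energy a + c.\<close>

lemma force_bounds:
  assumes "t \<in> {0..T}" "0 \<le> a" "0 \<le> c"
  shows "2 * sqrt c * \<bar>g t (sqrt a)\<bar> \<le> 2 * G * (1 + (a + c))"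
    and "2 * \<bar>c - sqrt a * g t (sqrt a)\<bar> \<le> (2 + 3 * G) * (1 + (a + c))"
proof -
  define x v where "x = sqrt a" and "v = sqrt c"
  have xv: "0 \<le> x" "0 \<le> v" "a = x\<^sup>2" "c = v\<^sup>2" using assms by (auto simp: x_def v_def)
  have gb: "\<bar>g t x\<bar> \<le> G * (1 + x)" using g_growth assms xv by auto
  have "2 * v * \<bar>g t x\<bar> \<le> 2 * v * (G * (1 + x))" using gb xv by (intro mult_left_mono) auto
  also have "\<dots> = G * (2 * v * (1 + x))" by simp
  also have "\<dots> \<le> G * (2 * (1 + (x\<^sup>2 + v\<^sup>2)))"
  proof (intro mult_left_mono G_nonneg)
    have "2 * v \<le> v\<^sup>2 + 1" "2 * (v * x) \<le> v\<^sup>2 + x\<^sup>2"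
      using sum_squares_bound[of v 1] sum_squares_bound[of v x] by (auto simp: mult.assoc)
    moreover have "0 \<le> x\<^sup>2" "0 \<le> v\<^sup>2" by simp_all
    ultimately have "2 * v + 2 * (v * x) \<le> 2 * (1 + (x\<^sup>2 + v\<^sup>2))" by argo
    then show "2 * v * (1 + x) \<le> 2 * (1 + (x\<^sup>2 + v\<^sup>2))" by (simp add: distrib_left mult.assoc)
  qed
  finally show "2 * sqrt c * \<bar>g t (sqrt a)\<bar> \<le> 2 * G * (1 + (a + c))"
    using xv by (simp add: x_def[symmetric] v_def[symmetric] mult_ac)
  have "2 * \<bar>c - x * g t x\<bar> \<le> 2 * c + 2 * x * \<bar>g t x\<bar>"
    using xv assms(3) abs_triangle_ineq4[of c "x * g t x"] by (simp add: abs_mult)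
  also have "2 * x * \<bar>g t x\<bar> \<le> 2 * x * (G * (1 + x))" using gb xv by (intro mult_left_mono) auto
  also have "2 * x * (G * (1 + x)) = G * (2 * x * (1 + x))" by simp
  also have "\<dots> \<le> G * (3 * (1 + (a + c)))"
  proof (intro mult_left_mono G_nonneg)
    have "2 * x \<le> x\<^sup>2 + 1" using sum_squares_bound[of x 1] by auto
    then have "2 * x + 2 * x\<^sup>2 \<le> 3 * (1 + (a + c))" using xv(3) assms by argo
    then show "2 * x * (1 + x) \<le> 3 * (1 + (a + c))"
      by (simp add: distrib_left power2_eq_square)
  qed
  finally have "2 * \<bar>c - x * g t x\<bar> \<le> 2 * c + G * (3 * (1 + (a + c)))" by simp
  also have "\<dots> \<le> (2 + 3 * G) * (1 + (a + c))" using assms by (simp add: algebra_simps)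
  finally show "2 * \<bar>c - sqrt a * g t (sqrt a)\<bar> \<le> (2 + 3 * G) * (1 + (a + c))"
    by (simp add: x_def)
qed

text \<open>The constant is independent of \<epsilon>, which gives compactness as \<epsilon> tends
  to 0. It is 3 (3 + 5 G), where the outer 3 converts energy into norm by means of energy \<le> norm
  + 2 for \<epsilon> \<le> 1.\<close>

lemma reg_field_growth:
  assumes "t \<in> {0..T}" "0 < \<epsilon>" "\<epsilon> \<le> 1"
  shows "norm (reg_field g \<epsilon> t w) \<le> (9 + 15 * G) * (1 + norm w)"
proof -
  define a c b x where "a = sq_pos \<epsilon> w" and "c = sq_vel \<epsilon> w" and "b = prod_pv w" and "x = sqrt a"
  have ac: "0 \<le> a" "0 \<le> c" using sq_nonneg by (auto simp: a_def c_def)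
  have y: "\<bar>b / x\<bar> \<le> sqrt c" using velocity_bound[OF assms(2)] by (simp add: a_def b_def c_def x_def)
  have b: "\<bar>2 * b\<bar> \<le> 1 + (a + c)"
  proof -
    have "\<bar>snd w\<bar> \<le> energy \<epsilon> w" unfolding energy_def by (rule real_le_rsqrt) simp
    then show ?thesis using sq_sum[of \<epsilon> w] by (simp add: b_def prod_pv_def a_def c_def)
  qed
  have "norm (reg_field g \<epsilon> t w) \<le> \<bar>2 * b + 2 * (b / x) * g t x\<bar> + \<bar>2 * (c - x * g t x)\<bar>"
    unfolding reg_field_def Let_def a_def[symmetric] b_def[symmetric] c_def[symmetric] x_def[symmetric]
    using norm_Pair_le[of "2 * b + 2 * (b / x) * g t x" "2 * (c - x * g t x)"] by simp
  also have "\<bar>2 * b + 2 * (b / x) * g t x\<bar> \<le> (1 + (a + c)) + 2 * G * (1 + (a + c))"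
  proof -
    have "\<bar>2 * (b / x) * g t x\<bar> = 2 * \<bar>b / x\<bar> * \<bar>g t x\<bar>" by (simp add: abs_mult)
    also have "\<dots> \<le> 2 * sqrt c * \<bar>g t x\<bar>" using y by (intro mult_right_mono mult_left_mono) auto
    also have "\<dots> \<le> 2 * G * (1 + (a + c))" unfolding x_def by (rule force_bounds(1)[OF assms(1) ac])
    finally show ?thesis using b by linarith
  qed
  also have "\<bar>2 * (c - x * g t x)\<bar> \<le> (2 + 3 * G) * (1 + (a + c))"
    using force_bounds(2)[OF assms(1) ac] unfolding x_def abs_mult by simp
  also have "1 + (a + c) + 2 * G * (1 + (a + c)) + (2 + 3 * G) * (1 + (a + c))
      = (3 + 5 * G) * (1 + energy \<epsilon> w)"
    using sq_sum[of \<epsilon> w] by (simp add: a_def c_def algebra_simps)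
  also have "\<dots> \<le> (3 + 5 * G) * (3 * (1 + norm w))"
  proof (rule mult_left_mono)
    have "energy \<epsilon> w \<le> norm w + 2" using energy_bounds(3)[of \<epsilon> w] assms by simp
    then show "1 + energy \<epsilon> w \<le> 3 * (1 + norm w)" using norm_ge_zero[of w] by argo
  qed (use G_nonneg in simp)
  also have "\<dots> = (9 + 15 * G) * (1 + norm w)" by (simp add: algebra_simps)
  finally show ?thesis by simp
qed

lemma force_continuous:
  assumes "continuous_on S \<tau>" "continuous_on S a" "\<And>p. p \<in> S \<Longrightarrow> \<tau> p \<in> {0..T}"
    "\<And>p. p \<in> S \<Longrightarrow> 0 \<le> a p"
  shows "continuous_on S (\<lambda>p. g (\<tau> p) (sqrt (a p)))"
proof -
  have "continuous_on S (\<lambda>p. (\<lambda>(t, x). g t x) (\<tau> p, sqrt (a p)))"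
    using assms by (intro continuous_on_compose2[OF g_cont] continuous_intros) auto
  then show ?thesis by simp
qed

text \<open>Here \<epsilon> > 0 is essential: it makes \<open>sq_pos\<close> positive, whereas for
  \<epsilon> = 0 the quotient \<open>prod_pv w / x\<close> would jump across the half-line x =
  0.\<close>

lemma reg_field_continuous:
  assumes "0 < \<epsilon>"
  shows "continuous_on ({0..T} \<times> UNIV) (\<lambda>(t, w). reg_field g \<epsilon> t w)"
proof -
  let ?S = "{0..T} \<times> (UNIV :: (real \<times> real) set)"
  have a: "continuous_on ?S (\<lambda>p. sq_pos \<epsilon> (snd p))" and c: "continuous_on ?S (\<lambda>p. sq_vel \<epsilon> (snd p))"
    and b: "continuous_on ?S (\<lambda>p. prod_pv (snd p))"
    unfolding sq_pos_def sq_vel_def energy_def prod_pv_def by (intro continuous_intros; simp)+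
  have f: "continuous_on ?S (\<lambda>p. g (fst p) (sqrt (sq_pos \<epsilon> (snd p))))"
    using sq_nonneg by (intro force_continuous a continuous_intros) auto
  have "sq_pos \<epsilon> w \<noteq> 0" for w using sq_nonneg(3)[OF assms, of w] by simp
  then show ?thesis
    unfolding reg_field_def Let_def split_beta by (intro continuous_intros a b c f) auto
qed

context
  fixes \<epsilon> :: real and w :: "real \<Rightarrow> real \<times> real"
  assumes eps: "0 < \<epsilon>" "\<epsilon> \<le> 1"
    and w: "\<And>t. t \<in> {0..T} \<Longrightarrow> (w has_vector_derivative reg_field g \<epsilon> t (w t)) (at t within {0..T})"
begin

text \<open>The fourth statement is x'' = \<epsilon>^2/x^3 - g for the velocity x' = b/x. The second
  and third contain no division by x; these are the ones that pass to \<epsilon> = 0.\<close>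

lemma reg_derivatives:
  assumes t: "t \<in> {0..T}"
  defines "x \<equiv> sqrt (sq_pos \<epsilon> (w t))" and "b \<equiv> prod_pv (w t)" and "c \<equiv> sq_vel \<epsilon> (w t)"
  shows "((\<lambda>t. energy \<epsilon> (w t)) has_real_derivative 2 * b - 2 * (b / x) * g t x) (at t within {0..T})"
    and "((\<lambda>t. sq_pos \<epsilon> (w t)) has_real_derivative 2 * b) (at t within {0..T})"
    and "((\<lambda>t. prod_pv (w t)) has_real_derivative c - x * g t x) (at t within {0..T})"
    and "((\<lambda>t. prod_pv (w t) / sqrt (sq_pos \<epsilon> (w t))) has_real_derivative \<epsilon>\<^sup>2 / (x * x\<^sup>2) - g t x)
           (at t within {0..T})"
proof -
  define y where "y = b / x"
  define f where "f = g t x"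
  have x: "0 < x" and a: "sq_pos \<epsilon> (w t) = x * x"
    using sq_nonneg[of \<epsilon> "w t"] eps by (auto simp: x_def)
  have b: "b = x * y" using x by (simp add: y_def)
  have E: "energy \<epsilon> (w t) = x * x + c" and w1: "fst (w t) = x * x - c" and w2: "snd (w t) = 2 * b"
    using sq_sum[of \<epsilon> "w t"] sq_diff[of \<epsilon> "w t"] a by (auto simp: c_def b_def prod_pv_def)
  have pos: "0 < (fst (w t))\<^sup>2 + (snd (w t))\<^sup>2 + 4 * \<epsilon>\<^sup>2"
    using eps by (intro add_nonneg_pos) auto
  have E0: "0 < energy \<epsilon> (w t)" unfolding energy_def using pos by simp
  have F: "reg_field g \<epsilon> t (w t) = (2 * b + 2 * y * f, 2 * (c - x * f))"
    unfolding reg_field_def Let_def x_def[symmetric] b_def[symmetric] c_def[symmetric] y_def f_def ..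
  have d1: "((\<lambda>t. fst (w t)) has_real_derivative 2 * b + 2 * y * f) (at t within {0..T})"
    using bounded_linear.has_vector_derivative[OF bounded_linear_fst w[OF t]]
    unfolding F has_real_derivative_iff_has_vector_derivative by simp
  have d2: "((\<lambda>t. snd (w t)) has_real_derivative 2 * (c - x * f)) (at t within {0..T})"
    using bounded_linear.has_vector_derivative[OF bounded_linear_snd w[OF t]]
    unfolding F has_real_derivative_iff_has_vector_derivative by simp
  have "((\<lambda>t. energy \<epsilon> (w t)) has_real_derivative
      (2 * fst (w t) * (2 * b + 2 * y * f) + 2 * snd (w t) * (2 * (c - x * f)))
        * (inverse (energy \<epsilon> (w t)) / 2)) (at t within {0..T})"
    unfolding energy_def
    using pos by (auto intro!: derivative_eq_intros d1 d2)
  moreover have "(2 * fst (w t) * (2 * b + 2 * y * f) + 2 * snd (w t) * (2 * (c - x * f)))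
        * (inverse (energy \<epsilon> (w t)) / 2) = 2 * b - 2 * y * f"
  proof -
    have "2 * fst (w t) * (2 * b + 2 * y * f) + 2 * snd (w t) * (2 * (c - x * f))
        = 2 * (energy \<epsilon> (w t) * (2 * b - 2 * y * f))"
      unfolding E w1 w2 b by (simp add: algebra_simps)
    then show ?thesis using E0 by (simp add: field_simps)
  qed
  ultimately show dE: "((\<lambda>t. energy \<epsilon> (w t)) has_real_derivative 2 * b - 2 * (b / x) * g t x)
      (at t within {0..T})"
    unfolding y_def f_def by (simp only:)
  show dA: "((\<lambda>t. sq_pos \<epsilon> (w t)) has_real_derivative 2 * b) (at t within {0..T})"
    unfolding sq_pos_def
    by (auto intro!: derivative_eq_intros dE d1 simp: y_def f_def)
  show dB: "((\<lambda>t. prod_pv (w t)) has_real_derivative c - x * g t x) (at t within {0..T})"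
    unfolding prod_pv_def by (auto intro!: derivative_eq_intros d2 simp: f_def)
  have ac: "x * x * c = b\<^sup>2 + \<epsilon>\<^sup>2" using sq_prod[of \<epsilon> "w t"] a by (simp add: b_def c_def)
  have "((\<lambda>t. prod_pv (w t) / sqrt (sq_pos \<epsilon> (w t))) has_real_derivative
      ((c - x * f) * x - b * (2 * b * (inverse x / 2))) / (x * x)) (at t within {0..T})"
    using x sq_nonneg(3)[OF eps(1), of "w t"] unfolding f_def x_def b_def c_def
    by (auto intro!: derivative_eq_intros dA[unfolded b_def] dB[unfolded b_def c_def x_def])
  moreover have "((c - x * f) * x - b * (2 * b * (inverse x / 2))) / (x * x) = \<epsilon>\<^sup>2 / (x * x\<^sup>2) - f"
  proof -
    have "\<epsilon>\<^sup>2 = x * x * c - b * b" using ac by (simp add: power2_eq_square)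
    then show ?thesis using x by (simp add: field_simps power2_eq_square)
  qed
  ultimately show "((\<lambda>t. prod_pv (w t) / sqrt (sq_pos \<epsilon> (w t))) has_real_derivative
      \<epsilon>\<^sup>2 / (x * x\<^sup>2) - g t x) (at t within {0..T})"
    by (simp add: f_def)
qed

text \<open>Gronwall's inequality for the logarithm of 1 + energy, whose derivative is at most 1 + 2
  G in absolute value. The times s and t come in either order: decay is controlled as well as
  growth, so a large initial energy stays large.\<close>

lemma reg_energy_growth:
  assumes "s \<in> {0..T}" "t \<in> {0..T}"
  shows "1 + energy \<epsilon> (w t) \<le> exp ((1 + 2 * G) * T) * (1 + energy \<epsilon> (w s))"
proof -
  have pos: "0 < 1 + energy \<epsilon> (w t)" for t
    using energy_bounds(1)[of "w t" \<epsilon>] by linarith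
  have "norm (ln (1 + energy \<epsilon> (w t)) - ln (1 + energy \<epsilon> (w s))) \<le> (1 + 2 * G) * norm (t - s)"
  proof (rule field_differentiable_bound)
    fix t assume t: "t \<in> {0..T}"
    define x b c where "x = sqrt (sq_pos \<epsilon> (w t))" and "b = prod_pv (w t)" and "c = sq_vel \<epsilon> (w t)"
    let ?D = "2 * b - 2 * (b / x) * g t x"
    have dE: "((\<lambda>t. energy \<epsilon> (w t)) has_real_derivative ?D) (at t within {0..T})"
      using reg_derivatives(1)[OF t] by (simp add: x_def b_def)
    show "((\<lambda>t. ln (1 + energy \<epsilon> (w t))) has_real_derivative ?D / (1 + energy \<epsilon> (w t)))
        (at t within {0..T})"
      using pos[of t] by (auto intro!: derivative_eq_intros dE simp: divide_inverse)
    have "\<bar>snd (w t)\<bar> \<le> energy \<epsilon> (w t)" unfolding energy_def by (rule real_le_rsqrt) simp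
    then have "\<bar>2 * b\<bar> \<le> 1 + energy \<epsilon> (w t)" by (simp add: b_def prod_pv_def)
    moreover have "\<bar>2 * (b / x) * g t x\<bar> \<le> 2 * G * (1 + energy \<epsilon> (w t))"
    proof -
      have "\<bar>2 * (b / x) * g t x\<bar> = 2 * \<bar>b / x\<bar> * \<bar>g t x\<bar>" by (simp add: abs_mult)
      also have "\<dots> \<le> 2 * sqrt c * \<bar>g t x\<bar>"
        using velocity_bound[OF eps(1), of "w t"] unfolding b_def x_def c_def
        by (intro mult_right_mono mult_left_mono) auto
      also have "\<dots> \<le> 2 * G * (1 + energy \<epsilon> (w t))"
        unfolding x_def c_def sq_sum[symmetric] using sq_nonneg t by (intro force_bounds(1)) auto
      finally show ?thesis .
    qed
    ultimately have "\<bar>?D\<bar> \<le> (1 + 2 * G) * (1 + energy \<epsilon> (w t))"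
      using abs_triangle_ineq4[of "2 * b" "2 * (b / x) * g t x"] by argo
    then show "norm (?D / (1 + energy \<epsilon> (w t))) \<le> 1 + 2 * G"
      using pos[of t] by (simp add: divide_le_eq)
  qed (use assms in auto)
  also have "\<dots> \<le> (1 + 2 * G) * T" using assms G_nonneg by (intro mult_left_mono) auto
  finally have "ln (1 + energy \<epsilon> (w t)) \<le> (1 + 2 * G) * T + ln (1 + energy \<epsilon> (w s))" by simp
  then have "exp (ln (1 + energy \<epsilon> (w t))) \<le> exp ((1 + 2 * G) * T) * exp (ln (1 + energy \<epsilon> (w s)))"
    by (simp only: flip: exp_add) simp
  then show ?thesis using pos by simp
qed

lemma reg_Lipschitz:
  assumes M: "\<And>t. t \<in> {0..T} \<Longrightarrow> norm (w t) \<le> M" and "s \<in> {0..T}" "t \<in> {0..T}"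
  shows "norm (w t - w s) \<le> (9 + 15 * G) * (1 + M) * norm (t - s)"
proof (rule differentiable_bound)
  fix r assume r: "r \<in> {0..T}"
  show "(w has_derivative (\<lambda>h. h *\<^sub>R reg_field g \<epsilon> r (w r))) (at r within {0..T})"
    using w[OF r] by (simp add: has_vector_derivative_def)
  have "norm (reg_field g \<epsilon> r (w r)) \<le> (9 + 15 * G) * (1 + norm (w r))"
    by (rule reg_field_growth[OF r eps])
  also have "\<dots> \<le> (9 + 15 * G) * (1 + M)"
    using M[OF r] G_nonneg by (intro mult_left_mono) auto
  finally have "norm (reg_field g \<epsilon> r (w r)) \<le> (9 + 15 * G) * (1 + M)" .
  then show "onorm (\<lambda>h. h *\<^sub>R reg_field g \<epsilon> r (w r)) \<le> (9 + 15 * G) * (1 + M)"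
    by (intro onorm_le) (metis abs_ge_zero mult.commute mult_left_mono norm_scaleR real_norm_def)
qed (use assms in auto)

end

end

section \<open>Removing the regularisation\<close>

lemma uniform_limit_Pair:
  assumes "uniform_limit S f l F" "uniform_limit S g m F"
  shows "uniform_limit S (\<lambda>n x. (f n x, g n x)) (\<lambda>x. (l x, m x)) F"
proof (rule uniform_limitI)
  fix e :: real assume "e > 0"
  then have "e / 2 > 0" by simp
  from uniform_limitD[OF assms(1) this] uniform_limitD[OF assms(2) this]
  show "\<forall>\<^sub>F n in F. \<forall>x\<in>S. dist (f n x, g n x) (l x, m x) < e"
  proof eventually_elim
    case (elim n)
    show ?case
    proof
      fix x assume "x \<in> S"
      have "dist (f n x, g n x) (l x, m x) \<le> dist (f n x) (l x) + dist (g n x) (m x)"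
        unfolding dist_Pair_Pair by (intro sqrt_sum_squares_le_sum) auto
      also have "\<dots> < e" using elim \<open>x \<in> S\<close> by fastforce
      finally show "dist (f n x, g n x) (l x, m x) < e" .
    qed
  qed
qed

lemma has_real_derivative_uniform_limit:
  fixes f :: "nat \<Rightarrow> real \<Rightarrow> real"
  assumes "a \<le> b"
    and d: "\<And>n t. t \<in> {a..b} \<Longrightarrow> (f n has_real_derivative f' n t) (at t within {a..b})"
    and u: "uniform_limit {a..b} f' g' sequentially"
    and l: "\<And>t. t \<in> {a..b} \<Longrightarrow> (\<lambda>n. f n t) \<longlonglongrightarrow> F t" and t: "t \<in> {a..b}"
  shows "(F has_real_derivative g' t) (at t within {a..b})"
proof -
  have ev: "\<forall>\<^sub>F n in sequentially. \<forall>x\<in>{a..b}. \<forall>h. norm (f' n x * h - g' x * h) \<le> e * norm h"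
    if "e > 0" for e
    using uniform_limitD[OF u that]
  proof eventually_elim
    case (elim n)
    show ?case
    proof (intro ballI allI)
      fix x h assume "x \<in> {a..b}"
      then have "\<bar>f' n x - g' x\<bar> \<le> e" using elim by (auto simp: dist_real_def less_imp_le)
      then have "\<bar>f' n x - g' x\<bar> * \<bar>h\<bar> \<le> e * \<bar>h\<bar>" by (intro mult_right_mono) auto
      then show "norm (f' n x * h - g' x * h) \<le> e * norm h"
        by (simp flip: abs_mult add: left_diff_distrib)
    qed
  qed
  have "\<exists>g. \<forall>x\<in>{a..b}. (\<lambda>n. f n x) \<longlonglongrightarrow> g x \<and> (g has_derivative (*) (g' x)) (at x within {a..b})"
  proof (rule has_derivative_sequence)
    show "(f n has_derivative (*) (f' n x)) (at x within {a..b})" if "x \<in> {a..b}" for n x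
      using d[OF that] by (simp add: has_field_derivative_def)
    show "(\<lambda>n. f n a) \<longlonglongrightarrow> F a" using l \<open>a \<le> b\<close> by simp
  qed (use ev \<open>a \<le> b\<close> in auto)
  then obtain g where g: "\<And>x. x \<in> {a..b} \<Longrightarrow> (\<lambda>n. f n x) \<longlonglongrightarrow> g x"
    "\<And>x. x \<in> {a..b} \<Longrightarrow> (g has_derivative (*) (g' x)) (at x within {a..b})" by blast
  have "g x = F x" if "x \<in> {a..b}" for x using LIMSEQ_unique[OF g(1) l] that by simp
  then have "(F has_derivative (*) (g' t)) (at t within {a..b})"
    using has_derivative_transform[OF t _ g(2)[OF t], of F] by metis
  then show ?thesis by (simp add: has_field_derivative_def)
qed

context half_line_oscillator
begin

text \<open>The equation \<open>x'' = - g(t,x)\<close> with elastic bounces, for \<open>A = x\<^sup>2\<close>, \<open>B = x x'\<close> and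
  \<open>C = x'\<^sup>2\<close>; these quantities do not jump at a bounce.\<close>

definition bounce_motion :: "(real \<Rightarrow> real) \<Rightarrow> (real \<Rightarrow> real) \<Rightarrow> (real \<Rightarrow> real) \<Rightarrow> bool" where
  "bounce_motion A B C \<longleftrightarrow> continuous_on {0..T} C \<and>
     (\<forall>t\<in>{0..T}. 0 \<le> A t \<and> 0 \<le> C t \<and> A t * C t = (B t)\<^sup>2 \<and>
        (A has_real_derivative 2 * B t) (at t within {0..T}) \<and>
        (B has_real_derivative C t - sqrt (A t) * g t (sqrt (A t))) (at t within {0..T})) \<and>
     (\<forall>s\<in>{0..T}. \<forall>t\<in>{0..T}. 1 + (A t + C t) \<le> exp ((1 + 2 * G) * T) * (1 + (A s + C s)))"

text \<open>In the second statement the limiting equation is of no help, since g(t,0) enters it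
  multiplied by sqrt A = 0. The velocities are: the repulsive term \<epsilon>^2/x^3 has a favourable
  sign, so if g(t,0) were negative on the whole interval, each late velocity would increase there by
  a fixed amount. But its absolute value is at most sqrt \<open>sq_vel\<close>, which tends to 0 at
  both ends.\<close>

lemma reg_sequence_limit:
  assumes \<epsilon>: "\<And>n. 0 < \<epsilon> n" "\<And>n. \<epsilon> n \<le> 1" "\<epsilon> \<longlonglongrightarrow> 0"
    and w: "\<And>n t. t \<in> {0..T} \<Longrightarrow>
      (w n has_vector_derivative reg_field g (\<epsilon> n) t (w n t)) (at t within {0..T})"
    and M: "\<And>n t. t \<in> {0..T} \<Longrightarrow> norm (w n t) \<le> M"
    and lim: "uniform_limit {0..T} w W sequentially"
  defines "A \<equiv> \<lambda>t. sq_pos 0 (W t)" and "B \<equiv> \<lambda>t. prod_pv (W t)" and "C \<equiv> \<lambda>t. sq_vel 0 (W t)"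
  shows "bounce_motion A B C"
    and "\<And>a b. 0 \<le> a \<Longrightarrow> a < b \<Longrightarrow> b \<le> T \<Longrightarrow> \<forall>t\<in>{a..b}. A t = 0 \<Longrightarrow> \<exists>t\<in>{a..b}. 0 \<le> g t 0"
proof -
  \<comment> \<open>The value \<epsilon> = 0 belongs to K. All quantities below are continuous up to
    it, hence uniformly continuous, and uniform convergence passes through them.\<close>
  define K where "K = {0..1::real} \<times> {0..T} \<times> cball (0 :: real \<times> real) M"
  have K: "compact K" unfolding K_def by (intro compact_Times compact_Icc compact_cball)
  have pair: "uniform_limit {0..T} (\<lambda>n t. (\<epsilon> n, t, w n t)) (\<lambda>t. (0, t, W t)) sequentially"
    using \<epsilon>(3) by (intro uniform_limit_Pair lim uniform_limit_const)
      (auto simp: uniform_limit_iff tendsto_iff)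
  have comp: "uniform_limit {0..T} (\<lambda>n t. \<phi> (\<epsilon> n, t, w n t)) (\<lambda>t. \<phi> (0, t, W t)) sequentially"
    if "continuous_on K \<phi>" for \<phi> :: "real \<times> real \<times> real \<times> real \<Rightarrow> real"
    by (rule uniform_limit_compose_uniformly_continuous_on[OF pair
          compact_uniformly_continuous[OF that K] _ compact_imp_closed[OF K]])
      (use \<epsilon>(1,2) M in \<open>auto simp: K_def less_imp_le\<close>)
  have cA: "continuous_on K (\<lambda>p. sq_pos (fst p) (snd (snd p)))"
    and cC: "continuous_on K (\<lambda>p. sq_vel (fst p) (snd (snd p)))"
    and cE: "continuous_on K (\<lambda>p. energy (fst p) (snd (snd p)))"
    and cB: "continuous_on K (\<lambda>p. prod_pv (snd (snd p)))"
    unfolding sq_pos_def sq_vel_def energy_def prod_pv_def by (intro continuous_intros; simp)+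
  have cg: "continuous_on K (\<lambda>p. g (fst (snd p)) (sqrt (sq_pos (fst p) (snd (snd p)))))"
    using sq_nonneg by (intro force_continuous cA continuous_intros) (auto simp: K_def)
  note uA = comp[OF cA, simplified] and uB = comp[OF cB, simplified] and uC = comp[OF cC, simplified]
    and uE = comp[OF cE, simplified] and ug = comp[OF cg, simplified]
  have uF: "uniform_limit {0..T}
      (\<lambda>n t. sq_vel (\<epsilon> n) (w n t) - sqrt (sq_pos (\<epsilon> n) (w n t)) * g t (sqrt (sq_pos (\<epsilon> n) (w n t))))
      (\<lambda>t. C t - sqrt (A t) * g t (sqrt (A t))) sequentially"
    unfolding A_def C_def
    using comp[of "\<lambda>p. sq_vel (fst p) (snd (snd p)) - sqrt (sq_pos (fst p) (snd (snd p)))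
        * g (fst (snd p)) (sqrt (sq_pos (fst p) (snd (snd p))))"]
    by (simp add: cA cC cg continuous_on_diff continuous_on_mult continuous_on_real_sqrt)
  note ptw = tendsto_uniform_limitI
  have dA: "(A has_real_derivative 2 * B t) (at t within {0..T})" if "t \<in> {0..T}" for t
  proof (rule has_real_derivative_uniform_limit[where f' = "\<lambda>n t. 2 * prod_pv (w n t)"])
    show "((\<lambda>t. sq_pos (\<epsilon> n) (w n t)) has_real_derivative 2 * prod_pv (w n t)) (at t within {0..T})"
      if "t \<in> {0..T}" for n t by (rule reg_derivatives(2)[OF \<epsilon>(1,2) w that])
    show "uniform_limit {0..T} (\<lambda>n t. 2 * prod_pv (w n t)) (\<lambda>t. 2 * B t) sequentially"
      unfolding B_def by (rule bounded_linear.uniform_limit[OF bounded_linear_mult_right uB])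
    show "(\<lambda>n. sq_pos (\<epsilon> n) (w n t)) \<longlonglongrightarrow> A t" if "t \<in> {0..T}" for t
      unfolding A_def by (rule ptw[OF uA that])
  qed (use that T_pos in auto)
  have dB: "(B has_real_derivative C t - sqrt (A t) * g t (sqrt (A t))) (at t within {0..T})"
    if "t \<in> {0..T}" for t
  proof (rule has_real_derivative_uniform_limit[OF _ _ uF])
    show "((\<lambda>t. prod_pv (w n t)) has_real_derivative sq_vel (\<epsilon> n) (w n t) -
        sqrt (sq_pos (\<epsilon> n) (w n t)) * g t (sqrt (sq_pos (\<epsilon> n) (w n t)))) (at t within {0..T})"
      if "t \<in> {0..T}" for n t by (rule reg_derivatives(3)[OF \<epsilon>(1,2) w that])
    show "(\<lambda>n. prod_pv (w n t)) \<longlonglongrightarrow> B t" if "t \<in> {0..T}" for t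
      unfolding B_def by (rule ptw[OF uB that])
  qed (use that T_pos in auto)
  have AC: "A t * C t = (B t)\<^sup>2" "0 \<le> A t" "0 \<le> C t" for t
    using sq_prod[of 0 "W t"] sq_nonneg[of 0 "W t"] by (auto simp: A_def B_def C_def)
  have "continuous_on {0..T} (w n)" for n
    using w has_vector_derivative_continuous continuous_on_eq_continuous_within by blast
  then have W: "continuous_on {0..T} W"
    by (intro uniform_limit_theorem[OF _ lim]) auto
  have "continuous_on {0..T} C"
    unfolding C_def sq_vel_def energy_def using W by (intro continuous_intros) auto
  moreover have "1 + (A t + C t) \<le> exp ((1 + 2 * G) * T) * (1 + (A s + C s))"
    if "s \<in> {0..T}" "t \<in> {0..T}" for s t
    unfolding A_def C_def sq_sum
  proof (rule tendsto_le)
    show "(\<lambda>n. 1 + energy (\<epsilon> n) (w n t)) \<longlonglongrightarrow> 1 + energy 0 (W t)"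
      by (intro tendsto_intros ptw[OF uE] that)
    show "(\<lambda>n. exp ((1 + 2 * G) * T) * (1 + energy (\<epsilon> n) (w n s)))
        \<longlonglongrightarrow> exp ((1 + 2 * G) * T) * (1 + energy 0 (W s))"
      by (intro tendsto_intros ptw[OF uE] that)
    show "\<forall>\<^sub>F n in sequentially. 1 + energy (\<epsilon> n) (w n t)
        \<le> exp ((1 + 2 * G) * T) * (1 + energy (\<epsilon> n) (w n s))"
      by (intro always_eventually allI reg_energy_growth[OF \<epsilon>(1,2) w] that)
  qed simp
  ultimately show "bounce_motion A B C"
    unfolding bounce_motion_def using dA dB AC by blast
  fix a b assume ab: "0 \<le> a" "a < b" "b \<le> T" and zero: "\<forall>t\<in>{a..b}. A t = 0"
  have sub: "{a..b} \<subseteq> {0..T}" using ab by auto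
  show "\<exists>t\<in>{a..b}. 0 \<le> g t 0"
  proof (rule ccontr)
    assume "\<not> (\<exists>t\<in>{a..b}. 0 \<le> g t 0)"
    then have neg: "g t 0 < 0" if "t \<in> {a..b}" for t using that by (auto simp: not_le)
    have B0: "B t = 0" if "t \<in> {a..b}" for t using AC(1)[of t] zero that by simp
    have C0: "C t = 0" if t: "t \<in> {a..b}" for t
    proof -
      have "(B has_vector_derivative C t) (at t within {a..b})"
        using DERIV_subset[OF dB[of t] sub] zero t sub
        by (auto simp: has_real_derivative_iff_has_vector_derivative)
      moreover have "(B has_vector_derivative 0) (at t within {a..b})"
        by (rule has_vector_derivative_transform[OF t _ has_vector_derivative_const[of 0]]) (rule B0)
      ultimately show ?thesis
        using vector_derivative_unique_within_closed_interval[OF ab(2)] t by auto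
    qed
    have "continuous_on {a..b} (\<lambda>t. g t (sqrt 0))"
      using sub by (intro force_continuous continuous_intros) auto
    then obtain t1 where "t1 \<in> {a..b}" and t1: "\<And>t. t \<in> {a..b} \<Longrightarrow> g t 0 \<le> g t1 0"
      using continuous_attains_sup[of "{a..b}" "\<lambda>t. g t (sqrt 0)"] ab by auto
    \<comment> \<open>Half the minimum of the absolute value of g(t,0) on the interval; the other
      half is spent on the uniform convergence of the force.\<close>
    define c where "c = - g t1 0 / 2"
    have "c > 0" using neg[OF \<open>t1 \<in> {a..b}\<close>] by (simp add: c_def)
    define y where "y n t = prod_pv (w n t) / sqrt (sq_pos (\<epsilon> n) (w n t))" for n t
    have "\<forall>\<^sub>F n in sequentially. c * (b - a) \<le> sqrt (sq_vel (\<epsilon> n) (w n b)) + sqrt (sq_vel (\<epsilon> n) (w n a))"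
      using uniform_limitD[OF ug \<open>c > 0\<close>]
    proof eventually_elim
      case (elim n)
      define D where "D t = (\<epsilon> n)\<^sup>2 / (sqrt (sq_pos (\<epsilon> n) (w n t)) * (sqrt (sq_pos (\<epsilon> n) (w n t)))\<^sup>2)
          - g t (sqrt (sq_pos (\<epsilon> n) (w n t)))" for t
      have "(y n has_derivative (\<lambda>h. D t * h)) (at t within {a..b})" if "t \<in> {a..b}" for t
        using DERIV_subset[OF reg_derivatives(4)[OF \<epsilon>(1,2) w, of t n] sub] that sub
        unfolding y_def[abs_def] D_def has_field_derivative_def by auto
      then obtain t where t: "t \<in> {a..b}" "y n b - y n a = D t * (b - a)"
        using mvt_very_simple[of a b "y n" "\<lambda>t h. D t * h"] ab by auto
      have "dist (g t (sqrt (sq_pos (\<epsilon> n) (w n t)))) (g t (sqrt (sq_pos 0 (W t)))) < c"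
        using elim t sub by blast
      then have "g t (sqrt (sq_pos (\<epsilon> n) (w n t))) < g t 0 + c"
        using zero t(1) unfolding dist_real_def A_def by auto
      moreover have "g t 0 \<le> - 2 * c" using t1[OF t(1)] by (simp add: c_def)
      moreover have "0 \<le> (\<epsilon> n)\<^sup>2 / (sqrt (sq_pos (\<epsilon> n) (w n t)) * (sqrt (sq_pos (\<epsilon> n) (w n t)))\<^sup>2)"
        using sq_nonneg by simp
      ultimately have "c \<le> D t" unfolding D_def by argo
      then have "c * (b - a) \<le> y n b - y n a" unfolding t(2) using ab by (intro mult_right_mono) auto
      then show ?case
        using velocity_bound[OF \<epsilon>(1)[of n], of "w n b"] velocity_bound[OF \<epsilon>(1)[of n], of "w n a"]
        unfolding y_def by argo
    qed
    moreover have "(\<lambda>n. sqrt (sq_vel (\<epsilon> n) (w n b)) + sqrt (sq_vel (\<epsilon> n) (w n a)))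
        \<longlonglongrightarrow> sqrt (C b) + sqrt (C a)"
      unfolding C_def using ab by (intro tendsto_intros ptw[OF uC]) auto
    ultimately have "c * (b - a) \<le> sqrt (C b) + sqrt (C a)"
      by (intro tendsto_lowerbound) auto
    then have "c * (b - a) \<le> 0" using C0 ab by simp
    then show False using \<open>c > 0\<close> ab by (simp add: mult_le_0_iff)
  qed
qed

theorem bounce_motion_exists:
  assumes "R > 0"
  obtains A B C \<mu> where "bounce_motion A B C" "1 \<le> \<mu>"
    "A T = \<mu> * A 0" "B T = \<mu> * B 0" "C T = \<mu> * C 0" "\<mu> = 1 \<or> A 0 + C 0 = R"
    "\<And>a b. 0 \<le> a \<Longrightarrow> a < b \<Longrightarrow> b \<le> T \<Longrightarrow> \<forall>t\<in>{a..b}. A t = 0 \<Longrightarrow> \<exists>t\<in>{a..b}. 0 \<le> g t 0"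
proof -
  define \<epsilon> where "\<epsilon> n = inverse (real (Suc n))" for n
  have \<epsilon>: "0 < \<epsilon> n" "\<epsilon> n \<le> 1" for n by (auto simp: \<epsilon>_def divide_simps)
  have \<epsilon>0: "\<epsilon> \<longlonglongrightarrow> 0" unfolding \<epsilon>_def by (rule LIMSEQ_inverse_real_of_nat)
  have K0: "0 \<le> 9 + 15 * G" using G_nonneg by simp
  have "\<exists>w \<mu>. (\<forall>t\<in>{0..T}. (w has_vector_derivative reg_field g (\<epsilon> n) t (w t)) (at t within {0..T})) \<and>
      w T = \<mu> *\<^sub>R w 0 \<and> 1 \<le> \<mu> \<and> norm (w 0) \<le> R \<and> (\<mu> = 1 \<or> norm (w 0) = R)" for n
  proof (rule ode_radial_fixed_point[OF T_pos \<open>R > 0\<close> reg_field_continuous[OF \<epsilon>(1)] K0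
        reg_field_growth[OF _ \<epsilon>]])
    fix w \<mu>
    assume "\<And>t. t \<in> {0..T} \<Longrightarrow>
        (w has_vector_derivative reg_field g (\<epsilon> n) t (w t)) (at t within {0..T})"
      "w T = \<mu> *\<^sub>R w 0" "1 \<le> \<mu>" "norm (w 0) \<le> R" "\<mu> = 1 \<or> norm (w 0) = R"
    then show ?thesis by blast
  qed
  then obtain w \<mu> where w: "\<And>n t. t \<in> {0..T} \<Longrightarrow>
      (w n has_vector_derivative reg_field g (\<epsilon> n) t (w n t)) (at t within {0..T})"
    and \<mu>: "\<And>n. w n T = \<mu> n *\<^sub>R w n 0" "\<And>n. 1 \<le> \<mu> n" "\<And>n. norm (w n 0) \<le> R"
      "\<And>n. \<mu> n = 1 \<or> norm (w n 0) = R"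
    by metis
  \<comment> \<open>R + 3 bounds 1 + energy at time 0, since the energy exceeds the norm by at most
    2 \<epsilon> \<le> 2.\<close>
  define M where "M = exp ((1 + 2 * G) * T) * (R + 3)"
  have M: "norm (w n t) \<le> M" if "t \<in> {0..T}" for n t
  proof -
    have "norm (w n t) \<le> 1 + energy (\<epsilon> n) (w n t)" using energy_bounds(2)[of "w n t" "\<epsilon> n"] by simp
    also have "\<dots> \<le> exp ((1 + 2 * G) * T) * (1 + energy (\<epsilon> n) (w n 0))"
      by (rule reg_energy_growth[OF \<epsilon> w _ that]) (use T_pos in auto)
    also have "\<dots> \<le> M" unfolding M_def
    proof (rule mult_left_mono)
      have "2 * \<bar>\<epsilon> n\<bar> \<le> 2" using \<epsilon>[of n] by simp
      then show "1 + energy (\<epsilon> n) (w n 0) \<le> R + 3"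
        using energy_bounds(3)[of "\<epsilon> n" "w n 0"] \<mu>(3)[of n] by argo
    qed simp
    finally show ?thesis .
  qed
  obtain W k where "continuous_on {0..T} W" and k: "strict_mono k"
    and lim: "uniform_limit {0..T} (\<lambda>n. w (k n)) W sequentially"
    by (rule Lipschitz_Arzela_Ascoli[OF compact_Icc M reg_Lipschitz[OF \<epsilon> w M]])
  have \<epsilon>k: "(\<lambda>n. \<epsilon> (k n)) \<longlonglongrightarrow> 0" using LIMSEQ_subseq_LIMSEQ[OF \<epsilon>0 k] by (simp add: o_def)
  have w0: "(\<lambda>n. w (k n) 0) \<longlonglongrightarrow> W 0" using T_pos by (intro tendsto_uniform_limitI[OF lim]) auto
  have wT: "(\<lambda>n. \<mu> (k n) *\<^sub>R w (k n) 0) \<longlonglongrightarrow> W T"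
    unfolding \<mu>(1)[symmetric] using T_pos by (intro tendsto_uniform_limitI[OF lim]) auto
  obtain l where l: "W T = l *\<^sub>R W 0" "1 \<le> l" "norm (W 0) \<le> R" "l = 1 \<or> norm (W 0) = R"
    by (rule radial_multiple_limit[OF w0 wT \<open>R > 0\<close> \<mu>(3) \<mu>(2) \<mu>(4)])
  \<comment> \<open>Without regularisation the energy is the norm of the coordinates, so the sphere
    of radius R becomes A 0 + C 0 = R.\<close>
  have en: "energy 0 v = norm v" for v unfolding energy_def norm_prod_def by simp
  show thesis
  proof (rule that)
    show "bounce_motion (\<lambda>t. sq_pos 0 (W t)) (\<lambda>t. prod_pv (W t)) (\<lambda>t. sq_vel 0 (W t))"
      by (rule reg_sequence_limit(1)[OF \<epsilon> \<epsilon>k w M lim])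
    show "1 \<le> l" by (rule l)
    show "\<exists>t\<in>{a..b}. 0 \<le> g t 0"
      if "0 \<le> a" "a < b" "b \<le> T" "\<forall>t\<in>{a..b}. sq_pos 0 (W t) = 0" for a b
      by (rule reg_sequence_limit(2)[OF \<epsilon> \<epsilon>k w M lim that])
    show "sq_pos 0 (W T) = l * sq_pos 0 (W 0)" "sq_vel 0 (W T) = l * sq_vel 0 (W 0)"
      "prod_pv (W T) = l * prod_pv (W 0)"
      unfolding sq_pos_def sq_vel_def prod_pv_def en using l(1,2) by (auto simp: algebra_simps)
    show "l = 1 \<or> sq_pos 0 (W 0) + sq_vel 0 (W 0) = R" using l(4) unfolding sq_sum en .
  qed
qed

end

section \<open>The rotation of a bouncing motion\<close>

text \<open>Twice the energy of the oscillator x'' = - \<omega>^2 x, which elastic bounces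
  preserve.\<close>

definition ell_energy :: "real \<Rightarrow> (real \<Rightarrow> real) \<Rightarrow> (real \<Rightarrow> real) \<Rightarrow> real \<Rightarrow> real" where
  "ell_energy \<omega> A C t = \<omega>\<^sup>2 * A t + C t"

text \<open>Clockwise angular speed of the complex number (\<omega> x + i x')^2. Squaring doubles
  the angle, which closes the half-plane up to a plane and explains the factor 2. For g = \<omega>^2
  x the speed is 2 \<omega>, one full turn for each interval between bounces.\<close>

definition ang_speed :: "(real \<Rightarrow> real \<Rightarrow> real) \<Rightarrow> real \<Rightarrow> (real \<Rightarrow> real) \<Rightarrow> (real \<Rightarrow> real) \<Rightarrow> real \<Rightarrow> real" where
  "ang_speed g \<omega> A C t =
     2 * \<omega> * (C t + sqrt (A t) * g t (sqrt (A t))) / ell_energy \<omega> A C t"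

context half_line_oscillator
begin

context
  fixes A B C :: "real \<Rightarrow> real"
  assumes bm: "bounce_motion A B C" and energy_pos: "\<And>t. t \<in> {0..T} \<Longrightarrow> 0 < A t + C t"
begin

lemma motion:
  assumes "t \<in> {0..T}"
  shows "0 \<le> A t" "0 \<le> C t" "A t * C t = (B t)\<^sup>2"
    "(A has_real_derivative 2 * B t) (at t within {0..T})"
    "(B has_real_derivative C t - sqrt (A t) * g t (sqrt (A t))) (at t within {0..T})"
  using bm assms unfolding bounce_motion_def by blast+

lemma motion_continuous:
  "continuous_on {0..T} A" "continuous_on {0..T} B" "continuous_on {0..T} C"
proof -
  show "continuous_on {0..T} A" by (rule DERIV_continuous_on) (rule motion(4))
  show "continuous_on {0..T} B" by (rule DERIV_continuous_on) (rule motion(5))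
  show "continuous_on {0..T} C" using bm unfolding bounce_motion_def by (rule conjunct1)
qed

lemma force_continuous_motion: "continuous_on {0..T} (\<lambda>t. g t (sqrt (A t)))"
  using motion(1) by (intro force_continuous motion_continuous continuous_intros) auto

text \<open>A zero of \<open>A\<close> is a simple zero of \<open>B\<close>, because \<open>B' = C > 0\<close> there.\<close>

lemma finite_impacts: "finite ({0..T} \<inter> {t. A t = 0})"
proof -
  let ?Z = "{0..T} \<inter> {t. A t = 0}"
  have "\<not> r islimpt ?Z" if r: "r \<in> {0..T}" for r
  proof
    assume "r islimpt ?Z"
    then have nt: "at r within ?Z \<noteq> bot" by (simp add: trivial_limit_within)
    have "(A \<longlongrightarrow> A r) (at r within ?Z)"
      using motion_continuous(1) r unfolding continuous_on_def
      by (auto intro: tendsto_within_subset)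
    moreover have "(A \<longlongrightarrow> 0) (at r within ?Z)"
      by (rule tendsto_eventually) (auto simp: eventually_at_filter)
    ultimately have "A r = 0" using tendsto_unique[OF nt] by blast
    then have Br: "B r = 0" and Cr: "C r > 0"
      using motion(3)[OF r] energy_pos[OF r] by auto
    have "(B has_real_derivative C r) (at r within ?Z)"
      using DERIV_subset[OF motion(5)[OF r], of ?Z] \<open>A r = 0\<close> by simp
    then have "((\<lambda>y. (B y - B r) / (y - r)) \<longlongrightarrow> C r) (at r within ?Z)"
      by (simp add: has_field_derivative_iff)
    moreover have "((\<lambda>y. (B y - B r) / (y - r)) \<longlongrightarrow> 0) (at r within ?Z)"
    proof (rule tendsto_eventually)
      have "B y = 0" if "y \<in> ?Z" for y using motion(3)[of y] that by simp
      then show "\<forall>\<^sub>F y in at r within ?Z. (B y - B r) / (y - r) = 0"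
        using Br by (auto simp: eventually_at_filter)
    qed
    ultimately show False using tendsto_unique[OF nt] Cr by fastforce
  qed
  then have "finite ({0..T} \<inter> ?Z)" by (rule finite_not_islimpt_in_compact[OF compact_Icc])
  then show ?thesis by (simp add: Int_assoc[symmetric])
qed

text \<open>Away from impacts C = B^2 / A. At an impact only continuity of C is available: the
  right-hand side is - 2 x' g, and x' changes sign there.\<close>

lemma C_derivative:
  assumes t: "t \<in> {0<..<T}" and "A t \<noteq> 0"
  shows "(C has_real_derivative - 2 * (B t / sqrt (A t)) * g t (sqrt (A t))) (at t)"
proof -
  have t': "t \<in> {0..T}" using t by auto
  have at: "at t within {0..T} = at t" using t by (intro at_within_interior) simp
  have dA: "(A has_real_derivative 2 * B t) (at t)"
    and dB: "(B has_real_derivative C t - sqrt (A t) * g t (sqrt (A t))) (at t)"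
    using motion(4,5)[OF t'] unfolding at .
  define x y f where "x = sqrt (A t)" and "y = B t / x" and "f = g t x"
  have x: "0 < x" and Ax: "A t = x * x" using motion(1)[OF t'] assms(2) by (auto simp: x_def)
  have By: "B t = x * y" using x by (simp add: y_def)
  have Cy: "C t = y * y"
    using motion(3)[OF t'] x unfolding Ax By by (simp add: power2_eq_square mult_ac)
  have "((\<lambda>t. (B t)\<^sup>2 / A t) has_real_derivative
      (2 * B t * (C t - x * f) * A t - (B t)\<^sup>2 * (2 * B t)) / (A t * A t)) (at t)"
    using assms(2) unfolding x_def f_def by (auto intro!: derivative_eq_intros dA dB)
  moreover have "(2 * B t * (C t - x * f) * A t - (B t)\<^sup>2 * (2 * B t)) / (A t * A t) = - 2 * y * f"
    using x unfolding Ax By Cy by (simp add: field_simps power2_eq_square)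
  moreover have "\<forall>\<^sub>F s in nhds t. (B s)\<^sup>2 / A s = C s"
  proof -
    have "(A \<longlongrightarrow> A t) (nhds t)"
      using DERIV_isCont[OF dA] by (simp add: isCont_def tendsto_at_iff_tendsto_nhds)
    then have "\<forall>\<^sub>F s in nhds t. A s \<noteq> 0"
      using assms(2) by (rule tendsto_imp_eventually_ne)
    moreover have "\<forall>\<^sub>F s in nhds t. s \<in> {0<..<T}" using t by (intro eventually_nhds_in_open) auto
    ultimately show ?thesis
    proof eventually_elim
      case (elim s)
      then show ?case using motion(3)[of s] by (simp add: field_simps)
    qed
  qed
  ultimately show ?thesis
    using DERIV_cong_ev[OF refl, of "\<lambda>t. (B t)\<^sup>2 / A t" C t "- 2 * y * f" "- 2 * y * f"]
    by (simp add: y_def f_def x_def)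
qed

section \<open>Energy and angle measured with a fixed frequency \<omega>\<close>

context
  fixes \<omega> :: real
  assumes \<omega>_pos: "0 < \<omega>"
begin

lemma ell_energy_pos:
  assumes "t \<in> {0..T}"
  shows "0 < ell_energy \<omega> A C t"
proof (cases "A t = 0")
  case False
  then have "0 < \<omega>\<^sup>2 * A t" using motion(1)[OF assms] \<omega>_pos by simp
  then show ?thesis using motion(2)[OF assms] unfolding ell_energy_def by simp
qed (use energy_pos[OF assms] in \<open>simp add: ell_energy_def\<close>)

lemma ell_energy_continuous: "continuous_on {0..T} (ell_energy \<omega> A C)"
  unfolding ell_energy_def by (intro continuous_intros motion_continuous)

lemma ang_speed_continuous: "continuous_on {0..T} (ang_speed g \<omega> A C)"
  unfolding ang_speed_def using ell_energy_pos
  by (intro continuous_intros motion_continuous force_continuous_motion ell_energy_continuous) force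

lemma ell_energy_derivative:
  assumes "t \<in> {0<..<T}" "A t \<noteq> 0"
  shows "(ell_energy \<omega> A C has_real_derivative
    - 2 * (B t / sqrt (A t)) * (g t (sqrt (A t)) - \<omega>\<^sup>2 * sqrt (A t))) (at t)"
proof -
  have at: "at t within {0..T} = at t" using assms by (intro at_within_interior) simp
  have dA: "(A has_real_derivative 2 * B t) (at t)" using motion(4)[of t] assms unfolding at by auto
  have "sqrt (A t) \<noteq> 0" using assms by simp
  then show ?thesis unfolding ell_energy_def
    by (auto intro!: derivative_eq_intros dA C_derivative assms simp: field_simps)
qed

text \<open>The two functions are the real and imaginary parts of (\<omega> x + i x')^2 divided by
  its modulus, a unit vector that does not see the sign of x' at x = 0.\<close>

lemma direction_derivative:
  assumes t: "t \<in> {0<..<T}" "A t \<noteq> 0"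
  shows "((\<lambda>t. (\<omega>\<^sup>2 * A t - C t) / ell_energy \<omega> A C t) has_real_derivative
      ang_speed g \<omega> A C t * (2 * \<omega> * B t / ell_energy \<omega> A C t)) (at t)"
    and "((\<lambda>t. 2 * \<omega> * B t / ell_energy \<omega> A C t) has_real_derivative
      - ang_speed g \<omega> A C t * ((\<omega>\<^sup>2 * A t - C t) / ell_energy \<omega> A C t)) (at t)"
proof -
  have t': "t \<in> {0..T}" using t by auto
  have at: "at t within {0..T} = at t" using t by (intro at_within_interior) simp
  define x y f where "x = sqrt (A t)" and "y = B t / x" and "f = g t x"
  have x: "0 < x" and Ax: "A t = x * x" using motion(1)[OF t'] t by (auto simp: x_def)
  have By: "B t = x * y" using x by (simp add: y_def)
  have Cy: "C t = y * y"
    using motion(3)[OF t'] x unfolding Ax By by (simp add: power2_eq_square mult_ac)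
  have dA: "(A has_real_derivative 2 * B t) (at t)"
    and dB: "(B has_real_derivative C t - x * f) (at t)"
    using motion(4,5)[OF t'] unfolding at x_def f_def .
  have dC: "(C has_real_derivative - 2 * y * f) (at t)"
    using C_derivative[OF t] by (simp add: x_def y_def f_def)
  have dE: "(ell_energy \<omega> A C has_real_derivative - 2 * y * (f - \<omega>\<^sup>2 * x)) (at t)"
    using ell_energy_derivative[OF t] by (simp add: x_def y_def f_def)
  define E where "E = ell_energy \<omega> A C t"
  have E: "E = \<omega>\<^sup>2 * (x * x) + y * y" unfolding E_def ell_energy_def Ax Cy ..
  have E0: "E \<noteq> 0" using ell_energy_pos[OF t'] by (simp add: E_def)
  have \<Omega>: "ang_speed g \<omega> A C t = 2 * \<omega> * (y * y + x * f) / E"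
    unfolding ang_speed_def E_def Cy x_def f_def ..
  have "((\<lambda>t. (\<omega>\<^sup>2 * A t - C t) / ell_energy \<omega> A C t) has_real_derivative
      ((\<omega>\<^sup>2 * (2 * B t) - - 2 * y * f) * E - (\<omega>\<^sup>2 * A t - C t) * (- 2 * y * (f - \<omega>\<^sup>2 * x))) / (E * E)) (at t)"
    unfolding E_def by (rule derivative_eq_intros dA dC dE refl | use E0 in \<open>simp add: E_def\<close>)+
  moreover have "(\<omega>\<^sup>2 * (2 * B t) - - 2 * y * f) * E - (\<omega>\<^sup>2 * A t - C t) * (- 2 * y * (f - \<omega>\<^sup>2 * x))
      = 2 * \<omega> * (y * y + x * f) * (2 * \<omega> * B t)"
    unfolding Ax By Cy E by (simp add: algebra_simps power2_eq_square)
  ultimately show "((\<lambda>t. (\<omega>\<^sup>2 * A t - C t) / ell_energy \<omega> A C t) has_real_derivative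
      ang_speed g \<omega> A C t * (2 * \<omega> * B t / ell_energy \<omega> A C t)) (at t)"
    unfolding \<Omega> E_def[symmetric] by simp
  have "((\<lambda>t. 2 * \<omega> * B t / ell_energy \<omega> A C t) has_real_derivative
      ((2 * \<omega> * (C t - x * f)) * E - (2 * \<omega> * B t) * (- 2 * y * (f - \<omega>\<^sup>2 * x))) / (E * E)) (at t)"
    unfolding E_def by (rule derivative_eq_intros dB dE refl | use E0 in \<open>simp add: E_def\<close>)+
  moreover have "(2 * \<omega> * (C t - x * f)) * E - (2 * \<omega> * B t) * (- 2 * y * (f - \<omega>\<^sup>2 * x))
      = - (2 * \<omega> * (y * y + x * f)) * (\<omega>\<^sup>2 * A t - C t)"
    unfolding Ax By Cy E by (simp add: algebra_simps power2_eq_square)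
  ultimately show "((\<lambda>t. 2 * \<omega> * B t / ell_energy \<omega> A C t) has_real_derivative
      - ang_speed g \<omega> A C t * ((\<omega>\<^sup>2 * A t - C t) / ell_energy \<omega> A C t)) (at t)"
    unfolding \<Omega> E_def[symmetric] by simp
qed

text \<open>Turning (p, q) back by the accumulated angle gives functions with zero derivative away
  from impacts. They are continuous across the impacts, of which there are finitely many, so they
  are constant.\<close>

lemma direction_rotation:
  assumes "t \<in> {0..T}"
  defines "p \<equiv> \<lambda>t. (\<omega>\<^sup>2 * A t - C t) / ell_energy \<omega> A C t" and "q \<equiv> \<lambda>t. 2 * \<omega> * B t / ell_energy \<omega> A C t"
    and "\<theta> \<equiv> \<lambda>t. integral {0..t} (ang_speed g \<omega> A C)"
  shows "p t = p 0 * cos (\<theta> t) + q 0 * sin (\<theta> t)"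
    and "q t = q 0 * cos (\<theta> t) - p 0 * sin (\<theta> t)"
    and "(p 0)\<^sup>2 + (q 0)\<^sup>2 = 1"
proof -
  have d\<theta>: "(\<theta> has_real_derivative ang_speed g \<omega> A C r) (at r within {0..T})" if "r \<in> {0..T}" for r
    unfolding \<theta>_def using integral_has_real_derivative[OF ang_speed_continuous that] .
  have cont_\<theta>: "continuous_on {0..T} \<theta>"
    by (rule DERIV_continuous_on) (rule d\<theta>)
  have cont_p: "continuous_on {0..T} p" and cont_q: "continuous_on {0..T} q"
    unfolding p_def q_def using ell_energy_pos
    by (intro continuous_intros motion_continuous ell_energy_continuous; force)+
  have sub: "{0..t} \<subseteq> {0..T}" using assms(1) by auto
  have const: "f t = f 0" if "continuous_on {0..T} f"
    and d: "\<And>r. r \<in> {0<..<T} \<Longrightarrow> A r \<noteq> 0 \<Longrightarrow> (f has_real_derivative 0) (at r)" for f :: "real \<Rightarrow> real"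
  proof -
    have "((\<lambda>_. 0) has_integral (f t - f 0)) {0..t}"
    proof (rule fundamental_theorem_of_calculus_interior_strong[OF finite_impacts])
      show "(f has_vector_derivative 0) (at r)"
        if "r \<in> {0<..<t} - ({0..T} \<inter> {t. A t = 0})" for r
        using d[of r] that assms(1) by (auto simp: has_real_derivative_iff_has_vector_derivative)
    qed (use continuous_on_subset[OF \<open>continuous_on {0..T} f\<close> sub] assms(1) in auto)
    then show ?thesis using has_integral_unique[OF has_integral_0] by force
  qed
  have d: "(\<theta> has_real_derivative ang_speed g \<omega> A C r) (at r)" if "r \<in> {0<..<T}" for r
  proof -
    have "at r within {0..T} = at r" using that by (intro at_within_interior) simp
    then show ?thesis using d\<theta>[of r] that by auto
  qed
  have dp: "(p has_real_derivative ang_speed g \<omega> A C r * q r) (at r)"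
    and dq: "(q has_real_derivative - ang_speed g \<omega> A C r * p r) (at r)" if "r \<in> {0<..<T}" "A r \<noteq> 0" for r
    unfolding p_def q_def by (rule direction_derivative[OF that])+
  have \<theta>0: "\<theta> 0 = 0" by (simp add: \<theta>_def)
  have "p t * cos (\<theta> t) - q t * sin (\<theta> t) = p 0 * cos (\<theta> 0) - q 0 * sin (\<theta> 0)"
  proof (rule const)
    fix r assume r: "r \<in> {0<..<T}" "A r \<noteq> 0"
    show "((\<lambda>t. p t * cos (\<theta> t) - q t * sin (\<theta> t)) has_real_derivative 0) (at r)"
      by (auto intro!: derivative_eq_intros dp[OF r] dq[OF r] d[OF r(1)] simp: algebra_simps)
  qed (intro continuous_intros cont_p cont_q cont_\<theta>)
  then have 1: "p t * cos (\<theta> t) - q t * sin (\<theta> t) = p 0" using \<theta>0 by simp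
  have "p t * sin (\<theta> t) + q t * cos (\<theta> t) = p 0 * sin (\<theta> 0) + q 0 * cos (\<theta> 0)"
  proof (rule const)
    fix r assume r: "r \<in> {0<..<T}" "A r \<noteq> 0"
    show "((\<lambda>t. p t * sin (\<theta> t) + q t * cos (\<theta> t)) has_real_derivative 0) (at r)"
      by (auto intro!: derivative_eq_intros dp[OF r] dq[OF r] d[OF r(1)] simp: algebra_simps)
  qed (intro continuous_intros cont_p cont_q cont_\<theta>)
  then have 2: "p t * sin (\<theta> t) + q t * cos (\<theta> t) = q 0" using \<theta>0 by simp
  have cs: "cos (\<theta> t) * cos (\<theta> t) + sin (\<theta> t) * sin (\<theta> t) = 1"
    using sin_cos_squared_add3[of "\<theta> t"] .
  have "p t = p t * (cos (\<theta> t) * cos (\<theta> t) + sin (\<theta> t) * sin (\<theta> t))" unfolding cs by simp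
  also have "\<dots> = p 0 * cos (\<theta> t) + q 0 * sin (\<theta> t)"
    unfolding 1[symmetric] 2[symmetric] by algebra
  finally show "p t = p 0 * cos (\<theta> t) + q 0 * sin (\<theta> t)" .
  have "q t = q t * (cos (\<theta> t) * cos (\<theta> t) + sin (\<theta> t) * sin (\<theta> t))" unfolding cs by simp
  also have "\<dots> = q 0 * cos (\<theta> t) - p 0 * sin (\<theta> t)"
    unfolding 1[symmetric] 2[symmetric] by algebra
  finally show "q t = q 0 * cos (\<theta> t) - p 0 * sin (\<theta> t)" .
  have z: "0 \<in> {0..T}" using T_pos by simp
  have "(\<omega>\<^sup>2 * A 0 - C 0)\<^sup>2 + (2 * \<omega> * B 0)\<^sup>2 = (ell_energy \<omega> A C 0)\<^sup>2"
    unfolding power_mult_distrib motion(3)[OF z, symmetric] ell_energy_def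
    by (simp add: power2_eq_square algebra_simps)
  then show "(p 0)\<^sup>2 + (q 0)\<^sup>2 = 1"
    using ell_energy_pos[OF z] unfolding p_def q_def
    by (simp add: power_divide flip: add_divide_distrib)
qed

text \<open>The direction (p, q) is homogeneous of degree 0 in (A, B, C). It therefore returns to
  itself, and a rotation of the plane that fixes a unit vector has cosine 1.\<close>

lemma return_angle:
  assumes "0 < \<mu>" "A T = \<mu> * A 0" "B T = \<mu> * B 0" "C T = \<mu> * C 0"
  obtains k :: int where "integral {0..T} (ang_speed g \<omega> A C) = 2 * pi * k"
proof -
  define p where "p t = (\<omega>\<^sup>2 * A t - C t) / ell_energy \<omega> A C t" for t
  define q where "q t = 2 * \<omega> * B t / ell_energy \<omega> A C t" for t
  define \<theta> where "\<theta> = integral {0..T} (ang_speed g \<omega> A C)"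
  have T: "T \<in> {0..T}" using T_pos by simp
  have E: "ell_energy \<omega> A C T = \<mu> * ell_energy \<omega> A C 0"
    unfolding ell_energy_def assms(2-) by (simp add: algebra_simps)
  have "p T = (\<mu> * (\<omega>\<^sup>2 * A 0 - C 0)) / (\<mu> * ell_energy \<omega> A C 0)"
    "q T = (\<mu> * (2 * \<omega> * B 0)) / (\<mu> * ell_energy \<omega> A C 0)"
    unfolding p_def q_def E assms(2-) by (simp_all add: algebra_simps)
  then have "p T = p 0" "q T = q 0" using assms(1) by (simp_all add: p_def q_def)
  then have 1: "p 0 = p 0 * cos \<theta> + q 0 * sin \<theta>" and 2: "q 0 = q 0 * cos \<theta> - p 0 * sin \<theta>"
    using direction_rotation(1,2)[OF T] unfolding p_def q_def \<theta>_def by simp_all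
  have "1 = p 0 * p 0 + q 0 * q 0"
    using direction_rotation(3)[OF T] by (simp add: p_def q_def power2_eq_square)
  also have "\<dots> = p 0 * (p 0 * cos \<theta> + q 0 * sin \<theta>) + q 0 * (q 0 * cos \<theta> - p 0 * sin \<theta>)"
    using 1 2 by simp
  also have "\<dots> = cos \<theta> * (p 0 * p 0 + q 0 * q 0)" by (simp add: algebra_simps)
  also have "p 0 * p 0 + q 0 * q 0 = 1"
    using direction_rotation(3)[OF T] by (simp add: p_def q_def power2_eq_square)
  finally have "cos \<theta> = 1" by simp
  then obtain k :: int where "\<theta> = real_of_int k * 2 * pi" unfolding cos_one_2pi_int by blast
  then show thesis using that[of k] by (simp add: \<theta>_def)
qed

lemma log_energy_variation:
  assumes t: "t \<in> {0..T}"
  shows "\<bar>ln (ell_energy \<omega> A C t) - ln (ell_energy \<omega> A C 0)\<bar>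
    \<le> integral {0..T} (\<lambda>s. 2 * sqrt (C s) * \<bar>g s (sqrt (A s)) - \<omega>\<^sup>2 * sqrt (A s)\<bar> / ell_energy \<omega> A C s)"
    (is "_ \<le> integral _ ?h")
proof -
  \<comment> \<open>At an impact the quotient B / sqrt A has the form 0 / 0. The value 0 is harmless
    on a finite set and satisfies the bound.\<close>
  define D where "D s = (if A s = 0 then 0 else
    - 2 * (B s / sqrt (A s)) * (g s (sqrt (A s)) - \<omega>\<^sup>2 * sqrt (A s)) / ell_energy \<omega> A C s)" for s
  have sub: "{0..t} \<subseteq> {0..T}" using t by auto
  have cont_h: "continuous_on {0..T} ?h"
    using ell_energy_pos
    by (intro continuous_intros motion_continuous force_continuous_motion ell_energy_continuous) force
  have h0: "0 \<le> ?h s" if "s \<in> {0..T}" for s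
    using motion(2)[OF that] ell_energy_pos[OF that] by simp
  have D: "(D has_integral (ln (ell_energy \<omega> A C t) - ln (ell_energy \<omega> A C 0))) {0..t}"
  proof (rule fundamental_theorem_of_calculus_interior_strong[OF finite_impacts])
    fix r assume r: "r \<in> {0<..<t} - ({0..T} \<inter> {t. A t = 0})"
    then have r': "r \<in> {0<..<T}" "A r \<noteq> 0" using t by auto
    then have "0 < ell_energy \<omega> A C r" by (intro ell_energy_pos) auto
    with r' have "((\<lambda>t. ln (ell_energy \<omega> A C t)) has_real_derivative D r) (at r)"
      unfolding D_def
      by (auto intro!: derivative_eq_intros ell_energy_derivative simp: divide_inverse)
    then show "((\<lambda>t. ln (ell_energy \<omega> A C t)) has_vector_derivative D r) (at r)"
      by (simp add: has_real_derivative_iff_has_vector_derivative)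
  next
    show "continuous_on {0..t} (\<lambda>t. ln (ell_energy \<omega> A C t))"
      using ell_energy_pos sub
      by (intro continuous_intros continuous_on_subset[OF ell_energy_continuous sub]) force
  qed (use t in auto)
  have bound: "norm (D s) \<le> ?h s" if "s \<in> {0..t}" for s
  proof (cases "A s = 0")
    case False
    have s: "s \<in> {0..T}" using that sub by blast
    define u where "u = B s / sqrt (A s)"
    have "\<bar>u\<bar> = sqrt (C s)" unfolding u_def
    proof -
      have "sqrt (A s) * sqrt (C s) = \<bar>B s\<bar>"
        using motion(3)[OF s] by (simp flip: real_sqrt_mult)
      then have "\<bar>B s\<bar> / sqrt (A s) = sqrt (C s)" using False by (simp add: field_simps)
      then show "\<bar>B s / sqrt (A s)\<bar> = sqrt (C s)" using motion(1)[OF s] by simp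
    qed
    moreover have "D s = - 2 * u * (g s (sqrt (A s)) - \<omega>\<^sup>2 * sqrt (A s)) / ell_energy \<omega> A C s"
      using False by (simp add: D_def u_def)
    ultimately show ?thesis using ell_energy_pos[OF s] by (simp add: abs_mult)
  next
    case True
    have "0 \<le> ?h s" using that sub by (intro h0) auto
    with True show ?thesis by (simp add: D_def)
  qed
  have "norm (integral {0..t} D) \<le> integral {0..t} ?h"
  proof (rule integral_norm_bound_integral)
    show "D integrable_on {0..t}" using D by blast
    show "?h integrable_on {0..t}"
      by (rule integrable_continuous_real[OF continuous_on_subset[OF cont_h sub]])
  qed (rule bound)
  also have "\<dots> \<le> integral {0..T} ?h"
    using h0 by (intro integral_subset_le sub integrable_continuous_real cont_h
        continuous_on_subset[OF cont_h sub]) auto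
  finally show ?thesis using D by (simp add: integral_unique)
qed

end

text \<open>The total angle is continuous in the frequency and takes values in 2 pi times the
  integers, so it is constant on an interval of frequencies. This makes estimates obtained with two
  different frequencies comparable.\<close>

lemma return_angle_independent:
  assumes \<mu>: "0 < \<mu>" "A T = \<mu> * A 0" "B T = \<mu> * B 0" "C T = \<mu> * C 0"
    and \<omega>: "0 < \<omega>1" "\<omega>1 \<le> \<omega>2"
  shows "integral {0..T} (ang_speed g \<omega>1 A C) = integral {0..T} (ang_speed g \<omega>2 A C)"
proof -
  let ?\<Theta> = "\<lambda>\<omega>. integral (cbox 0 T) (ang_speed g \<omega> A C)"
  have "continuous_on ({\<omega>1..\<omega>2} \<times> cbox 0 T) (\<lambda>(\<omega>, t). ang_speed g \<omega> A C t)"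
  proof -
    have c: "continuous_on ({\<omega>1..\<omega>2} \<times> cbox 0 T) (\<lambda>p. f (snd p))"
      if "continuous_on {0..T} f" for f :: "real \<Rightarrow> real"
      by (intro continuous_on_compose2[OF that] continuous_intros) auto
    have "ell_energy \<omega> A C t \<noteq> 0" if "\<omega> \<in> {\<omega>1..\<omega>2}" "t \<in> cbox 0 T" for \<omega> t
      using ell_energy_pos[of \<omega> t] that \<omega> by force
    then show ?thesis
      unfolding split_beta ang_speed_def ell_energy_def
      by (intro continuous_intros c motion_continuous force_continuous_motion) auto
  qed
  then have cont: "continuous_on {\<omega>1..\<omega>2} ?\<Theta>" by (rule integral_continuous_on_param)
  have "?\<Theta> constant_on {\<omega>1..\<omega>2}"
  proof (rule continuous_discrete_range_constant[OF connected_Icc cont])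
    fix x assume x: "x \<in> {\<omega>1..\<omega>2}"
    show "\<exists>e>0. \<forall>y. y \<in> {\<omega>1..\<omega>2} \<and> ?\<Theta> y \<noteq> ?\<Theta> x \<longrightarrow> e \<le> norm (?\<Theta> y - ?\<Theta> x)"
    proof (intro exI[of _ "2 * pi"] conjI allI impI)
      fix y assume y: "y \<in> {\<omega>1..\<omega>2} \<and> ?\<Theta> y \<noteq> ?\<Theta> x"
      obtain k l :: int where "?\<Theta> x = 2 * pi * k" "?\<Theta> y = 2 * pi * l"
        using return_angle[OF _ \<mu>, of x] return_angle[OF _ \<mu>, of y] x y \<omega> by force
      moreover from this have "1 \<le> \<bar>real_of_int (l - k)\<bar>" using y by auto
      moreover have "norm (2 * pi * l - 2 * pi * k) = 2 * pi * \<bar>real_of_int (l - k)\<bar>"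
        by (simp add: abs_mult flip: right_diff_distrib)
      ultimately show "2 * pi \<le> norm (?\<Theta> y - ?\<Theta> x)" by simp
    qed simp
  qed
  then show ?thesis using \<omega> unfolding constant_on_def by force
qed

end

end

section \<open>Weighted integrals of lower limits\<close>

text \<open>Reducing s to the first period cell shifts the argument of the sine by a multiple of pi.
  This changes at most the sign, and on the first cell the sine is nonnegative.\<close>

lemma psi_eq_abs_sin:
  assumes "T > 0" "j > 0"
  shows "psi T j s = \<bar>sin (pi * real j / T * s)\<bar>"
proof -
  define \<omega> where "\<omega> = pi * real j / T"
  have \<omega>: "\<omega> > 0" using assms by (simp add: \<omega>_def)
  define c where "c = T / real j"
  have c: "c > 0" "\<omega> * c = pi" using assms by (auto simp: c_def \<omega>_def)
  define k where "k = \<lfloor>s / c\<rfloor>"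
  define r where "r = s rmod c"
  have s: "s = r + c * of_int k" using c by (simp add: r_def k_def rmod_def)
  have r: "0 \<le> r" "r < c" using rmod_nonneg[of c s] rmod_less[of c s] c by (auto simp: r_def)
  have "\<omega> * r \<le> \<omega> * c" using r \<omega> by (intro mult_left_mono) auto
  then have "0 \<le> sin (\<omega> * r)" using r \<omega> c by (intro sin_ge_zero) auto
  moreover have "\<bar>sin (\<omega> * s)\<bar> = \<bar>sin (\<omega> * r)\<bar>"
  proof -
    have "\<omega> * s = \<omega> * r + (\<omega> * c) * of_int k" by (simp add: s algebra_simps)
    then show ?thesis unfolding c(2) by (simp add: sin_add cos_npi_int sin_npi_int abs_mult)
  qed
  moreover have "sqrt (mu T j) = \<omega>" using assms by (simp add: mu_def \<omega>_def)
  ultimately show ?thesis by (simp add: psi_def r_def c_def \<omega>_def)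
qed

text \<open>Every phase is realised by an admissible shift: \<tau> matters only modulo T / j, and T
  / j \<le> T. Hence the Landesman-Lazer conditions cover whatever phase a limit of motions may
  have.\<close>

lemma psi_shift_eq_abs_cos:
  assumes "T > 0" "j > 0"
  obtains \<tau> where "\<tau> \<in> {0..T}" "\<And>t. psi T j (t + \<tau>) = \<bar>cos (pi * real j / T * t - \<phi>)\<bar>"
proof -
  define \<omega> where "\<omega> = pi * real j / T"
  have \<omega>: "\<omega> > 0" using assms by (simp add: \<omega>_def)
  define c where "c = T / real j"
  have c: "c > 0" "c \<le> T" "\<omega> * c = pi" using assms by (auto simp: c_def \<omega>_def divide_simps)
  define \<tau>0 where "\<tau>0 = (pi / 2 - \<phi>) / \<omega>"
  define \<tau> where "\<tau> = \<tau>0 rmod c"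
  have \<tau>: "\<tau> \<in> {0..T}"
    using rmod_nonneg[of c \<tau>0] rmod_less[of c \<tau>0] c by (auto simp: \<tau>_def)
  have "psi T j (t + \<tau>) = \<bar>cos (\<omega> * t - \<phi>)\<bar>" for t
  proof -
    define k where "k = \<lfloor>\<tau>0 / c\<rfloor>"
    have \<tau>_eq: "\<tau> = \<tau>0 - c * of_int k" using c by (simp add: \<tau>_def k_def rmod_def)
    have "\<omega> * (t + \<tau>) = \<omega> * t + \<omega> * \<tau>0 - (\<omega> * c) * of_int k"
      unfolding \<tau>_eq by (simp add: algebra_simps)
    also have "\<omega> * \<tau>0 = pi / 2 - \<phi>" using \<omega> by (simp add: \<tau>0_def)
    finally have "\<omega> * (t + \<tau>) = (pi / 2 + (\<omega> * t - \<phi>)) - pi * of_int k"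
      unfolding c(3) by simp
    then have "\<bar>sin (\<omega> * (t + \<tau>))\<bar> = \<bar>sin (pi / 2 + (\<omega> * t - \<phi>))\<bar>"
      by (simp add: sin_diff cos_npi_int sin_npi_int abs_mult)
    also have "sin (pi / 2 + (\<omega> * t - \<phi>)) = cos (\<omega> * t - \<phi>)" by (simp add: sin_add)
    finally show ?thesis using psi_eq_abs_sin[OF assms] by (simp add: \<omega>_def)
  qed
  with \<tau> show thesis by (intro that[of \<tau>]) (auto simp: \<omega>_def)
qed

section \<open>Lower limits at infinity and Fatou's lemma\<close>

lemma Liminf_at_top_eq_SUP_INF:
  fixes f :: "real \<Rightarrow> 'a::complete_lattice"
  shows "Liminf at_top f = (SUP n::nat. INF x\<in>{real n..}. f x)"
proof (rule antisym)
  show "Liminf at_top f \<le> (SUP n::nat. INF x\<in>{real n..}. f x)"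
    unfolding Liminf_def
  proof (rule SUP_least)
    fix P :: "real \<Rightarrow> bool" assume "P \<in> {P. eventually P at_top}"
    then obtain N where N: "\<And>x. N \<le> x \<Longrightarrow> P x" unfolding eventually_at_top_linorder by auto
    obtain n :: nat where "N \<le> real n" using real_arch_simple by blast
    then have "{real n..} \<subseteq> {x. P x}" using N by auto
    then have "(INF x\<in>{x. P x}. f x) \<le> (INF x\<in>{real n..}. f x)" by (rule INF_superset_mono) simp
    then show "(INF x\<in>{x. P x}. f x) \<le> (SUP n::nat. INF x\<in>{real n..}. f x)"
      by (rule order_trans) (rule SUP_upper, simp)
  qed
  show "(SUP n::nat. INF x\<in>{real n..}. f x) \<le> Liminf at_top f"
  proof (rule SUP_least)
    fix n :: nat
    have "eventually (\<lambda>x. real n \<le> x) at_top" by (rule eventually_ge_at_top)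
    then show "(INF x\<in>{real n..}. f x) \<le> Liminf at_top f"
      unfolding Liminf_def by (intro SUP_upper2[of "\<lambda>x. real n \<le> x"]) (auto simp: atLeast_def)
  qed
qed

text \<open>Each infimum runs over uncountably many x, but its strict sublevel sets are unions of
  relatively open sets. The outer supremum is over integers and hence countable.\<close>

lemma measurable_Liminf_at_top:
  fixes h :: "real \<Rightarrow> real \<Rightarrow> real"
  assumes S: "S \<in> sets lebesgue" and h: "\<And>x. 0 \<le> x \<Longrightarrow> continuous_on S (\<lambda>t. h t x)"
  shows "(\<lambda>t. Liminf at_top (\<lambda>x. ereal (h t x))) \<in> borel_measurable (lebesgue_on S)"
  unfolding Liminf_at_top_eq_SUP_INF
proof (rule borel_measurable_SUP)
  fix n :: nat
  show "(\<lambda>t. INF x\<in>{real n..}. ereal (h t x)) \<in> borel_measurable (lebesgue_on S)"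
  proof (rule borel_measurableI_less)
    fix y :: ereal
    have "\<exists>U. open U \<and> {t \<in> S. ereal (h t x) < y} = S \<inter> U" if "x \<in> {real n..}" for x
    proof -
      have "continuous_on S (\<lambda>t. ereal (h t x))"
        using h[of x] that by (intro continuous_on_ereal) auto
      then have "openin (top_of_set S) (S \<inter> (\<lambda>t. ereal (h t x)) -` {..<y})"
        by (intro continuous_openin_preimage_gen) auto
      then show ?thesis unfolding openin_open by (auto simp: vimage_def Int_def)
    qed
    then obtain U where U: "\<And>x. x \<in> {real n..} \<Longrightarrow> open (U x)"
      "\<And>x. x \<in> {real n..} \<Longrightarrow> {t \<in> S. ereal (h t x) < y} = S \<inter> U x" by metis
    have "{t \<in> space (lebesgue_on S). (INF x\<in>{real n..}. ereal (h t x)) < y}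
        = (\<Union>x\<in>{real n..}. {t \<in> S. ereal (h t x) < y})"
      by (auto simp: INF_less_iff)
    also have "\<dots> = S \<inter> (\<Union>x\<in>{real n..}. U x)" using U(2) by auto
    also have "\<dots> \<in> sets (lebesgue_on S)"
    proof -
      have "open (\<Union>x\<in>{real n..}. U x)" using U(1) by blast
      then have "(\<Union>x\<in>{real n..}. U x) \<in> sets lebesgue" by simp
      then show ?thesis using S by (simp add: sets_restrict_space_iff)
    qed
    finally show "{t \<in> space (lebesgue_on S). (INF x\<in>{real n..}. ereal (h t x)) < y}
      \<in> sets (lebesgue_on S)" .
  qed
qed simp

lemma nn_integral_eq_integral_Icc:
  fixes f :: "real \<Rightarrow> real"
  assumes "continuous_on {a..b} f" "\<And>t. t \<in> {a..b} \<Longrightarrow> 0 \<le> f t"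
  shows "(\<integral>\<^sup>+ t. ennreal (f t) \<partial>lebesgue_on {a..b}) = ennreal (integral {a..b} f)"
proof -
  have i: "integrable (lebesgue_on {a..b}) f" by (rule continuous_imp_integrable_real[OF assms(1)])
  have "AE t in lebesgue_on {a..b}. 0 \<le> f t" using assms(2) by (intro AE_I2) auto
  from nn_integral_eq_integral[OF i this] show ?thesis
    using lebesgue_integral_eq_integral[OF i] by simp
qed

text \<open>A subtraction-free form of the splitting of L \<psi> into positive and negative part,
  which stays meaningful for L = \<infinity>.\<close>

lemma e2ennreal_shift:
  fixes L :: ereal and \<eta> \<psi> :: real
  assumes "- ereal \<eta> \<le> L" "0 \<le> \<psi>" "0 \<le> \<eta>"
  shows "e2ennreal (L * ereal \<psi>) + ennreal (\<eta> * \<psi>)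
    = e2ennreal ((L + ereal \<eta>) * ereal \<psi>) + e2ennreal (- (L * ereal \<psi>))"
proof (cases L)
  case (real l)
  have e: "e2ennreal (ereal r) = ennreal r" for r by (simp add: ennreal.abs_eq eq_onp_def)
  define u where "u = l * \<psi>"
  have "- \<eta> \<le> l" using assms(1) real by simp
  then have "- \<eta> * \<psi> \<le> l * \<psi>" using assms(2) by (rule mult_right_mono)
  then have u: "0 \<le> u + \<eta> * \<psi>" by (simp add: u_def)
  have "0 \<le> \<eta> * \<psi>" using assms by simp
  have "ennreal u + ennreal (\<eta> * \<psi>) = ennreal (u + \<eta> * \<psi>) + ennreal (- u)"
  proof (cases "0 \<le> u")
    case True
    then show ?thesis using \<open>0 \<le> \<eta> * \<psi>\<close> by (simp add: ennreal_neg)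
  next
    case False
    then have "ennreal (u + \<eta> * \<psi>) + ennreal (- u) = ennreal ((u + \<eta> * \<psi>) + - u)"
      using u by (intro ennreal_plus[symmetric]) auto
    then show ?thesis using False by (simp add: ennreal_neg)
  qed
  then show ?thesis unfolding real u_def by (simp add: e distrib_right)
next
  case PInf
  show ?thesis
  proof (cases "\<psi> = 0")
    case False
    then have "L * ereal \<psi> = \<infinity>" "(L + ereal \<eta>) * ereal \<psi> = \<infinity>" using PInf assms by auto
    then show ?thesis unfolding \<open>L * ereal \<psi> = \<infinity>\<close> \<open>(L + ereal \<eta>) * ereal \<psi> = \<infinity>\<close>
      by (simp add: e2ennreal_infty)
  qed (use PInf in \<open>simp add: e2ennreal_neg\<close>)
qed (use assms in simp)

text \<open>Testing with finite l < Y also covers Y = \<infinity>, and it suits a lower limit Y, of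
  which only eventual lower bounds are known.\<close>

lemma e2ennreal_times_le:
  fixes Y :: ereal
  assumes "0 \<le> Y" "0 \<le> c" and le: "\<And>l. 0 \<le> l \<Longrightarrow> ereal l < Y \<Longrightarrow> ennreal (l * c) \<le> X"
  shows "e2ennreal (Y * ereal c) \<le> X"
proof (cases "c = 0")
  case False
  then have c: "c > 0" using assms by simp
  show ?thesis
  proof (rule dense_le)
    fix y assume y: "y < e2ennreal (Y * ereal c)"
    then have "y < top" by (meson dual_order.strict_trans1 top_greatest)
    then obtain l where l: "0 \<le> l" "y = ennreal l" by (cases y) auto
    have "0 \<le> Y * ereal c" using assms by simp
    then have "enn2ereal y < Y * ereal c"
      using y by (simp add: less_ennreal.rep_eq enn2ereal_e2ennreal)
    then have "ereal l < Y * ereal c" using l by (simp add: enn2ereal_ennreal)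
    then have "ereal (l / c) < Y" using c by (cases Y) (auto simp: field_simps)
    then have "ennreal (l / c * c) \<le> X" using l c by (intro le) auto
    then show "y \<le> X" using l c by simp
  qed
qed (simp add: e2ennreal_neg flip: zero_ereal_def)

text \<open>Fatou's lemma for the nonnegative functions (h + \<eta>) s n. The conclusion is the
  negation of a Landesman-Lazer inequality, with the positive and negative parts on separate sides
  so that infinite values do no harm.\<close>

lemma Liminf_weighted_integral_le:
  fixes h :: "real \<Rightarrow> real \<Rightarrow> real" and x s :: "nat \<Rightarrow> real \<Rightarrow> real" and \<psi> :: "real \<Rightarrow> real"
  assumes h_cont: "continuous_on ({0..T} \<times> {0..}) (\<lambda>(t, x). h t x)"
    and h_low: "\<And>t x. t \<in> {0..T} \<Longrightarrow> 0 \<le> x \<Longrightarrow> - \<eta> \<le> h t x" and \<eta>: "0 \<le> \<eta>"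
    and x: "\<And>n. continuous_on {0..T} (x n)" "\<And>n t. t \<in> {0..T} \<Longrightarrow> 0 \<le> x n t"
    and s: "\<And>n. continuous_on {0..T} (s n)" "\<And>n t. t \<in> {0..T} \<Longrightarrow> 0 \<le> s n t"
      "\<And>n t. t \<in> {0..T} \<Longrightarrow> s n t \<le> S"
    and \<psi>: "continuous_on {0..T} \<psi>" "\<And>t. t \<in> {0..T} \<Longrightarrow> 0 \<le> \<psi> t"
    and s_lim: "\<And>t. t \<in> {0..T} \<Longrightarrow> (\<lambda>n. s n t) \<longlonglongrightarrow> \<psi> t"
    and x_lim: "\<And>t. t \<in> {0..T} \<Longrightarrow> 0 < \<psi> t \<Longrightarrow> filterlim (\<lambda>n. x n t) at_top sequentially"
    and int: "\<And>n. integral {0..T} (\<lambda>t. h t (x n t) * s n t) \<le> 0"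
  defines "L \<equiv> \<lambda>t. Liminf at_top (\<lambda>x. ereal (h t x))"
  shows "(\<integral>\<^sup>+ t. e2ennreal (L t * ereal (\<psi> t)) \<partial>lebesgue_on {0..T})
    \<le> (\<integral>\<^sup>+ t. e2ennreal (- (L t * ereal (\<psi> t))) \<partial>lebesgue_on {0..T})"
proof -
  let ?M = "lebesgue_on {0..T}"
  have hx: "continuous_on {0..T} (\<lambda>t. h t (x n t))" for n
  proof -
    have "continuous_on {0..T} (\<lambda>t. (\<lambda>(t, x). h t x) (t, x n t))"
      using x by (intro continuous_on_compose2[OF h_cont] continuous_intros) auto
    then show ?thesis by simp
  qed
  have L_meas[measurable]: "L \<in> borel_measurable ?M"
    unfolding L_def
  proof (rule measurable_Liminf_at_top)
    fix y :: real assume "0 \<le> y"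
    then have "continuous_on {0..T} (\<lambda>t. (\<lambda>(t, x). h t x) (t, y))"
      by (intro continuous_on_compose2[OF h_cont] continuous_intros) auto
    then show "continuous_on {0..T} (\<lambda>t. h t y)" by simp
  qed simp
  have \<psi>_meas[measurable]: "\<psi> \<in> borel_measurable ?M"
    using \<psi>(1) by (intro continuous_imp_measurable_on_sets_lebesgue) auto
  have L_low: "- ereal \<eta> \<le> L t" if "t \<in> {0..T}" for t
  proof -
    have "\<forall>\<^sub>F x in at_top. - ereal \<eta> \<le> ereal (h t x)"
      using eventually_ge_at_top[of 0] by eventually_elim (use h_low that in auto)
    then show ?thesis unfolding L_def by (rule Liminf_bounded)
  qed
  define f where "f n t = (h t (x n t) + \<eta>) * s n t" for n t
  have f_cont: "continuous_on {0..T} (f n)" for n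
    unfolding f_def by (intro continuous_intros hx s)
  have f_nonneg: "0 \<le> f n t" if "t \<in> {0..T}" for n t
    unfolding f_def
  proof (rule mult_nonneg_nonneg)
    show "0 \<le> h t (x n t) + \<eta>" using h_low[OF that x(2)[OF that], of n] by argo
  qed (rule s(2)[OF that])
  have s_int: "(\<lambda>n. integral {0..T} (s n)) \<longlonglongrightarrow> integral {0..T} \<psi>"
  proof (rule dominated_convergence(2))
    show "s n integrable_on {0..T}" for n by (intro integrable_continuous_real s)
    show "(\<lambda>_. S) integrable_on {0..T}" by (intro integrable_continuous_real continuous_intros)
    show "norm (s n t) \<le> S" if "t \<in> {0..T}" for n t using s(2,3)[OF that] by simp
  qed (rule s_lim)
  have f_int: "(\<integral>\<^sup>+ t. ennreal (f n t) \<partial>?M) \<le> ennreal (\<eta> * integral {0..T} (s n))" for n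
  proof -
    have "integral {0..T} (f n) = integral {0..T} (\<lambda>t. h t (x n t) * s n t)
        + integral {0..T} (\<lambda>t. \<eta> * s n t)"
      unfolding f_def distrib_right
      by (intro Henstock_Kurzweil_Integration.integral_add integrable_continuous_real
          continuous_intros hx s)
    also have "\<dots> \<le> \<eta> * integral {0..T} (s n)" using int[of n] by simp
    finally show ?thesis
      using nn_integral_eq_integral_Icc[OF f_cont f_nonneg, of n] by (simp add: ennreal_leI)
  qed
  have "(\<integral>\<^sup>+ t. liminf (\<lambda>n. ennreal (f n t)) \<partial>?M) \<le> liminf (\<lambda>n. \<integral>\<^sup>+ t. ennreal (f n t) \<partial>?M)"
  proof (rule nn_integral_liminf)
    fix n
    have "f n \<in> borel_measurable ?M"
      using f_cont by (intro continuous_imp_measurable_on_sets_lebesgue) auto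
    then show "(\<lambda>t. ennreal (f n t)) \<in> borel_measurable ?M" by measurable
  qed
  also have "\<dots> \<le> liminf (\<lambda>n. ennreal (\<eta> * integral {0..T} (s n)))"
    by (intro Liminf_mono always_eventually allI f_int)
  also have "\<dots> = ennreal (\<eta> * integral {0..T} \<psi>)"
    by (intro lim_imp_Liminf tendsto_ennrealI tendsto_intros s_int) simp
  finally have fatou: "(\<integral>\<^sup>+ t. liminf (\<lambda>n. ennreal (f n t)) \<partial>?M) \<le> ennreal (\<eta> * integral {0..T} \<psi>)" .
  have ptw: "e2ennreal ((L t + ereal \<eta>) * ereal (\<psi> t)) \<le> liminf (\<lambda>n. ennreal (f n t))"
    if t: "t \<in> {0..T}" for t
  proof (rule e2ennreal_times_le)
    show "0 \<le> L t + ereal \<eta>" using L_low[OF t] by (cases "L t") auto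
    show "0 \<le> \<psi> t" by (rule \<psi>(2)[OF t])
    fix l :: real assume l: "0 \<le> l" "ereal l < L t + ereal \<eta>"
    show "ennreal (l * \<psi> t) \<le> liminf (\<lambda>n. ennreal (f n t))"
    \<comment> \<open>Where \<psi> vanishes nothing is known about the growth of x n, but there the
      left-hand side is 0.\<close>
    proof (cases "\<psi> t = 0")
      case False
      then have "0 < \<psi> t" using \<psi>(2)[OF t] by simp
      have "ereal (l - \<eta>) < L t" using l(2) by (cases "L t") auto
      then have "\<forall>\<^sub>F y in at_top. ereal (l - \<eta>) < ereal (h t y)"
        unfolding L_def by (rule less_LiminfD)
      then have "\<forall>\<^sub>F n in sequentially. ereal (l - \<eta>) < ereal (h t (x n t))"
        by (rule eventually_compose_filterlim[OF _ x_lim[OF t \<open>0 < \<psi> t\<close>]])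
      then have ev: "\<forall>\<^sub>F n in sequentially. ennreal (l * s n t) \<le> ennreal (f n t)"
      proof eventually_elim
        case (elim n)
        then have "l \<le> h t (x n t) + \<eta>" by simp
        then show ?case unfolding f_def using s(2)[OF t] by (intro ennreal_leI mult_right_mono) auto
      qed
      have "ennreal (l * \<psi> t) = liminf (\<lambda>n. ennreal (l * s n t))"
        by (intro lim_imp_Liminf[symmetric] tendsto_ennrealI tendsto_intros s_lim t) simp
      also have "\<dots> \<le> liminf (\<lambda>n. ennreal (f n t))" using ev by (rule Liminf_mono)
      finally show ?thesis .
    qed simp
  qed
  have \<psi>_int: "(\<integral>\<^sup>+ t. ennreal (\<eta> * \<psi> t) \<partial>?M) = ennreal (\<eta> * integral {0..T} \<psi>)"
    using nn_integral_eq_integral_Icc[of 0 T "\<lambda>t. \<eta> * \<psi> t"] \<psi> \<eta>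
    by (simp add: continuous_on_mult_left)
  have "(\<integral>\<^sup>+ t. e2ennreal (L t * ereal (\<psi> t)) \<partial>?M) + ennreal (\<eta> * integral {0..T} \<psi>)
      = (\<integral>\<^sup>+ t. e2ennreal (L t * ereal (\<psi> t)) + ennreal (\<eta> * \<psi> t) \<partial>?M)"
    unfolding \<psi>_int[symmetric] by (intro nn_integral_add[symmetric]) measurable
  also have "\<dots> = (\<integral>\<^sup>+ t. e2ennreal ((L t + ereal \<eta>) * ereal (\<psi> t)) + e2ennreal (- (L t * ereal (\<psi> t))) \<partial>?M)"
    by (intro nn_integral_cong e2ennreal_shift L_low \<psi> \<eta>) auto
  also have "\<dots> = (\<integral>\<^sup>+ t. e2ennreal ((L t + ereal \<eta>) * ereal (\<psi> t)) \<partial>?M)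
      + (\<integral>\<^sup>+ t. e2ennreal (- (L t * ereal (\<psi> t))) \<partial>?M)"
    by (intro nn_integral_add) measurable
  also have "(\<integral>\<^sup>+ t. e2ennreal ((L t + ereal \<eta>) * ereal (\<psi> t)) \<partial>?M)
      \<le> (\<integral>\<^sup>+ t. liminf (\<lambda>n. ennreal (f n t)) \<partial>?M)"
    by (intro nn_integral_mono ptw) simp
  also note fatou
  finally have "ennreal (\<eta> * integral {0..T} \<psi>) + (\<integral>\<^sup>+ t. e2ennreal (L t * ereal (\<psi> t)) \<partial>?M)
      \<le> ennreal (\<eta> * integral {0..T} \<psi>) + (\<integral>\<^sup>+ t. e2ennreal (- (L t * ereal (\<psi> t))) \<partial>?M)"
    by (simp add: add.commute)
  then show ?thesis by (simp add: ennreal_add_left_cancel_le)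
qed

section \<open>Rotation of motions of large energy\<close>

context half_line_oscillator
begin

text \<open>The growth bound is read from t back to 0. The summand
  \<open>exp ((1 + 2 * G) * T)\<close> in the hypothesis absorbs the 1 of 1 + energy.\<close>

lemma large_energy:
  assumes "bounce_motion A B C" "exp ((1 + 2 * G) * T) + K \<le> A 0 + C 0" "t \<in> {0..T}"
  shows "(1 + K) / exp ((1 + 2 * G) * T) \<le> A t + C t"
proof -
  let ?M = "exp ((1 + 2 * G) * T)"
  have "0 \<in> {0..T}" using T_pos by simp
  then have "1 + (A 0 + C 0) \<le> ?M * (1 + (A t + C t))"
    using assms(1,3) unfolding bounce_motion_def by blast
  then have "1 + K \<le> ?M * (A t + C t)" using assms(2) unfolding distrib_left mult_1_right by argo
  then show ?thesis by (simp add: divide_le_eq mult.commute)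
qed

section \<open>A motion that turns too slowly (\<sigma> = 1) or too fast (\<sigma> = - 1)\<close>

context
  fixes A B C :: "real \<Rightarrow> real" and \<omega> \<sigma> \<eta> m :: real
  assumes bm: "bounce_motion A B C" and \<omega>: "0 < \<omega>" and \<sigma>: "\<sigma> = 1 \<or> \<sigma> = - 1" and \<eta>: "0 \<le> \<eta>"
    and low: "\<And>t x. t \<in> {0..T} \<Longrightarrow> 0 \<le> x \<Longrightarrow> - \<eta> \<le> \<sigma> * (g t x - \<omega>\<^sup>2 * x)"
    and m: "0 < m" "\<And>t. t \<in> {0..T} \<Longrightarrow> m \<le> ell_energy \<omega> A C t"
    and pos: "\<And>t. t \<in> {0..T} \<Longrightarrow> 0 < A t + C t"
    and slow: "\<sigma> * (integral {0..T} (ang_speed g \<omega> A C) - 2 * \<omega> * T) \<le> 0"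
begin

abbreviation "en \<equiv> ell_energy \<omega> A C"

abbreviation "pert t \<equiv> g t (sqrt (A t)) - \<omega>\<^sup>2 * sqrt (A t)"

lemma en_bounds:
  assumes "t \<in> {0..T}"
  shows "0 < en t" "sqrt (A t) \<le> sqrt (en t) / \<omega>" "sqrt (C t) \<le> sqrt (en t)"
    "sqrt (A t) / en t \<le> 1 / (\<omega> * sqrt m)"
proof -
  note mo = motion[OF bm pos assms]
  show E: "0 < en t" using m(2)[OF assms] m(1) by linarith
  have "(\<omega> * sqrt (A t))\<^sup>2 \<le> en t"
    using mo(1,2) by (simp add: ell_energy_def power_mult_distrib)
  then have "\<omega> * sqrt (A t) \<le> sqrt (en t)" by (rule real_le_rsqrt)
  then show x: "sqrt (A t) \<le> sqrt (en t) / \<omega>" using \<omega> by (simp add: field_simps)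
  show "sqrt (C t) \<le> sqrt (en t)" using mo(1) by (simp add: ell_energy_def)
  have "sqrt (A t) / en t \<le> (sqrt (en t) / \<omega>) / en t"
    using x E by (intro divide_right_mono) auto
  also have "\<dots> = 1 / (\<omega> * sqrt (en t))"
  proof -
    define r where "r = sqrt (en t)"
    have "0 < r" "en t = r * r" using E by (auto simp: r_def)
    then show ?thesis unfolding r_def[symmetric] by (simp add: field_simps)
  qed
  also have "\<dots> \<le> 1 / (\<omega> * sqrt m)"
    using \<omega> m(1) m(2)[OF assms] by (intro divide_left_mono mult_left_mono mult_pos_pos) auto
  finally show "sqrt (A t) / en t \<le> 1 / (\<omega> * sqrt m)" .
qed

lemma pert_continuous: "continuous_on {0..T} pert"
  by (intro continuous_intros motion_continuous[OF bm pos] force_continuous_motion[OF bm pos])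

lemma en_continuous: "continuous_on {0..T} en"
  by (rule ell_energy_continuous[OF bm pos \<omega>])

lemma weighted_continuous:
  "continuous_on {0..T} (\<lambda>t. pert t * (sqrt (A t) / en t))"
  "continuous_on {0..T} (\<lambda>t. \<bar>pert t\<bar> * (sqrt (A t) / en t))"
  "continuous_on {0..T} (\<lambda>t. \<sigma> * pert t * (sqrt (A t) / en t))"
  using en_bounds(1)
  by (intro continuous_intros pert_continuous en_continuous motion_continuous[OF bm pos]; force)+

lemma ang_speed_split:
  assumes "t \<in> {0..T}"
  shows "ang_speed g \<omega> A C t = 2 * \<omega> + 2 * \<omega> * (pert t * (sqrt (A t) / en t))"
proof -
  define x where "x = sqrt (A t)"
  have Ax: "A t = x * x" using motion(1)[OF bm pos assms] by (simp add: x_def)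
  have "C t + x * g t x = en t + (g t x - \<omega>\<^sup>2 * x) * x"
    unfolding ell_energy_def Ax by (simp add: algebra_simps power2_eq_square)
  then have "(C t + x * g t x) / en t = 1 + (g t x - \<omega>\<^sup>2 * x) * (x / en t)"
    using en_bounds(1)[OF assms] by (simp add: add_divide_distrib)
  then show ?thesis
    unfolding ang_speed_def x_def[symmetric] times_divide_eq_right[symmetric]
    by (simp only: distrib_left mult_1_right mult.assoc)
qed

text \<open>The excess of the angular speed over 2 \<omega> is 2 \<omega> times the deviation of g
  from \<omega>^2 x, weighted by x / E. So the hypothesis on the total angle becomes a sign of this
  integral, which is what Fatou's lemma will be applied to after rescaling.\<close>

lemma signed_pert_integral: "integral {0..T} (\<lambda>t. \<sigma> * pert t * (sqrt (A t) / en t)) \<le> 0"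
proof -
  let ?I = "integral {0..T} (\<lambda>t. pert t * (sqrt (A t) / en t))"
  have "integral {0..T} (ang_speed g \<omega> A C)
      = integral {0..T} (\<lambda>t. 2 * \<omega> + 2 * \<omega> * (pert t * (sqrt (A t) / en t)))"
    by (intro integral_cong ang_speed_split)
  also have "\<dots> = integral {0..T} (\<lambda>t. 2 * \<omega>) + integral {0..T} (\<lambda>t. 2 * \<omega> * (pert t * (sqrt (A t) / en t)))"
    by (intro Henstock_Kurzweil_Integration.integral_add integrable_continuous_real
        continuous_intros weighted_continuous)
  also have "\<dots> = 2 * \<omega> * T + 2 * \<omega> * ?I"
    using T_pos by (subst integral_mult_right) simp
  finally have "2 * \<omega> * (\<sigma> * ?I) \<le> 0" using slow by (simp add: mult.left_commute)
  then have "\<sigma> * ?I \<le> 0" using \<omega> by (simp add: mult_le_0_iff)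
  then show ?thesis unfolding mult.assoc integral_mult_right .
qed

text \<open>A function f \<ge> - \<eta> satisfies |f| \<le> f + 2 \<eta>, so the one-sided bound and
  the sign of the weighted integral give a small weighted L1 norm. Pointwise the deviation is
  controlled only by a multiple of 1 + x.\<close>

lemma pert_integral_bound:
  "integral {0..T} (\<lambda>t. \<bar>pert t\<bar> * (sqrt (A t) / en t)) \<le> 2 * \<eta> * T / (\<omega> * sqrt m)"
proof -
  have "integral {0..T} (\<lambda>t. \<bar>pert t\<bar> * (sqrt (A t) / en t))
      \<le> integral {0..T} (\<lambda>t. \<sigma> * pert t * (sqrt (A t) / en t) + 2 * \<eta> * (1 / (\<omega> * sqrt m)))"
  proof (rule integral_le)
    fix t assume t: "t \<in> {0..T}"
    have nn: "0 \<le> sqrt (A t) / en t"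
      using en_bounds(1)[OF t] motion(1)[OF bm pos t] by simp
    have "- \<eta> \<le> \<sigma> * pert t" using motion(1)[OF bm pos t] by (intro low t) simp
    moreover have "\<bar>pert t\<bar> = \<bar>\<sigma> * pert t\<bar>" using \<sigma> by auto
    ultimately have "\<bar>pert t\<bar> \<le> \<sigma> * pert t + 2 * \<eta>" using \<eta> by linarith
    then have "\<bar>pert t\<bar> * (sqrt (A t) / en t) \<le> (\<sigma> * pert t + 2 * \<eta>) * (sqrt (A t) / en t)"
      using nn by (rule mult_right_mono)
    also have "\<dots> = \<sigma> * pert t * (sqrt (A t) / en t) + 2 * \<eta> * (sqrt (A t) / en t)"
      by (rule distrib_right)
    also have "2 * \<eta> * (sqrt (A t) / en t) \<le> 2 * \<eta> * (1 / (\<omega> * sqrt m))"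
      using \<eta> by (intro mult_left_mono en_bounds t) auto
    finally show "\<bar>pert t\<bar> * (sqrt (A t) / en t)
        \<le> \<sigma> * pert t * (sqrt (A t) / en t) + 2 * \<eta> * (1 / (\<omega> * sqrt m))" by simp
  qed (intro integrable_continuous_real continuous_on_add weighted_continuous continuous_on_const)+
  also have "\<dots> = integral {0..T} (\<lambda>t. \<sigma> * pert t * (sqrt (A t) / en t))
      + integral {0..T} (\<lambda>t. 2 * \<eta> * (1 / (\<omega> * sqrt m)))"
    by (intro Henstock_Kurzweil_Integration.integral_add integrable_continuous_real
        weighted_continuous continuous_on_const)
  also have "integral {0..T} (\<lambda>t. 2 * \<eta> * (1 / (\<omega> * sqrt m))) = 2 * \<eta> * T / (\<omega> * sqrt m)"
    using T_pos by simp
  also have "integral {0..T} (\<lambda>t. \<sigma> * pert t * (sqrt (A t) / en t)) + 2 * \<eta> * T / (\<omega> * sqrt m)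
      \<le> 2 * \<eta> * T / (\<omega> * sqrt m)"
    using signed_pert_integral by (simp only: add_le_same_cancel2)
  finally show ?thesis .
qed

text \<open>The weighted L1 norm controls the partial integrals too, so the angle follows that of
  the oscillator at all times, with an error that vanishes as m grows.\<close>

lemma rotation_bound:
  assumes t: "t \<in> {0..T}"
  shows "\<bar>integral {0..t} (ang_speed g \<omega> A C) - 2 * \<omega> * t\<bar> \<le> 2 * \<omega> * (2 * \<eta> * T / (\<omega> * sqrt m))"
proof -
  have sub: "{0..t} \<subseteq> {0..T}" using t by auto
  note ws = continuous_on_subset[OF weighted_continuous(1) sub]
    continuous_on_subset[OF weighted_continuous(2) sub]
  have "integral {0..t} (ang_speed g \<omega> A C)
      = integral {0..t} (\<lambda>t. 2 * \<omega> + 2 * \<omega> * (pert t * (sqrt (A t) / en t)))"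
    using sub by (intro integral_cong ang_speed_split) auto
  also have "\<dots> = integral {0..t} (\<lambda>t. 2 * \<omega>) + integral {0..t} (\<lambda>t. 2 * \<omega> * (pert t * (sqrt (A t) / en t)))"
    by (intro Henstock_Kurzweil_Integration.integral_add integrable_continuous_real continuous_intros ws)
  finally have eq: "integral {0..t} (ang_speed g \<omega> A C) - 2 * \<omega> * t
      = 2 * \<omega> * integral {0..t} (\<lambda>t. pert t * (sqrt (A t) / en t))"
    using t by (subst (asm) integral_mult_right) simp
  have nn: "0 \<le> sqrt (A s) / en s" if "s \<in> {0..T}" for s
    using en_bounds(1)[OF that] motion(1)[OF bm pos that] by simp
  have "norm (integral {0..t} (\<lambda>t. pert t * (sqrt (A t) / en t)))
      \<le> integral {0..t} (\<lambda>t. \<bar>pert t\<bar> * (sqrt (A t) / en t))"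
  proof (rule integral_norm_bound_integral)
    fix s assume "s \<in> {0..t}"
    then have "s \<in> {0..T}" using sub by blast
    from nn[OF this] show "norm (pert s * (sqrt (A s) / en s)) \<le> \<bar>pert s\<bar> * (sqrt (A s) / en s)"
      unfolding real_norm_def abs_mult by (simp add: abs_of_nonneg del: abs_divide)
  qed (intro integrable_continuous_real ws)+
  also have "\<dots> \<le> integral {0..T} (\<lambda>t. \<bar>pert t\<bar> * (sqrt (A t) / en t))"
  proof (rule integral_subset_le[OF sub])
    show "\<forall>s\<in>{0..T}. 0 \<le> \<bar>pert s\<bar> * (sqrt (A s) / en s)"
      using nn by (blast intro: mult_nonneg_nonneg[OF abs_ge_zero])
  qed (intro integrable_continuous_real ws weighted_continuous)+
  also note pert_integral_bound
  finally have "2 * \<omega> * norm (integral {0..t} (\<lambda>t. pert t * (sqrt (A t) / en t)))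
      \<le> 2 * \<omega> * (2 * \<eta> * T / (\<omega> * sqrt m))"
    using \<omega> by (intro mult_left_mono) auto
  then show ?thesis
    unfolding eq abs_mult using \<omega> by (simp only: abs_of_pos real_norm_def abs_numeral)
qed

text \<open>The weight x / E of the L1 bound vanishes at impacts, whereas the integrand 2 |x'|
  |pert| / E need not. The deviation is therefore split at the level \<kappa> sqrt E. Below it the
  integral is at most 2 \<kappa> T. Above it the integrand is made quadratic in the deviation, and
  one factor is traded for P (1 + x), which supplies the missing x up to the error \<delta>.\<close>

lemma log_energy_bound:
  assumes t: "t \<in> {0..T}" and \<kappa>: "0 < \<kappa>"
  defines "P \<equiv> G + \<omega>\<^sup>2"
  shows "\<bar>ln (en t) - ln (en 0)\<bar> \<le> 2 * \<kappa> * T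
    + 2 / \<kappa> * P * (2 * \<eta> * T / (\<omega> * sqrt m) + P * (1 / m + 1 / (\<omega> * sqrt m)) * T)"
proof -
  define \<delta> where "\<delta> = P * (1 / m + 1 / (\<omega> * sqrt m))"
  have P: "0 \<le> P" using G_nonneg by (simp add: P_def)
  have "\<bar>ln (en t) - ln (en 0)\<bar> \<le> integral {0..T} (\<lambda>s. 2 * sqrt (C s) * \<bar>pert s\<bar> / en s)"
    by (rule log_energy_variation[OF bm pos \<omega> t])
  also have "\<dots> \<le> integral {0..T} (\<lambda>s. 2 * \<kappa> + 2 / \<kappa> * P * (\<bar>pert s\<bar> * (sqrt (A s) / en s) + \<delta>))"
  proof (rule integral_le)
    fix s assume s: "s \<in> {0..T}"
    define x E p where "x = sqrt (A s)" and "E = en s" and "p = \<bar>pert s\<bar>"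
    have x: "0 \<le> x" using motion(1)[OF bm pos s] by (simp add: x_def)
    have E: "0 < E" "m \<le> E" using en_bounds(1)[OF s] m(2)[OF s] by (auto simp: E_def)
    have p: "0 \<le> p" "p \<le> P * (1 + x)"
    proof -
      have "p \<le> \<bar>g s x\<bar> + \<omega>\<^sup>2 * x"
        using abs_triangle_ineq4[of "g s x" "\<omega>\<^sup>2 * x"] x by (simp add: p_def x_def abs_mult)
      also have "\<dots> \<le> G * (1 + x) + \<omega>\<^sup>2 * (1 + x)"
        using g_growth[OF s x] x by (intro add_mono mult_left_mono) auto
      finally show "p \<le> P * (1 + x)" by (simp add: P_def distrib_right)
    qed (simp add: p_def)
    have "p / E \<le> \<delta>"
    proof -
      have "p / E \<le> P * (1 + x) / E" using p E by (intro divide_right_mono) auto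
      also have "\<dots> = P * (1 / E + x / E)" by (simp add: distrib_left add_divide_distrib)
      also have "\<dots> \<le> \<delta>" unfolding \<delta>_def
        using en_bounds(4)[OF s] E m(1) P
        by (intro mult_left_mono add_mono) (auto simp: x_def E_def frac_le)
      finally show ?thesis .
    qed
    \<comment> \<open>Either p \<le> \<kappa> sqrt E, or the factor p / (\<kappa> sqrt E), which
      exceeds 1, may be inserted.\<close>
    have "p / sqrt E \<le> \<kappa> + (p * p / E) / \<kappa>"
    proof (cases "p / sqrt E \<le> \<kappa>")
      case True
      moreover have "0 \<le> (p * p / E) / \<kappa>" using p E \<kappa> by simp
      ultimately show ?thesis by linarith
    next
      case False
      have "p / sqrt E * \<kappa> \<le> p / sqrt E * (p / sqrt E)"
        using False p E by (intro mult_left_mono) auto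
      also have "\<dots> = p * p / E" using E by simp
      finally have "p / sqrt E \<le> (p * p / E) / \<kappa>" unfolding pos_le_divide_eq[OF \<kappa>] .
      then show ?thesis using \<kappa> by linarith
    qed
    also have "p * p / E \<le> P * (p * (x / E) + \<delta>)"
    proof -
      have "p * p / E \<le> p * (P * (1 + x)) / E"
        using p E by (intro divide_right_mono mult_left_mono) auto
      also have "\<dots> = P * (p * (x / E) + p / E)"
        by (simp add: distrib_left add_divide_distrib mult_ac)
      also have "\<dots> \<le> P * (p * (x / E) + \<delta>)"
        using \<open>p / E \<le> \<delta>\<close> P by (intro mult_left_mono add_left_mono) auto
      finally show ?thesis .
    qed
    finally have *: "p / sqrt E \<le> \<kappa> + P * (p * (x / E) + \<delta>) / \<kappa>"
      using \<kappa> by (simp add: divide_right_mono)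
    have "2 * sqrt (C s) * p / E \<le> 2 * sqrt E * p / E"
      using en_bounds(3)[OF s] p E
      by (intro divide_right_mono mult_right_mono mult_left_mono) (auto simp: E_def)
    also have "\<dots> = 2 * (p / sqrt E)" using E by (simp add: field_simps flip: real_sqrt_mult)
    also have "\<dots> \<le> 2 * (\<kappa> + P * (p * (x / E) + \<delta>) / \<kappa>)" using * by simp
    also have "\<dots> = 2 * \<kappa> + 2 / \<kappa> * P * (p * (x / E) + \<delta>)" using \<kappa> by (simp add: field_simps)
    finally show "2 * sqrt (C s) * \<bar>pert s\<bar> / en s
        \<le> 2 * \<kappa> + 2 / \<kappa> * P * (\<bar>pert s\<bar> * (sqrt (A s) / en s) + \<delta>)"
      unfolding x_def E_def p_def .
  next
    show "(\<lambda>s. 2 * sqrt (C s) * \<bar>pert s\<bar> / en s) integrable_on {0..T}"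
    proof (intro integrable_continuous_real continuous_on_divide continuous_on_mult
        continuous_on_rabs continuous_on_real_sqrt continuous_on_const pert_continuous en_continuous
        motion_continuous[OF bm pos])
      show "\<forall>s\<in>{0..T}. en s \<noteq> 0" using en_bounds(1) by fastforce
    qed
    show "(\<lambda>s. 2 * \<kappa> + 2 / \<kappa> * P * (\<bar>pert s\<bar> * (sqrt (A s) / en s) + \<delta>)) integrable_on {0..T}"
      by (intro integrable_continuous_real continuous_on_add continuous_on_mult continuous_on_const
          weighted_continuous)
  qed
  also have "\<dots> = 2 * \<kappa> * T + 2 / \<kappa> * P * (integral {0..T} (\<lambda>s. \<bar>pert s\<bar> * (sqrt (A s) / en s)) + \<delta> * T)"
  proof -
    have "((\<lambda>s. \<bar>pert s\<bar> * (sqrt (A s) / en s)) has_integral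
        integral {0..T} (\<lambda>s. \<bar>pert s\<bar> * (sqrt (A s) / en s))) {0..T}"
      by (intro integrable_integral integrable_continuous_real weighted_continuous)
    moreover have "((\<lambda>s. \<delta>) has_integral \<delta> * T) {0..T}" "((\<lambda>s. 2 * \<kappa>) has_integral 2 * \<kappa> * T) {0..T}"
      using has_integral_const_real[of \<delta> 0 T] has_integral_const_real[of "2 * \<kappa>" 0 T] T_pos
      by (simp_all add: mult.commute)
    ultimately show ?thesis
      by (intro integral_unique has_integral_add has_integral_mult_right)
  qed
  also have "\<dots> \<le> 2 * \<kappa> * T + 2 / \<kappa> * P * (2 * \<eta> * T / (\<omega> * sqrt m) + \<delta> * T)"
    using pert_integral_bound P \<kappa> by (intro add_left_mono mult_left_mono add_right_mono) auto
  finally show ?thesis unfolding \<delta>_def .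
qed

end

end

section \<open>Counting turns with the Landesman-Lazer conditions\<close>

context half_line_oscillator
begin

text \<open>Otherwise there are motions with initial energy tending to infinity that turn the wrong
  way. Their angle tends to 2 \<omega> t and E n t / E n 0 tends to 1, so along a subsequence
  \<omega> x / sqrt E tends to |cos (\<omega> t - \<beta>/2)|, a shift of \<open>psi\<close>.
  Fatou's lemma then contradicts the condition for this very shift.\<close>

lemma Landesman_Lazer_rotation:
  fixes \<sigma> \<eta> :: real and J :: nat
  assumes J: "0 < J" and \<sigma>: "\<sigma> = 1 \<or> \<sigma> = - 1" and \<eta>: "0 \<le> \<eta>"
  defines "\<omega> \<equiv> pi * real J / T"
  assumes low: "\<And>t x. t \<in> {0..T} \<Longrightarrow> 0 \<le> x \<Longrightarrow> - \<eta> \<le> \<sigma> * (g t x - \<omega>\<^sup>2 * x)"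
    and LL: "\<And>\<tau>. \<tau> \<in> {0..T} \<Longrightarrow>
      (\<integral>\<^sup>+ t. e2ennreal (- (Liminf at_top (\<lambda>x. ereal (\<sigma> * (g t x - \<omega>\<^sup>2 * x))) * ereal (psi T J (t + \<tau>))))
        \<partial>lebesgue_on {0..T})
      < (\<integral>\<^sup>+ t. e2ennreal (Liminf at_top (\<lambda>x. ereal (\<sigma> * (g t x - \<omega>\<^sup>2 * x))) * ereal (psi T J (t + \<tau>)))
        \<partial>lebesgue_on {0..T})"
  shows "\<exists>R. \<forall>A B C. bounce_motion A B C \<longrightarrow> R \<le> A 0 + C 0 \<longrightarrow>
    0 < \<sigma> * (integral {0..T} (ang_speed g \<omega> A C) - 2 * \<omega> * T)"
proof (rule ccontr)
  assume neg: "\<nexists>R. \<forall>A B C. bounce_motion A B C \<longrightarrow> R \<le> A 0 + C 0 \<longrightarrow>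
    0 < \<sigma> * (integral {0..T} (ang_speed g \<omega> A C) - 2 * \<omega> * T)"
  define M where "M = exp ((1 + 2 * G) * T)"
  have "\<exists>A B C. bounce_motion A B C \<and> M + real n \<le> A 0 + C 0 \<and>
    \<sigma> * (integral {0..T} (ang_speed g \<omega> A C) - 2 * \<omega> * T) \<le> 0" for n
    using neg by (meson not_less)
  then obtain A B C where bm: "\<And>n. bounce_motion (A n) (B n) (C n)"
    and large: "\<And>n. M + real n \<le> A n 0 + C n 0"
    and slow: "\<And>n. \<sigma> * (integral {0..T} (ang_speed g \<omega> (A n) (C n)) - 2 * \<omega> * T) \<le> 0"
    by metis
  have \<omega>: "0 < \<omega>" using J T_pos by (simp add: \<omega>_def)
  have M: "0 < M" by (simp add: M_def)
  have AC: "(1 + real n) / M \<le> A n t + C n t" if "t \<in> {0..T}" for n t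
    using large_energy[OF bm large[unfolded M_def] that] unfolding M_def .
  have pos: "0 < A n t + C n t" if "t \<in> {0..T}" for n t
    using AC[OF that, of n] M by (smt (verit) divide_pos_pos of_nat_0_le_iff)
  \<comment> \<open>Compares the two energies: \<nu> (A + C) \<le> \<omega>^2 A + C.\<close>
  define \<nu> where "\<nu> = min (\<omega>\<^sup>2) 1"
  have \<nu>: "0 < \<nu>" "\<nu> \<le> \<omega>\<^sup>2" "\<nu> \<le> 1" using \<omega> by (auto simp: \<nu>_def)
  define m where "m n = \<nu> * ((1 + real n) / M)" for n
  have m0: "0 < m n" for n using \<nu> M by (simp add: m_def add_pos_nonneg)
  define E where "E n = ell_energy \<omega> (A n) (C n)" for n
  have mo: "0 \<le> A n t" "0 \<le> C n t" if "t \<in> {0..T}" for n t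
    using motion(1,2)[OF bm[of n] pos[where n = n] that] by simp_all
  have mE: "m n \<le> E n t" if "t \<in> {0..T}" for n t
  proof -
    have "m n \<le> \<nu> * (A n t + C n t)" unfolding m_def using AC[OF that] \<nu> by (intro mult_left_mono) auto
    also have "\<dots> \<le> \<omega>\<^sup>2 * A n t + 1 * C n t"
      unfolding distrib_left using mo(1,2)[OF that] \<nu> by (intro add_mono mult_right_mono) auto
    finally show ?thesis by (simp add: E_def ell_energy_def)
  qed
  have E0: "0 < E n t" if "t \<in> {0..T}" for n t using mE[OF that, of n] m0[of n] by linarith
  have z: "0 \<in> {0..T}" using T_pos by simp
  have inv_m: "(\<lambda>n. 1 / m n) \<longlonglongrightarrow> 0"
  proof -
    have "(\<lambda>n. M / \<nu> * inverse (real (Suc n))) \<longlonglongrightarrow> M / \<nu> * 0"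
      by (intro tendsto_intros LIMSEQ_inverse_real_of_nat)
    then show ?thesis using \<nu> M unfolding m_def by (simp add: divide_inverse mult_ac)
  qed
  have inv_sqrt_m: "(\<lambda>n. 1 / (\<omega> * sqrt (m n))) \<longlonglongrightarrow> 0"
  proof -
    have "(\<lambda>n. 1 / \<omega> * sqrt (1 / m n)) \<longlonglongrightarrow> 1 / \<omega> * sqrt 0" by (intro tendsto_intros inv_m)
    then show ?thesis by (simp add: real_sqrt_divide)
  qed
  define P where "P = G + \<omega>\<^sup>2"
  define Y where "Y \<kappa> n = 2 / \<kappa> * P * (2 * \<eta> * T * (1 / (\<omega> * sqrt (m n)))
    + P * (1 / m n + 1 / (\<omega> * sqrt (m n))) * T)" for \<kappa> n
  have Y: "Y \<kappa> \<longlonglongrightarrow> 0" for \<kappa>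
  proof -
    have "Y \<kappa> \<longlonglongrightarrow> 2 / \<kappa> * P * (2 * \<eta> * T * 0 + P * (0 + 0) * T)"
      unfolding Y_def by (intro tendsto_intros inv_m inv_sqrt_m)
    then show ?thesis by simp
  qed
  have logE: "\<bar>ln (E n t) - ln (E n 0)\<bar> \<le> 2 * \<kappa> * T + Y \<kappa> n" if "t \<in> {0..T}" "0 < \<kappa>" for n t \<kappa>
    using log_energy_bound[OF bm[of "n"] \<omega> \<sigma> \<eta> low m0[of "n"] mE[unfolded E_def, where n = "n"] pos[where n = "n"] slow[of "n"] that] unfolding Y_def P_def E_def by simp
  have E_lim: "(\<lambda>n. ln (E n 0) - ln (E n t)) \<longlonglongrightarrow> 0" if t: "t \<in> {0..T}" for t
  proof (rule tendstoI)
    fix e :: real assume "e > 0"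
    \<comment> \<open>Fixed before n, because \<open>Y \<kappa> n\<close> tends to 0 only for fixed
      \<kappa>; the term 2 \<kappa> T takes one half of e.\<close>
    define \<kappa> where "\<kappa> = e / (4 * T)"
    have \<kappa>: "\<kappa> > 0" "2 * \<kappa> * T = e / 2" using \<open>e > 0\<close> T_pos by (auto simp: \<kappa>_def)
    have "\<forall>\<^sub>F n in sequentially. Y \<kappa> n < e / 2"
      using order_tendstoD(2)[OF Y, of "e / 2"] \<open>e > 0\<close> by simp
    then show "\<forall>\<^sub>F n in sequentially. dist (ln (E n 0) - ln (E n t)) 0 < e"
    proof eventually_elim
      case (elim n)
      then show ?case using logE[OF t \<kappa>(1), of n] \<kappa>(2) unfolding dist_real_def by argo
    qed
  qed
  \<comment> \<open>With \<kappa> = 1 this bounds the energy ratio uniformly in n and t, which will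
    dominate the weights s n.\<close>
  obtain K where K: "\<And>n. \<bar>Y 1 n\<bar> \<le> K"
    using convergent_imp_Bseq[OF convergentI[OF Y[of 1]]] unfolding Bseq_def by auto
  define p where "p n t = (\<omega>\<^sup>2 * A n t - C n t) / E n t" for n t
  define q where "q n t = 2 * \<omega> * B n t / E n t" for n t
  define \<theta> where "\<theta> n t = integral {0..t} (ang_speed g \<omega> (A n) (C n))" for n t
  have rot1: "p n t = p n 0 * cos (\<theta> n t) + q n 0 * sin (\<theta> n t)" if "t \<in> {0..T}" for n t
    unfolding p_def q_def \<theta>_def E_def
    by (rule direction_rotation(1)[OF bm[of n] pos[where n = n] \<omega> that])
  have rot2: "(p n 0)\<^sup>2 + (q n 0)\<^sup>2 = 1" for n
    unfolding p_def q_def E_def by (rule direction_rotation(3)[OF bm[of n] pos[where n = n] \<omega> z])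
  have \<theta>_lim: "(\<lambda>n. \<theta> n t) \<longlonglongrightarrow> 2 * \<omega> * t" if t: "t \<in> {0..T}" for t
  proof -
    have "(\<lambda>n. 2 * \<omega> * (2 * \<eta> * T * (1 / (\<omega> * sqrt (m n))))) \<longlonglongrightarrow> 2 * \<omega> * (2 * \<eta> * T * 0)"
      by (intro tendsto_intros inv_sqrt_m)
    then have lim: "(\<lambda>n. 2 * \<omega> * (2 * \<eta> * T / (\<omega> * sqrt (m n)))) \<longlonglongrightarrow> 0" by simp
    have "norm (\<theta> n t - 2 * \<omega> * t) \<le> 2 * \<omega> * (2 * \<eta> * T / (\<omega> * sqrt (m n)))" for n
      unfolding \<theta>_def real_norm_def
      by (rule rotation_bound[OF bm[of "n"] \<omega> \<sigma> \<eta> low m0[of "n"] mE[unfolded E_def, where n = "n"] pos[where n = "n"] slow[of "n"] t])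
    then have "(\<lambda>n. \<theta> n t - 2 * \<omega> * t) \<longlonglongrightarrow> 0"
      by (intro Lim_null_comparison[OF always_eventually lim] allI)
    then show ?thesis by (simp add: LIM_zero_iff)
  qed
  have abs1: "x \<in> {-1..1}" if "x\<^sup>2 + y\<^sup>2 = 1" for x y :: real
  proof -
    have "x\<^sup>2 \<le> 1" using that zero_le_power2[of y] by linarith
    then have "\<bar>x\<bar> \<le> 1" by (simp add: abs_square_le_1)
    then show ?thesis unfolding atLeastAtMost_iff by argo
  qed
  have sc: "seq_compact ({-1..1} \<times> {-1..1} :: (real \<times> real) set)"
    by (intro compact_imp_seq_compact compact_Times compact_Icc)
  have inn: "\<forall>n. (p n 0, q n 0) \<in> {-1..1} \<times> {-1..1}"
  proof
    fix n
    have "p n 0 \<in> {-1..1}" by (rule abs1[OF rot2])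
    moreover have "q n 0 \<in> {-1..1}"
      by (rule abs1[of _ "p n 0"]) (use rot2[of n] in argo)
    ultimately show "(p n 0, q n 0) \<in> {-1..1} \<times> {-1..1}" by (rule SigmaI)
  qed
  then obtain l r where r: "strict_mono (r :: nat \<Rightarrow> nat)" and "((\<lambda>n. (p n 0, q n 0)) \<circ> r) \<longlonglongrightarrow> l"
    using mp[OF spec[OF sc[unfolded seq_compact_def]] inn] by blast
  then have pr: "(\<lambda>n. p (r n) 0) \<longlonglongrightarrow> fst l" and qr: "(\<lambda>n. q (r n) 0) \<longlonglongrightarrow> snd l"
    by (auto dest: tendsto_fst tendsto_snd simp: o_def)
  have "(\<lambda>n. (p (r n) 0)\<^sup>2 + (q (r n) 0)\<^sup>2) \<longlonglongrightarrow> (fst l)\<^sup>2 + (snd l)\<^sup>2"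
    by (intro tendsto_intros pr qr)
  then have "(fst l)\<^sup>2 + (snd l)\<^sup>2 = 1" unfolding rot2 by (simp add: LIMSEQ_const_iff)
  \<comment> \<open>The pair (p, q) carries the doubled angle, so the position has the phase \<beta>
    / 2.\<close>
  then obtain \<beta> where \<beta>: "fst l = cos \<beta>" "snd l = sin \<beta>"
    using sincos_total_2pi by metis
  obtain \<tau> where \<tau>: "\<tau> \<in> {0..T}" "\<And>t. psi T J (t + \<tau>) = \<bar>cos (\<omega> * t - \<beta> / 2)\<bar>"
    using psi_shift_eq_abs_cos[OF T_pos J, of "\<beta> / 2", folded \<omega>_def] by metis
  have sub: "(\<lambda>n. f (r n)) \<longlonglongrightarrow> c" if "f \<longlonglongrightarrow> c" for f and c :: real
    using LIMSEQ_subseq_LIMSEQ[OF that r] by (simp add: o_def)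
  have p_lim: "(\<lambda>n. p (r n) t) \<longlonglongrightarrow> cos (\<beta> - 2 * \<omega> * t)" if t: "t \<in> {0..T}" for t
    unfolding rot1[OF t] cos_diff \<beta>[symmetric] by (intro tendsto_intros pr qr sub[OF \<theta>_lim[OF t]])
  \<comment> \<open>By the half-angle formula this is the normalised position \<omega> x / sqrt
    E.\<close>
  define u where "u n t = sqrt ((1 + p n t) / 2)" for n t
  have u_lim: "(\<lambda>n. u (r n) t) \<longlonglongrightarrow> \<bar>cos (\<omega> * t - \<beta> / 2)\<bar>" if t: "t \<in> {0..T}" for t
  proof -
    have "(\<lambda>n. u (r n) t) \<longlonglongrightarrow> sqrt ((1 + cos (\<beta> - 2 * \<omega> * t)) / 2)"
      unfolding u_def by (intro tendsto_intros p_lim t) simp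
    also have "cos (\<beta> - 2 * \<omega> * t) = cos (2 * (\<omega> * t - \<beta> / 2))"
      by (subst cos_minus[symmetric]) (simp add: algebra_simps)
    also have "sqrt ((1 + cos (2 * (\<omega> * t - \<beta> / 2))) / 2) = \<bar>cos (\<omega> * t - \<beta> / 2)\<bar>"
      unfolding cos_double_cos by simp
    finally show ?thesis .
  qed
  have u: "\<omega> * sqrt (A n t) = u n t * sqrt (E n t)" "0 \<le> u n t" "u n t \<le> 1" if t: "t \<in> {0..T}" for n t
  proof -
    have "1 + p n t = (E n t + (\<omega>\<^sup>2 * A n t - C n t)) / E n t"
      using E0[OF t, of n] by (simp add: p_def add_divide_distrib)
    also have "\<dots> = 2 * (\<omega>\<^sup>2 * A n t) / E n t" by (simp add: E_def ell_energy_def)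
    finally have eq: "(1 + p n t) / 2 = \<omega>\<^sup>2 * A n t / E n t" by simp
    then show "\<omega> * sqrt (A n t) = u n t * sqrt (E n t)"
      using \<omega> E0[OF t, of n] by (simp add: u_def real_sqrt_divide real_sqrt_mult)
    have "\<omega>\<^sup>2 * A n t \<le> E n t" using mo(2)[OF t, of n] by (simp add: E_def ell_energy_def)
    then show "u n t \<le> 1" using E0[OF t, of n] unfolding u_def eq by simp
    show "0 \<le> u n t" using mo(1)[OF t, of n] E0[OF t, of n] unfolding u_def eq by simp
  qed
  \<comment> \<open>The weight x / E times a factor that is constant in t: the sign of the integral
    is kept, and s n t now has the limit \<open>psi\<close>.\<close>
  define s where "s n t = \<omega> * sqrt (E n 0) * (sqrt (A n t) / E n t)" for n t
  have s_eq: "s n t = u n t * exp ((ln (E n 0) - ln (E n t)) / 2)" if t: "t \<in> {0..T}" for n t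
  proof -
    define e where "e = sqrt (E n t)"
    have e: "0 < e" "E n t = e * e" using E0[OF t, of n] by (auto simp: e_def)
    have ex: "exp (ln y / 2) = sqrt y" if "0 < y" for y :: real
      using that by (simp add: ln_sqrt[symmetric])
    have "exp ((ln (E n 0) - ln (E n t)) / 2) = sqrt (E n 0) / e"
      unfolding diff_divide_distrib exp_diff e_def using ex E0[OF t] E0[OF z] by simp
    moreover have "s n t = sqrt (E n 0) * (\<omega> * sqrt (A n t)) / (e * e)" unfolding s_def e(2) by simp
    ultimately show ?thesis unfolding u(1)[OF t] e_def[symmetric] using e(1) by simp
  qed
  have xc: "continuous_on {0..T} (\<lambda>t. sqrt (A n t))" for n
    by (intro continuous_on_real_sqrt motion_continuous(1)[OF bm[of n] pos[where n = n]])
  let ?h = "\<lambda>t x. \<sigma> * (g t x - \<omega>\<^sup>2 * x)"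
  have "(\<integral>\<^sup>+ t. e2ennreal (Liminf at_top (\<lambda>x. ereal (?h t x)) * ereal (psi T J (t + \<tau>))) \<partial>lebesgue_on {0..T})
    \<le> (\<integral>\<^sup>+ t. e2ennreal (- (Liminf at_top (\<lambda>x. ereal (?h t x)) * ereal (psi T J (t + \<tau>)))) \<partial>lebesgue_on {0..T})"
  proof (rule Liminf_weighted_integral_le[where x = "\<lambda>n t. sqrt (A (r n) t)" and s = "\<lambda>n. s (r n)"
        and \<eta> = \<eta> and S = "exp ((2 * T + K) / 2)"])
    show "continuous_on ({0..T} \<times> {0..}) (\<lambda>(t, x). ?h t x)"
      unfolding split_beta
      by (intro continuous_intros g_cont[unfolded split_beta])
    show "- \<eta> \<le> ?h t x" if "t \<in> {0..T}" "0 \<le> x" for t x by (rule low[OF that])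
    show "continuous_on {0..T} (\<lambda>t. sqrt (A (r n) t))" for n by (rule xc)
    show "0 \<le> sqrt (A (r n) t)" if "t \<in> {0..T}" for n t using mo(1)[OF that] by simp
    show "continuous_on {0..T} (s (r n))" for n
    proof -
      have "\<forall>t\<in>{0..T}. E (r n) t \<noteq> 0"
      proof
        fix t assume "t \<in> {0..T}"
        from E0[OF this, of "r n"] show "E (r n) t \<noteq> 0" by simp
      qed
      then show ?thesis unfolding s_def
        using en_continuous[OF bm[of "r n"] \<omega> \<sigma> \<eta> low m0[of "r n"] mE[unfolded E_def, where n = "r n"] pos[where n = "r n"] slow[of "r n"]] xc unfolding E_def
        by (intro continuous_on_mult continuous_on_divide continuous_on_const)
    qed
    show "0 \<le> s (r n) t" if "t \<in> {0..T}" for n t unfolding s_eq[OF that] using u(2)[OF that] by simp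
    show "s (r n) t \<le> exp ((2 * T + K) / 2)" if t: "t \<in> {0..T}" for n t
    proof -
      have "ln (E (r n) 0) - ln (E (r n) t) \<le> 2 * T + K"
        using logE[OF t, of 1 "r n"] K[of "r n"] by argo
      then have "u (r n) t * exp ((ln (E (r n) 0) - ln (E (r n) t)) / 2) \<le> 1 * exp ((2 * T + K) / 2)"
        using u(2,3)[OF t] by (intro mult_mono) auto
      then show ?thesis unfolding s_eq[OF t] by simp
    qed
    show "continuous_on {0..T} (\<lambda>t. psi T J (t + \<tau>))"
      unfolding \<tau>(2) by (intro continuous_intros)
    show "0 \<le> psi T J (t + \<tau>)" for t unfolding \<tau>(2) by simp
    show s_lim: "(\<lambda>n. s (r n) t) \<longlonglongrightarrow> psi T J (t + \<tau>)" if t: "t \<in> {0..T}" for t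
    proof -
      have "(\<lambda>n. u (r n) t * exp ((ln (E (r n) 0) - ln (E (r n) t)) / 2))
          \<longlonglongrightarrow> \<bar>cos (\<omega> * t - \<beta> / 2)\<bar> * exp (0 / 2)"
        by (intro tendsto_intros u_lim sub[OF E_lim] t) simp
      then show ?thesis unfolding s_eq[OF t] \<tau>(2) by simp
    qed
    \<comment> \<open>Where the limit profile is positive, x is comparable to sqrt E, and E is at
      least m.\<close>
    show "filterlim (\<lambda>n. sqrt (A (r n) t)) at_top sequentially"
      if t: "t \<in> {0..T}" "0 < psi T J (t + \<tau>)" for t
    proof -
      have "filterlim (\<lambda>n. sqrt (m n)) at_top sequentially"
      proof -
        have "filterlim (\<lambda>n. \<nu> / M * real (Suc n)) at_top sequentially"
          using \<nu> M by (intro filterlim_tendsto_pos_mult_at_top[OF tendsto_const]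
              filterlim_compose[OF filterlim_real_sequentially filterlim_Suc]) auto
        then have "filterlim m at_top sequentially" by (simp add: m_def[abs_def] mult_ac)
        then show ?thesis by (rule filterlim_compose[OF sqrt_at_top])
      qed
      then have "filterlim (\<lambda>n. sqrt (m (r n))) at_top sequentially"
        by (rule filterlim_compose[OF _ filterlim_subseq[OF r]])
      then have "filterlim (\<lambda>n. sqrt (E (r n) t)) at_top sequentially"
        by (rule filterlim_at_top_mono) (use mE[OF t(1)] in simp)
      then have "filterlim (\<lambda>n. u (r n) t / \<omega> * sqrt (E (r n) t)) at_top sequentially"
        using t(2) \<omega> unfolding \<tau>(2)
        by (intro filterlim_tendsto_pos_mult_at_top[where c = "\<bar>cos (\<omega> * t - \<beta> / 2)\<bar> / \<omega>"]
            tendsto_divide u_lim t tendsto_const) auto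
      moreover have "u (r n) t / \<omega> * sqrt (E (r n) t) = sqrt (A (r n) t)" for n
        using u(1)[OF t(1), of "r n"] \<omega> by (simp add: field_simps)
      ultimately show ?thesis by simp
    qed
    show "integral {0..T} (\<lambda>t. ?h t (sqrt (A (r n) t)) * s (r n) t) \<le> 0" for n
    proof -
      let ?k = "\<lambda>t. ?h t (sqrt (A (r n) t)) * (sqrt (A (r n) t) / E (r n) t)"
      have "integral {0..T} (\<lambda>t. ?h t (sqrt (A (r n) t)) * s (r n) t)
          = integral {0..T} (\<lambda>t. \<omega> * sqrt (E (r n) 0) * ?k t)"
        by (intro integral_cong) (simp add: s_def)
      also have "\<dots> = \<omega> * sqrt (E (r n) 0) * integral {0..T} ?k" by (rule integral_mult_right)
      also have "\<dots> \<le> 0"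
        using signed_pert_integral[OF bm[of "r n"] \<omega> \<sigma> \<eta> low m0[of "r n"] mE[unfolded E_def, where n = "r n"] pos[where n = "r n"] slow[of "r n"]] \<omega> E0[OF z, of "r n"] unfolding E_def
        by (intro mult_nonneg_nonpos) auto
      finally show ?thesis .
    qed
  qed (rule \<eta>)
  with LL[OF \<tau>(1)] show False by simp
qed

lemma periodic_bounce_motion:
  fixes \<eta> :: real
  assumes N: "0 < N" and \<eta>: "0 \<le> \<eta>"
    and bounds: "\<And>t x. t \<in> {0..T} \<Longrightarrow> 0 \<le> x \<Longrightarrow> mu T N * x - \<eta> \<le> g t x \<and> g t x \<le> mu T (N + 1) * x + \<eta>"
    and LL_upper: "\<And>\<tau>. \<tau> \<in> {0..T} \<Longrightarrow>
      (\<integral>\<^sup>+ t. e2ennreal (Limsup at_top (\<lambda>x. ereal (g t x - mu T (N + 1) * x)) * ereal (psi T (N + 1) (t + \<tau>)))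
        \<partial>lebesgue_on {0..T})
      < (\<integral>\<^sup>+ t. e2ennreal (- (Limsup at_top (\<lambda>x. ereal (g t x - mu T (N + 1) * x)) * ereal (psi T (N + 1) (t + \<tau>))))
        \<partial>lebesgue_on {0..T})"
    and LL_lower: "\<And>\<tau>. \<tau> \<in> {0..T} \<Longrightarrow>
      (\<integral>\<^sup>+ t. e2ennreal (- (Liminf at_top (\<lambda>x. ereal (g t x - mu T N * x)) * ereal (psi T N (t + \<tau>))))
        \<partial>lebesgue_on {0..T})
      < (\<integral>\<^sup>+ t. e2ennreal (Liminf at_top (\<lambda>x. ereal (g t x - mu T N * x)) * ereal (psi T N (t + \<tau>)))
        \<partial>lebesgue_on {0..T})"
  obtains A B C where "bounce_motion A B C" "A T = A 0" "B T = B 0" "C T = C 0"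
    "\<And>a b. 0 \<le> a \<Longrightarrow> a < b \<Longrightarrow> b \<le> T \<Longrightarrow> \<forall>t\<in>{a..b}. A t = 0 \<Longrightarrow> \<exists>t\<in>{a..b}. 0 \<le> g t 0"
proof -
  define \<omega>1 \<omega>2 where "\<omega>1 = pi * real N / T" and "\<omega>2 = pi * real (N + 1) / T"
  have mu: "mu T N = \<omega>1\<^sup>2" "mu T (N + 1) = \<omega>2\<^sup>2" by (simp_all add: mu_def \<omega>1_def \<omega>2_def)
  have \<omega>: "0 < \<omega>1" "\<omega>1 \<le> \<omega>2"
    using N T_pos by (auto simp: \<omega>1_def \<omega>2_def divide_right_mono)
  have "\<exists>R. \<forall>A B C. bounce_motion A B C \<longrightarrow> R \<le> A 0 + C 0 \<longrightarrow>
      0 < 1 * (integral {0..T} (ang_speed g \<omega>1 A C) - 2 * \<omega>1 * T)"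
    unfolding \<omega>1_def
  proof (rule Landesman_Lazer_rotation[OF N _ \<eta>], unfold mult_1_left \<omega>1_def[symmetric] mu[symmetric])
    show "- \<eta> \<le> g t x - mu T N * x" if "t \<in> {0..T}" "0 \<le> x" for t x
      using bounds[OF that] by argo
  qed (simp, rule LL_lower)
  then obtain R1 where R1: "\<And>A B C. bounce_motion A B C \<Longrightarrow> R1 \<le> A 0 + C 0 \<Longrightarrow>
      2 * \<omega>1 * T < integral {0..T} (ang_speed g \<omega>1 A C)" by auto
  \<comment> \<open>The condition on the upper limit is the one on the lower limit for the deviation
    with reversed sign.\<close>
  have neg: "Liminf at_top (\<lambda>x. ereal (- 1 * (g t x - mu T (N + 1) * x)))
      = - Limsup at_top (\<lambda>x. ereal (g t x - mu T (N + 1) * x))" for t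
    using ereal_Liminf_uminus[of at_top "\<lambda>x. ereal (g t x - mu T (N + 1) * x)"] by simp
  have "\<exists>R. \<forall>A B C. bounce_motion A B C \<longrightarrow> R \<le> A 0 + C 0 \<longrightarrow>
      0 < - 1 * (integral {0..T} (ang_speed g \<omega>2 A C) - 2 * \<omega>2 * T)"
    unfolding \<omega>2_def
  proof (rule Landesman_Lazer_rotation[of "N + 1", OF _ _ \<eta>],
      unfold \<omega>2_def[symmetric] mu[symmetric] neg ereal_mult_minus_left ereal_uminus_uminus)
    show "- \<eta> \<le> - 1 * (g t x - mu T (N + 1) * x)" if "t \<in> {0..T}" "0 \<le> x" for t x
      using bounds[OF that] by argo
  qed (simp, simp, rule LL_upper)
  then obtain R2 where R2: "\<And>A B C. bounce_motion A B C \<Longrightarrow> R2 \<le> A 0 + C 0 \<Longrightarrow>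
      integral {0..T} (ang_speed g \<omega>2 A C) < 2 * \<omega>2 * T" by auto
  define M where "M = exp ((1 + 2 * G) * T)"
  \<comment> \<open>M keeps the energy positive along the whole motion, so that angles are defined;
    \<open>R1\<close> and \<open>R2\<close> are the thresholds of the two rotation
    estimates.\<close>
  define R where "R = max M (max R1 R2)"
  have R: "0 < R" "M \<le> R" "R1 \<le> R" "R2 \<le> R" by (auto simp: R_def M_def less_max_iff_disj)
  obtain A B C \<mu> where bm: "bounce_motion A B C" and \<mu>: "1 \<le> \<mu>"
    and ret: "A T = \<mu> * A 0" "B T = \<mu> * B 0" "C T = \<mu> * C 0" and alt: "\<mu> = 1 \<or> A 0 + C 0 = R"
    and rest: "\<And>a b. 0 \<le> a \<Longrightarrow> a < b \<Longrightarrow> b \<le> T \<Longrightarrow> \<forall>t\<in>{a..b}. A t = 0 \<Longrightarrow> \<exists>t\<in>{a..b}. 0 \<le> g t 0"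
    using bounce_motion_exists[OF R(1)] by metis
  have "\<mu> = 1"
  proof (rule ccontr)
    assume "\<mu> \<noteq> 1"
    then have AC: "A 0 + C 0 = R" using alt by simp
    have pos: "0 < A t + C t" if "t \<in> {0..T}" for t
    proof -
      have "(1 + 0) / exp ((1 + 2 * G) * T) \<le> A t + C t"
        using AC R(2) by (intro large_energy[OF bm _ that]) (simp add: M_def)
      then show ?thesis by (smt (verit) divide_pos_pos exp_gt_zero)
    qed
    have \<mu>0: "0 < \<mu>" using \<mu> by simp
    let ?\<Theta>1 = "integral {0..T} (ang_speed g \<omega>1 A C)"
    obtain k :: int where k: "?\<Theta>1 = 2 * pi * of_int k"
      using return_angle[OF bm pos \<omega>(1) \<mu>0 ret] by blast
    \<comment> \<open>In doubled angles the oscillators with frequencies \<omega>1 and \<omega>2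
      make exactly N and N + 1 turns per period.\<close>
    have T: "2 * \<omega>1 * T = 2 * pi * of_int (int N)" "2 * \<omega>2 * T = 2 * pi * of_int (int N + 1)"
      using T_pos by (simp_all add: \<omega>1_def \<omega>2_def)
    have "?\<Theta>1 = integral {0..T} (ang_speed g \<omega>2 A C)"
      by (rule return_angle_independent[OF bm pos \<mu>0 ret \<omega>])
    also have "\<dots> < 2 * \<omega>2 * T" by (rule R2[OF bm]) (use AC R in simp)
    finally have "?\<Theta>1 < 2 * \<omega>2 * T" .
    moreover have "2 * \<omega>1 * T < ?\<Theta>1" by (rule R1[OF bm]) (use AC R in simp)
    ultimately have "real_of_int (int N) < of_int k" "real_of_int k < of_int (int N + 1)"
      unfolding k T by simp_all
    then have "int N < k" "k < int N + 1" by (simp_all only: of_int_less_iff)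
    then show False by simp
  qed
  with bm ret rest that show thesis by simp
qed

end

section \<open>Bouncing solutions from the squared coordinates\<close>

lemma has_real_derivative_union:
  assumes "(f has_real_derivative D) (at t within S)" "(f has_real_derivative D) (at t within U)"
  shows "(f has_real_derivative D) (at t within S \<union> U)"
  using assms unfolding has_field_derivative_iff by (simp add: at_within_union filterlim_sup)

text \<open>At a multiple of T the one-sided derivatives come from opposite ends of the period; they
  agree because f' T = f' 0.\<close>

lemma periodic_extension_derivative:
  fixes f f' :: "real \<Rightarrow> real"
  assumes "0 < T" and d: "\<And>t. t \<in> {0..T} \<Longrightarrow> (f has_real_derivative f' t) (at t within {0..T})"
    and f: "f T = f 0" and f': "f' T = f' 0"
  shows "((\<lambda>t. f (t rmod T)) has_real_derivative f' (t rmod T)) (at t)"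
proof -
  define c where "c k = T * real_of_int k" for k
  have cs: "c (k + 1) = c k + T" for k by (simp add: c_def algebra_simps)
  have rm: "u rmod T = u - c k" if "c k \<le> u" "u < c k + T" for u k
  proof -
    have "\<lfloor>u / T\<rfloor> = k"
      using that \<open>0 < T\<close> by (intro floor_unique) (auto simp: c_def field_simps)
    then show ?thesis using \<open>0 < T\<close> by (simp add: rmod_def c_def)
  qed
  \<comment> \<open>At the right end of a cell \<open>rmod\<close> falls back to 0. Equal end values
    of \<phi> allow the closed cell to be used all the same.\<close>
  have end_eq: "\<phi> (u rmod T) = \<phi> (u - c k)" if "u \<in> {c k..c k + T}" "\<phi> T = \<phi> 0"
    for \<phi> :: "real \<Rightarrow> real" and u k
  proof (cases "u < c k + T")
    case True
    then show ?thesis using rm[of k u] that by simp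
  next
    case False
    then have u: "u = c k + T" using that by simp
    then have "u rmod T = 0" using rm[of "k + 1" u] \<open>0 < T\<close> by (simp add: cs)
    then show ?thesis using u that by simp
  qed
  have piece: "((\<lambda>t. f (t rmod T)) has_real_derivative f' (u rmod T)) (at u within {c k..c k + T})"
    if u: "u \<in> {c k..c k + T}" for u k
  proof -
    have img: "(\<lambda>t. t - c k) ` {c k..c k + T} \<subseteq> {0..T}" by auto
    have "(f has_real_derivative f' (u - c k)) (at (u - c k) within (\<lambda>t. t - c k) ` {c k..c k + T})"
      using u by (intro DERIV_subset[OF d img]) auto
    then have "(f \<circ> (\<lambda>t. t - c k) has_real_derivative f' (u - c k) * 1) (at u within {c k..c k + T})"
      by (rule DERIV_image_chain) (auto intro!: derivative_eq_intros)
    then have "(f \<circ> (\<lambda>t. t - c k) has_real_derivative f' (u rmod T)) (at u within {c k..c k + T})"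
      using end_eq[OF u f'] by simp
    then show ?thesis
      by (rule has_field_derivative_transform_within[OF _ zero_less_one u])
        (simp add: end_eq[of _ k f, OF _ f])
  qed
  define k where "k = \<lfloor>t / T\<rfloor>"
  have "t rmod T = t - c k" using \<open>0 < T\<close> by (simp add: rmod_def c_def k_def)
  then have t: "c k \<le> t" "t < c k + T"
    using rmod_nonneg[of T t] rmod_less[of T t] \<open>0 < T\<close> by auto
  show ?thesis
  proof (cases "t = c k")
    case False
    then have "at t within {c k..c k + T} = at t" using t by (intro at_within_interior) simp
    then show ?thesis using piece[of t k] t by simp
  next
    case True
    have k1: "c (k - 1) + T = c k" using cs[of "k - 1"] by simp
    have "((\<lambda>t. f (t rmod T)) has_real_derivative f' (t rmod T))
        (at t within {c (k - 1)..c (k - 1) + T} \<union> {c k..c k + T})"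
      using True k1 \<open>0 < T\<close> by (intro has_real_derivative_union piece) auto
    moreover have "{c (k - 1)..c (k - 1) + T} \<union> {c k..c k + T} = {c k - T..c k + T}"
      using k1 \<open>0 < T\<close> by auto
    moreover have "at t within {c k - T..c k + T} = at t"
      using True \<open>0 < T\<close> by (intro at_within_interior) simp
    ultimately show ?thesis by simp
  qed
qed

section \<open>The position x = sqrt A near impacts and away from them\<close>

context
  fixes A B C :: "real \<Rightarrow> real" and g :: "real \<Rightarrow> real \<Rightarrow> real"
  assumes nonneg: "\<And>t. 0 \<le> A t" "\<And>t. 0 \<le> C t" and prod: "\<And>t. A t * C t = (B t)\<^sup>2"
    and dA: "\<And>t. (A has_real_derivative 2 * B t) (at t)"
    and dB: "\<And>t. (B has_real_derivative C t - sqrt (A t) * g t (sqrt (A t))) (at t)"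
begin

lemma sqrt_motion_derivative:
  assumes "0 < A t"
  shows "((\<lambda>t. sqrt (A t)) has_real_derivative B t / sqrt (A t)) (at t)"
proof -
  have "((\<lambda>t. sqrt (A t)) has_real_derivative inverse (sqrt (A t)) / 2 * (2 * B t)) (at t)"
    by (rule DERIV_chain2[where f = sqrt and g = A and x = t, OF DERIV_real_sqrt[OF assms] dA])
  moreover have "inverse (sqrt (A t)) / 2 * (2 * B t) = B t / sqrt (A t)" using assms by (simp add: field_simps)
  ultimately show ?thesis by (simp only:)
qed

lemma sqrt_motion_away:
  assumes "0 < sqrt (A r)"
  shows "\<exists>x' x''. (\<forall>\<^sub>F t in nhds r. ((\<lambda>t. sqrt (A t)) has_real_derivative x' t) (at t)) \<and>
    (x' has_real_derivative x'') (at r) \<and> x'' + g r (sqrt (A r)) = 0"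
proof -
  define x where "x = sqrt (A r)"
  have x: "0 < x" and Ax: "A r = x * x" using assms by (auto simp: x_def)
  define y where "y = B r / x"
  have By: "B r = x * y" using x by (simp add: y_def)
  have Cy: "C r = y * y" using prod[of r] x unfolding Ax By by (simp add: power2_eq_square mult_ac)
  have "(A \<longlongrightarrow> A r) (nhds r)"
    using DERIV_isCont[OF dA, of r] by (simp add: isCont_def tendsto_at_iff_tendsto_nhds)
  then have "\<forall>\<^sub>F t in nhds r. 0 < A t" using assms by (intro order_tendstoD(1)) auto
  then have 1: "\<forall>\<^sub>F t in nhds r. ((\<lambda>t. sqrt (A t)) has_real_derivative B t / sqrt (A t)) (at t)"
    by (rule eventually_mono) (rule sqrt_motion_derivative)
  have "((\<lambda>t. sqrt (A t)) has_real_derivative B r / sqrt (A r)) (at r)"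
    using assms by (intro sqrt_motion_derivative) simp
  from DERIV_divide[OF dB this]
  have "((\<lambda>t. B t / sqrt (A t)) has_real_derivative
      ((C r - x * g r x) * x - B r * (B r / x)) / (x * x)) (at r)"
    using x unfolding x_def by simp
  moreover have "((C r - x * g r x) * x - B r * (B r / x)) / (x * x) = - g r x"
    using x unfolding By Cy by (simp add: field_simps)
  ultimately have 2: "((\<lambda>t. B t / sqrt (A t)) has_real_derivative - g r x) (at r)" by simp
  have 3: "- g r x + g r (sqrt (A r)) = 0" by (simp add: x_def)
  show ?thesis
    by (rule exI[of _ "\<lambda>t. B t / sqrt (A t)"], rule exI[of _ "- g r x"]) (intro conjI 1 2 3)
qed

text \<open>By l'Hopital's rule A / (t - r)^2 has the same limit as B / (t - r), namely B'(r) = C r.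
  So x reaches and leaves the wall with the same speed sqrt (C r): this is the elastic law.\<close>

lemma sqrt_motion_at_zero:
  assumes "A r = 0"
  shows "((\<lambda>t. sqrt (A t) / \<bar>t - r\<bar>) \<longlongrightarrow> sqrt (C r)) (at r)"
proof -
  have Br: "B r = 0" using prod[of r] assms by simp
  have "((\<lambda>t. A t / (t - r)\<^sup>2) \<longlongrightarrow> C r) (at r)"
  proof (rule lhopital)
    show "(A \<longlongrightarrow> 0) (at r)" using DERIV_isCont[OF dA, of r] assms by (simp add: isCont_def)
    show "((\<lambda>t. (t - r)\<^sup>2) \<longlongrightarrow> 0) (at r)" by (intro tendsto_eq_intros) auto
    show "\<forall>\<^sub>F t in at r. (t - r)\<^sup>2 \<noteq> 0" by (simp add: eventually_at_filter)
    show "\<forall>\<^sub>F t in at r. 2 * (t - r) \<noteq> 0" by (simp add: eventually_at_filter)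
    show "\<forall>\<^sub>F t in at r. (A has_real_derivative 2 * B t) (at t)" by (simp add: dA)
    show "\<forall>\<^sub>F t in at r. ((\<lambda>t. (t - r)\<^sup>2) has_real_derivative 2 * (t - r)) (at t)"
      by (intro always_eventually allI) (auto intro!: derivative_eq_intros)
    have "((\<lambda>t. (B t - B r) / (t - r)) \<longlongrightarrow> C r) (at r)"
      using dB[of r] assms by (simp add: has_field_derivative_iff)
    moreover have "2 * B t / (2 * (t - r)) = (B t - B r) / (t - r)" for t
      unfolding Br by (subst mult_divide_mult_cancel_left) simp_all
    ultimately show "((\<lambda>t. 2 * B t / (2 * (t - r))) \<longlongrightarrow> C r) (at r)" by (simp only:)
  qed
  then have "((\<lambda>t. sqrt (A t / (t - r)\<^sup>2)) \<longlongrightarrow> sqrt (C r)) (at r)" by (rule tendsto_real_sqrt)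
  then show ?thesis by (simp add: real_sqrt_divide)
qed

lemma sqrt_motion_one_sided:
  assumes "A r = 0"
  shows "((\<lambda>t. sqrt (A t)) has_real_derivative - sqrt (C r)) (at_left r)"
    and "((\<lambda>t. sqrt (A t)) has_real_derivative sqrt (C r)) (at_right r)"
proof -
  have l: "((\<lambda>t. sqrt (A t) / \<bar>t - r\<bar>) \<longlongrightarrow> sqrt (C r)) (at_left r)"
    and r: "((\<lambda>t. sqrt (A t) / \<bar>t - r\<bar>) \<longlongrightarrow> sqrt (C r)) (at_right r)"
    using sqrt_motion_at_zero[OF assms] by (simp_all add: filterlim_at_split)
  have "((\<lambda>t. - (sqrt (A t) / \<bar>t - r\<bar>)) \<longlongrightarrow> - sqrt (C r)) (at_left r)"
    by (rule tendsto_minus[OF l])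
  moreover have "\<forall>\<^sub>F t in at_left r. - (sqrt (A t) / \<bar>t - r\<bar>) = (sqrt (A t) - sqrt (A r)) / (t - r)"
    using assms unfolding eventually_at_filter
    by (intro always_eventually allI impI) (simp, metis minus_diff_eq minus_divide_right)
  ultimately have "((\<lambda>t. (sqrt (A t) - sqrt (A r)) / (t - r)) \<longlongrightarrow> - sqrt (C r)) (at_left r)"
    by (rule Lim_transform_eventually)
  then show "((\<lambda>t. sqrt (A t)) has_real_derivative - sqrt (C r)) (at_left r)"
    by (simp add: has_field_derivative_iff)
  have "\<forall>\<^sub>F t in at_right r. sqrt (A t) / \<bar>t - r\<bar> = (sqrt (A t) - sqrt (A r)) / (t - r)"
    using assms unfolding eventually_at_filter by (intro always_eventually allI impI) simp
  with r have "((\<lambda>t. (sqrt (A t) - sqrt (A r)) / (t - r)) \<longlongrightarrow> sqrt (C r)) (at_right r)"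
    by (rule Lim_transform_eventually)
  then show "((\<lambda>t. sqrt (A t)) has_real_derivative sqrt (C r)) (at_right r)"
    by (simp add: has_field_derivative_iff)
qed

lemma sqrt_motion_isolated:
  assumes "A r = 0" "C r \<noteq> 0"
  shows "\<forall>\<^sub>F t in at r. 0 < sqrt (A t)"
proof -
  have "0 < sqrt (C r)" using assms(2) nonneg(2)[of r] by simp
  then have "\<forall>\<^sub>F t in at r. 0 < sqrt (A t) / \<bar>t - r\<bar>"
    using order_tendstoD(1)[OF sqrt_motion_at_zero[OF assms(1)]] by blast
  then show ?thesis by eventually_elim (auto simp: zero_less_divide_iff)
qed

lemma sqrt_motion_bouncing:
  assumes g0: "continuous_on UNIV (\<lambda>t. g t 0)"
    and rest: "\<And>a b. a < b \<Longrightarrow> \<forall>t\<in>{a..b}. A t = 0 \<Longrightarrow> \<exists>t\<in>{a..b}. 0 \<le> g t 0"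
  shows "bouncing_solution 0 g (- \<infinity>) \<infinity> (\<lambda>t. sqrt (A t))"
proof -
  have full: "einterval (- \<infinity>) \<infinity> = UNIV" by (simp add: einterval_def)
  have cont: "continuous_on UNIV (\<lambda>t. sqrt (A t))"
    by (intro continuous_on_real_sqrt continuous_at_imp_continuous_on ballI DERIV_isCont[OF dA])
  have impact: "\<forall>\<^sub>F t in at r. 0 < sqrt (A t)"
    if r: "sqrt (A r) = 0" and d: "d \<noteq> 0"
      "((\<lambda>t. sqrt (A t)) has_real_derivative d) (at_left r) \<or>
       ((\<lambda>t. sqrt (A t)) has_real_derivative d) (at_right r)" for r d
  proof -
    have A0: "A r = 0" using r by simp
    have "d = - sqrt (C r) \<or> d = sqrt (C r)"
      using d(2)
    proof
      assume "((\<lambda>t. sqrt (A t)) has_real_derivative d) (at_left r)"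
      with sqrt_motion_one_sided(1)[OF A0] have "d = - sqrt (C r)"
        unfolding has_field_derivative_iff by (intro tendsto_unique[OF trivial_limit_at_left_real])
      then show ?thesis ..
    next
      assume "((\<lambda>t. sqrt (A t)) has_real_derivative d) (at_right r)"
      with sqrt_motion_one_sided(2)[OF A0] have "d = sqrt (C r)"
        unfolding has_field_derivative_iff by (intro tendsto_unique[OF trivial_limit_at_right_real])
      then show ?thesis ..
    qed
    then have "C r \<noteq> 0" using d(1) by auto
    then show ?thesis by (rule sqrt_motion_isolated[OF A0])
  qed
  \<comment> \<open>\<open>rest\<close> yields only one good point in each interval. It is applied
    to an interval at t so short that, by continuity, a negative g t 0 would make g(u,0) negative on
    all of it.\<close>
  have flat: "0 \<le> g t 0" if I: "is_interval I" "\<exists>s\<in>I. \<exists>t\<in>I. s < t" "\<forall>t\<in>I. sqrt (A t) = 0" "t \<in> I" for I t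
  proof (rule ccontr)
    assume "\<not> 0 \<le> g t 0"
    then have neg: "g t 0 < 0" by simp
    have "isCont (\<lambda>s. g s 0) t" using g0 by (simp add: continuous_on_eq_continuous_at)
    then have "((\<lambda>s. g s 0) \<longlongrightarrow> g t 0) (nhds t)"
      using tendsto_at_iff_tendsto_nhds[of "\<lambda>s. g s 0" t] by (simp add: isCont_def)
    then have "\<forall>\<^sub>F s in nhds t. g s 0 < 0" using neg by (rule order_tendstoD(2))
    then obtain \<delta> where \<delta>: "0 < \<delta>" "\<And>s. dist s t < \<delta> \<Longrightarrow> g s 0 < 0"
      unfolding eventually_nhds_metric by blast
    obtain s where s: "s \<in> I" "s \<noteq> t" using I(2) by (metis less_irrefl)
    define h where "h = min (\<delta> / 2) \<bar>s - t\<bar>"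
    have h: "0 < h" "h < \<delta>" "h \<le> \<bar>s - t\<bar>" using \<delta>(1) s(2) by (auto simp: h_def)
    \<comment> \<open>The interval extends from t towards s, since t may be an end point of
      I.\<close>
    define a b where "a = (if s < t then t - h else t)" and "b = (if s < t then t else t + h)"
    have ab: "a < b" using h by (auto simp: a_def b_def)
    have sub: "{a..b} \<subseteq> I"
    proof
      fix u assume "u \<in> {a..b}"
      then have "(s \<le> u \<and> u \<le> t) \<or> (t \<le> u \<and> u \<le> s)"
        using h s(2) by (auto simp: a_def b_def split: if_splits)
      then show "u \<in> I" using I(1,4) s(1) unfolding is_interval_1 by blast
    qed
    have "g u 0 < 0" if "u \<in> {a..b}" for u
      using that h by (intro \<delta>(2)) (auto simp: a_def b_def dist_real_def split: if_splits)
    moreover have "\<exists>u\<in>{a..b}. 0 \<le> g u 0" using sub I(3) by (intro rest[OF ab]) auto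
    ultimately show False by fastforce
  qed
  show ?thesis
    unfolding bouncing_solution_def full
  proof (intro conjI)
    show "\<forall>r\<in>UNIV. 0 < sqrt (A r) \<longrightarrow> (\<exists>x' x''.
        (\<forall>\<^sub>F t in nhds r. ((\<lambda>t. sqrt (A t)) has_real_derivative x' t) (at t)) \<and>
        (x' has_real_derivative x'') (at r) \<and> x'' + g r (sqrt (A r)) = 0)"
      by (intro ballI impI sqrt_motion_away)
    show "\<forall>r\<in>UNIV. sqrt (A r) = 0 \<and> (\<forall>\<^sub>F t in at r. 0 < sqrt (A t)) \<longrightarrow>
        (\<exists>l d. ((\<lambda>t. sqrt (A t)) has_real_derivative l) (at_left r) \<and>
          ((\<lambda>t. sqrt (A t)) has_real_derivative d) (at_right r) \<and> l = - d)"
    proof (intro ballI impI)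
      fix r assume "sqrt (A r) = 0 \<and> (\<forall>\<^sub>F t in at r. 0 < sqrt (A t))"
      then have "A r = 0" by simp
      then show "\<exists>l d. ((\<lambda>t. sqrt (A t)) has_real_derivative l) (at_left r) \<and>
          ((\<lambda>t. sqrt (A t)) has_real_derivative d) (at_right r) \<and> l = - d"
        by (intro exI[of _ "- sqrt (C r)"] exI[of _ "sqrt (C r)"] conjI sqrt_motion_one_sided refl)
    qed
    show "\<forall>r\<in>UNIV. sqrt (A r) = 0 \<and>
        (\<exists>d. d \<noteq> 0 \<and> (((\<lambda>t. sqrt (A t)) has_real_derivative d) (at_left r) \<or>
                      ((\<lambda>t. sqrt (A t)) has_real_derivative d) (at_right r))) \<longrightarrow>
        (\<forall>\<^sub>F t in at r. 0 < sqrt (A t))"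
      using impact by blast
    show "\<forall>I. is_interval I \<and> I \<subseteq> UNIV \<and> (\<exists>s\<in>I. \<exists>t\<in>I. s < t) \<and> (\<forall>t\<in>I. sqrt (A t) = 0) \<longrightarrow>
        (\<forall>t\<in>I. 0 \<le> g t 0)"
      using flat by blast
  qed (use cont nonneg in auto)
qed

end

text \<open>Finiteness of b excludes \<infinity> - \<infinity>, which has the value \<infinity> and
  would count as positive.\<close>

lemma ereal_diff_pos:
  assumes "0 < enn2ereal a - enn2ereal b" "b < top"
  shows "b < a"
  using assms
proof (cases a)
  case (real r)
  then show ?thesis using assms
    by (cases b) (auto simp: enn2ereal_ennreal ennreal_less_iff)
qed simp

text \<open>A difference with a = \<infinity> has the value \<infinity>, even for b = \<infinity>,
  so a negative value forces a to be finite.\<close>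

lemma ereal_diff_neg:
  assumes "enn2ereal a - enn2ereal b < 0"
  shows "a < b"
proof (cases a)
  case (real r)
  then show ?thesis using assms
    by (cases b) (auto simp: enn2ereal_ennreal ennreal_less_iff)
qed (use assms in simp)

theorem corollary3p2:
  fixes T :: real and g :: "real \<Rightarrow> real \<Rightarrow> real" and N :: nat
  assumes "T > 0"
    and "continuous_on (UNIV \<times> {0..}) (\<lambda>(t, x). g t x)"
    and "\<forall>t. \<forall>x\<ge>0. g (t + T) x = g t x"
    and "N > 0"
    and "\<exists>\<eta>. \<forall>t\<in>{0..T}. \<forall>x>0. mu T N * x - \<eta> \<le> g t x \<and> g t x \<le> mu T (N + 1) * x + \<eta>"
    and "\<forall>\<tau>\<in>{0..T}. ereal_integral (lebesgue_on {0..T})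
           (\<lambda>t. Limsup at_top (\<lambda>x. ereal (g t x - mu T (N + 1) * x)) * ereal (psi T (N + 1) (t + \<tau>))) < 0"
    and "\<forall>\<tau>\<in>{0..T}. ereal_integral (lebesgue_on {0..T})
           (\<lambda>t. Liminf at_top (\<lambda>x. ereal (g t x - mu T N * x)) * ereal (psi T N (t + \<tau>))) > 0"
  shows "\<exists>x. bouncing_solution 0 g (- \<infinity>) \<infinity> x \<and> (\<forall>t. x (t + T) = x t)"
proof -
  note T = \<open>T > 0\<close>
  obtain \<eta>0 where \<eta>0: "\<And>t x. t \<in> {0..T} \<Longrightarrow> 0 < x \<Longrightarrow>
      mu T N * x - \<eta>0 \<le> g t x \<and> g t x \<le> mu T (N + 1) * x + \<eta>0"
    using assms(5) by blast
  define \<eta> where "\<eta> = \<bar>\<eta>0\<bar>"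
  have \<eta>: "0 \<le> \<eta>" by (simp add: \<eta>_def)
  have cont: "continuous_on S (\<lambda>p. g (\<tau> p) (a p))"
    if "continuous_on S \<tau>" "continuous_on S a" "\<And>p. p \<in> S \<Longrightarrow> 0 \<le> a p" for S :: "real set" and \<tau> a
  proof -
    have "continuous_on S (\<lambda>p. (\<lambda>(t, x). g t x) (\<tau> p, a p))"
      using that by (intro continuous_on_compose2[OF assms(2)] continuous_intros) auto
    then show ?thesis by simp
  qed
  \<comment> \<open>The hypothesis is about x > 0; continuity of g extends it to x = 0, which the
    motions reach.\<close>
  have bounds: "mu T N * x - \<eta> \<le> g t x \<and> g t x \<le> mu T (N + 1) * x + \<eta>"
    if t: "t \<in> {0..T}" and x: "0 \<le> x" for t x
  proof -
    define y where "y n = x + inverse (real (Suc n))" for n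
    have y: "0 < y n" for n using x unfolding y_def by (intro add_nonneg_pos) auto
    have "y \<longlonglongrightarrow> x + 0" unfolding y_def by (intro tendsto_intros LIMSEQ_inverse_real_of_nat)
    then have yl: "y \<longlonglongrightarrow> x" by simp
    have gc: "continuous_on {0..} (\<lambda>x. g t x)"
      by (rule cont[OF continuous_on_const continuous_on_id]) simp
    have gl: "(\<lambda>n. g t (y n)) \<longlonglongrightarrow> g t x"
    proof (rule continuous_on_tendsto_compose[OF gc yl])
      show "\<forall>\<^sub>F n in sequentially. y n \<in> {0..}"
        by (intro always_eventually allI) (simp add: less_imp_le[OF y])
    qed (use x in simp)
    have y_bounds: "mu T N * y n - \<eta> \<le> g t (y n)" "g t (y n) \<le> mu T (N + 1) * y n + \<eta>" for n
      using \<eta>0[OF t y[of n]] unfolding \<eta>_def by argo+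
    have l: "(\<lambda>n. mu T N * y n - \<eta>) \<longlonglongrightarrow> mu T N * x - \<eta>"
      and u: "(\<lambda>n. mu T (N + 1) * y n + \<eta>) \<longlonglongrightarrow> mu T (N + 1) * x + \<eta>"
      by (intro tendsto_intros yl)+
    show ?thesis
    proof
      show "mu T N * x - \<eta> \<le> g t x" by (rule LIMSEQ_le[OF l gl]) (simp add: y_bounds(1))
      show "g t x \<le> mu T (N + 1) * x + \<eta>" by (rule LIMSEQ_le[OF gl u]) (simp only: y_bounds(2) simp_thms)
    qed
  qed
  have mu0: "0 \<le> mu T j" for j by (simp add: mu_def)
  define G where "G = mu T (N + 1) + \<eta>"
  interpret half_line_oscillator T G g
  proof
    show "continuous_on ({0..T} \<times> {0..}) (\<lambda>(t, x). g t x)"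
      by (rule continuous_on_subset[OF assms(2)]) auto
    show "\<bar>g t x\<bar> \<le> G * (1 + x)" if "t \<in> {0..T}" "0 \<le> x" for t x
    proof -
      have "0 \<le> mu T N * x" "0 \<le> mu T (N + 1) * x" "0 \<le> \<eta> * x" "0 \<le> mu T (N + 1)"
        using mu0 that \<eta> by simp_all
      then have "\<bar>g t x\<bar> \<le> mu T (N + 1) * x + \<eta> + (mu T (N + 1) + \<eta> * x)"
        using bounds[OF that] \<eta> by argo
      also have "\<dots> = G * (1 + x)" by (simp add: G_def algebra_simps)
      finally show ?thesis .
    qed
  qed (rule T)
  have LL_upper: "(\<integral>\<^sup>+ t. e2ennreal (Limsup at_top (\<lambda>x. ereal (g t x - mu T (N + 1) * x)) * ereal (psi T (N + 1) (t + \<tau>))) \<partial>lebesgue_on {0..T})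
      < (\<integral>\<^sup>+ t. e2ennreal (- (Limsup at_top (\<lambda>x. ereal (g t x - mu T (N + 1) * x)) * ereal (psi T (N + 1) (t + \<tau>)))) \<partial>lebesgue_on {0..T})"
    if "\<tau> \<in> {0..T}" for \<tau>
    by (rule ereal_diff_neg) (use assms(6) that in \<open>simp add: ereal_integral_def\<close>)
  \<comment> \<open>The negative part has a finite integral: it is at most \<eta> pointwise, since
    the lower limit is at least - \<eta> and \<open>psi\<close> takes values in [0, 1].\<close>
  have LL_lower: "(\<integral>\<^sup>+ t. e2ennreal (- (Liminf at_top (\<lambda>x. ereal (g t x - mu T N * x)) * ereal (psi T N (t + \<tau>)))) \<partial>lebesgue_on {0..T})
      < (\<integral>\<^sup>+ t. e2ennreal (Liminf at_top (\<lambda>x. ereal (g t x - mu T N * x)) * ereal (psi T N (t + \<tau>))) \<partial>lebesgue_on {0..T})"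
    if "\<tau> \<in> {0..T}" for \<tau>
  proof -
    let ?L = "\<lambda>t. Liminf at_top (\<lambda>x. ereal (g t x - mu T N * x))"
    let ?h = "\<lambda>t. ?L t * ereal (psi T N (t + \<tau>))"
    have "(\<integral>\<^sup>+ t. e2ennreal (- ?h t) \<partial>lebesgue_on {0..T}) \<le> (\<integral>\<^sup>+ t. ennreal \<eta> \<partial>lebesgue_on {0..T})"
    proof (rule nn_integral_mono)
      fix t assume "t \<in> space (lebesgue_on {0..T})"
      then have t: "t \<in> {0..T}" by simp
      have "\<forall>\<^sub>F x in at_top. - ereal \<eta> \<le> ereal (g t x - mu T N * x)"
        using eventually_ge_at_top[of 0]
      proof eventually_elim
        case (elim x)
        then show ?case using bounds[OF t elim] by simp
      qed
      then have L: "- ereal \<eta> \<le> ?L t" by (rule Liminf_bounded)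
      have \<psi>: "0 \<le> psi T N (t + \<tau>)" "psi T N (t + \<tau>) \<le> 1"
        by (simp_all add: psi_eq_abs_sin[OF T \<open>N > 0\<close>])
      have "- ?h t \<le> ereal \<eta>"
      proof (cases "?L t")
        case (real l)
        then have "- \<eta> \<le> l" using L by simp
        then have "- \<eta> * psi T N (t + \<tau>) \<le> l * psi T N (t + \<tau>)" using \<psi>(1) by (rule mult_right_mono)
        moreover have "\<eta> * psi T N (t + \<tau>) \<le> \<eta> * 1" using \<psi>(2) \<eta> by (rule mult_left_mono)
        ultimately show ?thesis unfolding real by simp
      next
        case PInf
        then show ?thesis using \<psi>(1) \<eta> by (cases "psi T N (t + \<tau>) = 0") auto
      qed (use L in simp)
      then have "e2ennreal (- ?h t) \<le> e2ennreal (ereal \<eta>)" by (rule e2ennreal_mono)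
      also have "\<dots> = ennreal \<eta>" by (simp add: ennreal.abs_eq eq_onp_def)
      finally show "e2ennreal (- ?h t) \<le> ennreal \<eta>" .
    qed
    also have "\<dots> = ennreal (integral {0..T} (\<lambda>t. \<eta>))"
      by (rule nn_integral_eq_integral_Icc[OF continuous_on_const \<eta>])
    also have "\<dots> < top" by (rule ennreal_less_top)
    finally have fin: "(\<integral>\<^sup>+ t. e2ennreal (- ?h t) \<partial>lebesgue_on {0..T}) < top" .
    have "0 < ereal_integral (lebesgue_on {0..T}) ?h" by (rule assms(7)[rule_format, OF that])
    then show ?thesis unfolding ereal_integral_def using fin by (rule ereal_diff_pos)
  qed
  obtain A B C where bm: "bounce_motion A B C" and ret: "A T = A 0" "B T = B 0" "C T = C 0"
    and rest: "\<And>a b. 0 \<le> a \<Longrightarrow> a < b \<Longrightarrow> b \<le> T \<Longrightarrow> \<forall>t\<in>{a..b}. A t = 0 \<Longrightarrow> \<exists>t\<in>{a..b}. 0 \<le> g t 0"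
    using periodic_bounce_motion[OF \<open>N > 0\<close> \<eta> bounds LL_upper LL_lower] by metis
  have mo: "0 \<le> A t" "0 \<le> C t" "A t * C t = (B t)\<^sup>2"
    "(A has_real_derivative 2 * B t) (at t within {0..T})"
    "(B has_real_derivative C t - sqrt (A t) * g t (sqrt (A t))) (at t within {0..T})"
    if "t \<in> {0..T}" for t
    using bm that unfolding bounce_motion_def by blast+
  have g_int: "g (t + T * of_int k) x = g t x" if "0 \<le> x" for t x and k :: int
  proof -
    have nat: "g (t + T * real n) x = g t x" for t n
    proof (induction n)
      case (Suc n)
      have "t + T * real (Suc n) = (t + T * real n) + T" by (simp add: algebra_simps)
      then show ?case using Suc assms(3) that by metis
    qed simp
    show ?thesis
    proof (cases "0 \<le> k")
      case True
      then show ?thesis using nat[of t "nat k"] by simp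
    next
      case False
      then show ?thesis using nat[of "t + T * of_int k" "nat (- k)"] by simp
    qed
  qed
  have rm: "t rmod T \<in> {0..T}" for t using rmod_nonneg[of T t] rmod_le[of T t] T by auto
  have g_rm: "g (t rmod T) x = g t x" if "0 \<le> x" for t x
    using g_int[OF that, of "t rmod T" "\<lfloor>t / T\<rfloor>"] T by (simp add: rmod_def)
  let ?A = "\<lambda>t. A (t rmod T)" and ?B = "\<lambda>t. B (t rmod T)" and ?C = "\<lambda>t. C (t rmod T)"
  \<comment> \<open>Makes the derivatives of B at the two ends of the period agree, as the periodic
    extension demands.\<close>
  have gT: "g T (sqrt (A 0)) = g 0 (sqrt (A 0))"
    using assms(3)[rule_format, of "sqrt (A 0)" 0] mo(1)[of 0] T by simp
  have dA: "(?A has_real_derivative 2 * ?B t) (at t)" for t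
    using periodic_extension_derivative[OF T mo(4) ret(1), of t] ret(2) by simp
  have dB: "(?B has_real_derivative ?C t - sqrt (?A t) * g t (sqrt (?A t))) (at t)" for t
    using periodic_extension_derivative[OF T mo(5) ret(2), of t] ret gT
      g_rm[of "sqrt (?A t)" t] mo(1)[OF rm] by simp
  \<comment> \<open>The interval may reach over several periods. Only its part in the period cell of
    a is used, translated by c into [0, T].\<close>
  have rest': "\<exists>t\<in>{a..b}. 0 \<le> g t 0" if ab: "a < b" and zero: "\<forall>t\<in>{a..b}. ?A t = 0" for a b
  proof -
    define c where "c = T * of_int \<lfloor>a / T\<rfloor>"
    have a: "0 \<le> a - c" "a - c < T"
      using rmod_nonneg[of T a] rmod_less[of T a] T by (simp_all add: rmod_def c_def)
    define d where "d = min (b - c) T"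
    have d: "a - c < d" "d \<le> T" "d \<le> b - c" using ab a by (auto simp: d_def)
    have "A u = 0" if u: "u \<in> {a - c..d}" for u
    proof -
      have "?A (u + c) = 0" using zero u d by simp
      moreover have "?A (u + c) = A u"
      proof (cases "u = T")
        case True
        have "T + c = T * of_int (\<lfloor>a / T\<rfloor> + 1)" by (simp add: c_def algebra_simps)
        then have "(T + c) rmod T = 0" using rmod_self_multiple_int'[of T] by metis
        then show ?thesis using True ret by simp
      next
        case False
        then have "0 \<le> u" "u < T" using u a d by auto
        then have "(u + c) rmod T = u"
          using T by (simp add: rmod_def c_def add_divide_distrib floor_eq_iff)
        then show ?thesis by simp
      qed
      ultimately show ?thesis by simp
    qed
    then obtain u where u: "u \<in> {a - c..d}" "0 \<le> g u 0" using rest[OF a(1) d(1,2)] by blast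
    have "g (u + c) 0 = g u 0" unfolding c_def by (rule g_int) simp
    then show ?thesis using u d by (intro bexI[of _ "u + c"]) auto
  qed
  have "bouncing_solution 0 g (- \<infinity>) \<infinity> (\<lambda>t. sqrt (?A t))"
    using mo(1-3)[OF rm] dA dB cont[of UNIV "\<lambda>t. t" "\<lambda>_. 0"] rest'
    by (intro sqrt_motion_bouncing[of ?A ?C ?B]) auto
  moreover have "sqrt (?A (t + T)) = sqrt (?A t)" for t
    using T by (simp add: rmod_def add_divide_distrib algebra_simps)
  ultimately show ?thesis by blast
qed

end
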